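(* Let $\bar x\in\mathbb{R}^n$ and $(u,v)\in BV([a,b];U)\times L^1([a,b];V)$, and consider the Cauchy problem $$\dot x=f(t,x,u,v)+\sum_{\alpha=1}^m g_\alpha(x)\,\dot u_\alpha,\quad t\in[a,b],\qquad x(a)=\bar x.$$ A map $x:[a,b]\to\mathbb{R}^n$ is a graph completion (g.c.) solution of this Cauchy problem corresponding to $(\bar x,u,v)$ if and only if $x$ is a BV simple limit solution of this Cauchy problem corresponding to $\bar x$ and $(u,v)$.
   Context: Notation. $[a,b]$ is a compact interval. For $E\subset\mathbb{R}^d$: $\mathcal{L}^1([a,b];E)$ is the set of pointwise (everywhere) defined Lebesgue integrable functions from $[a,b]$ with values in $E$, while $L^1([a,b];E)$ is the corresponding set of equivalence classes modulo equality a.e.; $AC([a,b];E)$ is the set of absolutely continuous maps, and $BV([a,b];E)$ the set of (everywhere defined) maps of bounded total variation, from $[a,b]$ to $E$. "Increasing" means nondecreasing. $\|\cdot\|_1$ is the $L^1$-norm. Standing hypotheses. Here $f:[a,b]\times\mathbb{R}^n\times\mathbb{R}^m\times V\to\mathbb{R}^n$ and $g_1,\dots,g_m:\mathbb{R}^n\to\mathbb{R}^n$. (i) $U\subset\mathbb{R}^m$ is compact and such that for every bounded interval $I\subset\mathbb{R}$, each $\tau\in I$ and every $w\in\mathcal{L}^1(I;U)$ there is a sequence $(w_k^\tau)\subset AC(I;U)$ with $|w_k^\tau(\tau)-w(\tau)|+\|w_k^\tau-w\|_1\to0$. (ii) $V\subset\mathbb{R}^l$ is compact. (iii) For each $(x,u,v)$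 the map $t\mapsto f(t,x,u,v)$ is measurable on $[a,b]$; for each $t\in[a,b]$ the map $(x,u,v)\mapsto f(t,x,u,v)$ is continuous on $\mathbb{R}^n\times\mathbb{R}^m\times V$; and $(x,u)\mapsto f(t,x,u,v)$ is locally Lipschitz on $\mathbb{R}^n\times\mathbb{R}^m$, uniformly in $(t,v)\in[a,b]\times V$. (iv) Each $g_\alpha$ is of class $C^1$. (v) There is $M>0$ with $|(f(t,x,u,v),g_1(x),\dots,g_m(x))|\le M(1+|(x,u)|)$ for every $(x,u)\in\mathbb{R}^n\times\mathbb{R}^m$, uniformly in $(t,v)\in[a,b]\times V$. Under (ii)–(v), for $\bar x\in\mathbb{R}^n$ and $(u,v)\in AC([a,b];U)\times L^1([a,b];V)$ the Cauchy problem has a unique Carathéodory solution on $[a,b]$. Limit solutions. Let $\bar x\in\mathbb{R}^n$, $u\in\mathcal{L}^1([a,b];U)$, $v\in L^1([a,b];V)$. A map $x:[a,b]\to\mathbb{R}^n$ is a limit solution of the Cauchy problem corresponding to $\bar x$ and $(u,v)$ if for every $\tau\in[a,b]$ there is a sequence $(u_k^\tau)$ of absolutely continuous maps from $[a,b]$ into $U$ such that: for each $k$ there exists a Carathéodory solution $x_k^\tau:[a,b]\to\mathbb{R}^n$ of the Cauchy problem with initial value $\bar x$ and control $(u_k^\tau,v)$, the sequence $(x_k^\tau)$ is bounded, and $$|(x_k^\tau,u_k^\tau)(\tau)-(x,u)(\tau)|+\|(x_k^\tau,u_k^\tau)-(x,u)\|_1\to0 .$$ A limit solution is simple if $(u_k^\tau)$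 can be chosen independently of $\tau$ (the sequence is then written $(u_k)$). A simple limit solution is a BV simple limit solution if the approximating inputs $u_k$ (chosen independently of $\tau$) have equibounded variation on $[a,b]$. Graph completion solutions. Let $\mathcal{U}$ be the set of Lipschitz maps $(\varphi_0,\varphi):[0,1]\to[a,b]\times U$ such that $\varphi_0:[0,1]\to[a,b]$ is increasing and surjective. For $(\varphi_0,\varphi)\in\mathcal{U}$ and $\psi\in L^1([0,1];V)$ consider the space-time system on $[0,1]$ $$y_0'(s)=\varphi_0'(s),\qquad y'(s)=f(y_0(s),y(s),\varphi(s),\psi(s))\,\varphi_0'(s)+\sum_{\alpha=1}^m g_\alpha(y(s))\,\varphi_\alpha'(s),\qquad (y_0,y)(0)=(a,\bar x),$$ whose unique solution is denoted $(y_0,y)[\varphi_0,\varphi,\psi]$. Given $v\in L^1([a,b];V)$, take a Borel measurable representative of $v$ and write $y[\varphi_0,\varphi;v]$ for the $y$-component of the solution with $\psi:=v\circ\varphi_0$. A graph completion (g.c.) of $u\in BV([a,b];U)$ is an element $(\varphi_0,\varphi)\in\mathcal{U}$ such that for every $t\in[a,b]$ there is $s\in[0,1]$ with $(t,u(t))=(\varphi_0,\varphi)(s)$. A clock corresponding to a graph completion $(\varphi_0,\varphi)$ of $u$ is a map $\sigma:[a,b]\to[0,1]$ with $(\varphi_0,\varphi)\circ\sigma(t)=(t,u(t))$ for every $t\in[a,b]$. A map $x:[a,b]\to\mathbb{R}^n$ is a g.c. solution of the Cauchy problem corresponding to $(\bar x,u,v)$ if it satisfies the initial condition $x(a)=\bar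 x$ and there exist a graph completion $(\varphi_0,\varphi)$ of $u$ and a corresponding clock $\sigma$ such that $x(t)=y[\varphi_0,\varphi;v](\sigma(t))$ for every $t\in[a,b]$. *)

theory Defs
  imports "HOL-Analysis.Analysis"
begin

section \<open>Function spaces\<close>

text \<open>
  Everywhere defined Lebesgue integrable maps from \<open>S\<close> to \<open>E\<close>. An element of the quotient
  \<open>L^1(S; E)\<close> is given by such a representative; every notion below that takes an argument
  \<open>v\<close> from \<open>L^1\<close> depends on \<open>v\<close> only up to equality almost everywhere.
\<close>
definition L1_maps :: "real set \<Rightarrow> ('e::euclidean_space) set \<Rightarrow> (real \<Rightarrow> 'e) set" where
  "L1_maps S E = {w. w absolutely_integrable_on S \<and> w ` S \<subseteq> E}"

definition L1_norm :: "real set \<Rightarrow> (real \<Rightarrow> 'e::euclidean_space) \<Rightarrow> real" where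
  "L1_norm S h = (LINT t:S|lebesgue. norm (h t))"

text \<open>
  The integrability conjunct is needed because the Bochner integral of a non-integrable
  function is \<open>0\<close>.
\<close>
definition tendsto_at_and_L1 ::
    "real set \<Rightarrow> real \<Rightarrow> (nat \<Rightarrow> real \<Rightarrow> 'e::euclidean_space) \<Rightarrow> (real \<Rightarrow> 'e) \<Rightarrow> bool" where
  "tendsto_at_and_L1 S \<tau> wk w \<longleftrightarrow>
     (\<forall>k. (\<lambda>t. wk k t - w t) absolutely_integrable_on S) \<and>
     (\<lambda>k. norm (wk k \<tau> - w \<tau>) + L1_norm S (\<lambda>t. wk k t - w t)) \<longlonglongrightarrow> 0"

text \<open>
  The finite families of nonoverlapping compact intervals in \<open>S\<close> are the divisions \<open>d\<close> of
  subsets of \<open>S\<close>; \<open>Inf k\<close> and \<open>Sup k\<close> are the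
  endpoints of \<open>k \<in> d\<close>.
\<close>
definition abs_continuous_on :: "real set \<Rightarrow> (real \<Rightarrow> 'e::euclidean_space) \<Rightarrow> bool" where
  "abs_continuous_on S h \<longleftrightarrow>
     (\<forall>\<epsilon>>0. \<exists>\<delta>>0. \<forall>d T. d division_of T \<and> T \<subseteq> S \<and> (\<Sum>k\<in>d. Sup k - Inf k) < \<delta> \<longrightarrow>
        (\<Sum>k\<in>d. norm (h (Sup k) - h (Inf k))) < \<epsilon>)"

definition AC_maps :: "real set \<Rightarrow> ('e::euclidean_space) set \<Rightarrow> (real \<Rightarrow> 'e) set" where
  "AC_maps S E = {w. abs_continuous_on S w \<and> w ` S \<subseteq> E}"

definition total_variation :: "real \<Rightarrow> real \<Rightarrow> (real \<Rightarrow> 'e::euclidean_space) \<Rightarrow> ennreal" where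
  "total_variation a b h =
     (SUP d \<in> {d. d division_of {a..b}}. ennreal (\<Sum>k\<in>d. norm (h (Sup k) - h (Inf k))))"

definition BV_maps :: "real \<Rightarrow> real \<Rightarrow> ('e::euclidean_space) set \<Rightarrow> (real \<Rightarrow> 'e) set" where
  "BV_maps a b E = {w. total_variation a b w < \<infinity> \<and> w ` {a..b} \<subseteq> E}"

definition C1_map :: "(real^'n \<Rightarrow> real^'n) \<Rightarrow> bool" where
  "C1_map h \<longleftrightarrow> (\<exists>h' :: real^'n \<Rightarrow> (real^'n) \<Rightarrow>\<^sub>L (real^'n).
     (\<forall>x. (h has_derivative blinfun_apply (h' x)) (at x)) \<and> continuous_on UNIV h')"

definition AC_approximable :: "('e::euclidean_space) set \<Rightarrow> bool" where
  "AC_approximable U \<longleftrightarrow>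
     (\<forall>I. is_interval I \<and> bounded I \<longrightarrow>
        (\<forall>\<tau>\<in>I. \<forall>w\<in>L1_maps I U.
           \<exists>wk. (\<forall>k. wk k \<in> AC_maps I U) \<and> tendsto_at_and_L1 I \<tau> wk w))"


section \<open>Caratheodory solutions and limit solutions\<close>

text \<open>
  Here \<open>u\<close> is meant to be absolutely continuous, so that it is differentiable almost everywhere
  and \<open>vector_derivative\<close> yields its derivative there.
\<close>
definition caratheodory_solution ::
    "(real \<Rightarrow> real^'n \<Rightarrow> real^'m \<Rightarrow> real^'l \<Rightarrow> real^'n) \<Rightarrow> ('m \<Rightarrow> real^'n \<Rightarrow> real^'n) \<Rightarrow>
     real \<Rightarrow> real \<Rightarrow> real^'n \<Rightarrow> (real \<Rightarrow> real^'m) \<Rightarrow> (real \<Rightarrow> real^'l) \<Rightarrow> (real \<Rightarrow> real^'n) \<Rightarrow> bool" where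
  "caratheodory_solution f g a b xbar u v x \<longleftrightarrow>
     abs_continuous_on {a..b} x \<and> x a = xbar \<and>
     (AE t in lebesgue_on {a..b}.
        (x has_vector_derivative
           (f t (x t) (u t) (v t) +
            (\<Sum>\<alpha>\<in>UNIV. (vector_derivative u (at t within {a..b}) $ \<alpha>) *\<^sub>R g \<alpha> (x t))))
        (at t within {a..b}))"

definition approximates_at ::
    "(real \<Rightarrow> real^'n \<Rightarrow> real^'m \<Rightarrow> real^'l \<Rightarrow> real^'n) \<Rightarrow> ('m \<Rightarrow> real^'n \<Rightarrow> real^'n) \<Rightarrow>
     real \<Rightarrow> real \<Rightarrow> real^'n \<Rightarrow> (real \<Rightarrow> real^'m) \<Rightarrow> (real \<Rightarrow> real^'l) \<Rightarrow> (real \<Rightarrow> real^'n) \<Rightarrow>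
     real \<Rightarrow> (nat \<Rightarrow> real \<Rightarrow> real^'m) \<Rightarrow> bool" where
  "approximates_at f g a b xbar u v x \<tau> uk \<longleftrightarrow>
     (\<exists>xk. (\<forall>k. caratheodory_solution f g a b xbar (uk k) v (xk k)) \<and>
           (\<exists>C. \<forall>k. \<forall>t\<in>{a..b}. norm (xk k t) \<le> C) \<and>
           tendsto_at_and_L1 {a..b} \<tau> (\<lambda>k t. (xk k t, uk k t)) (\<lambda>t. (x t, u t)))"

definition limit_solution ::
    "(real \<Rightarrow> real^'n \<Rightarrow> real^'m \<Rightarrow> real^'l \<Rightarrow> real^'n) \<Rightarrow> ('m \<Rightarrow> real^'n \<Rightarrow> real^'n) \<Rightarrow>
     real \<Rightarrow> real \<Rightarrow> (real^'m) set \<Rightarrow>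
     real^'n \<Rightarrow> (real \<Rightarrow> real^'m) \<Rightarrow> (real \<Rightarrow> real^'l) \<Rightarrow> (real \<Rightarrow> real^'n) \<Rightarrow> bool" where
  "limit_solution f g a b U xbar u v x \<longleftrightarrow>
     (\<forall>\<tau>\<in>{a..b}. \<exists>uk. (\<forall>k. uk k \<in> AC_maps {a..b} U) \<and>
        approximates_at f g a b xbar u v x \<tau> uk)"

definition simple_limit_solution ::
    "(real \<Rightarrow> real^'n \<Rightarrow> real^'m \<Rightarrow> real^'l \<Rightarrow> real^'n) \<Rightarrow> ('m \<Rightarrow> real^'n \<Rightarrow> real^'n) \<Rightarrow>
     real \<Rightarrow> real \<Rightarrow> (real^'m) set \<Rightarrow>
     real^'n \<Rightarrow> (real \<Rightarrow> real^'m) \<Rightarrow> (real \<Rightarrow> real^'l) \<Rightarrow> (real \<Rightarrow> real^'n) \<Rightarrow> bool" where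
  "simple_limit_solution f g a b U xbar u v x \<longleftrightarrow>
     (\<exists>uk. (\<forall>k. uk k \<in> AC_maps {a..b} U) \<and>
        (\<forall>\<tau>\<in>{a..b}. approximates_at f g a b xbar u v x \<tau> uk))"

definition BV_simple_limit_solution ::
    "(real \<Rightarrow> real^'n \<Rightarrow> real^'m \<Rightarrow> real^'l \<Rightarrow> real^'n) \<Rightarrow> ('m \<Rightarrow> real^'n \<Rightarrow> real^'n) \<Rightarrow>
     real \<Rightarrow> real \<Rightarrow> (real^'m) set \<Rightarrow>
     real^'n \<Rightarrow> (real \<Rightarrow> real^'m) \<Rightarrow> (real \<Rightarrow> real^'l) \<Rightarrow> (real \<Rightarrow> real^'n) \<Rightarrow> bool" where
  "BV_simple_limit_solution f g a b U xbar u v x \<longleftrightarrow>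
     (\<exists>uk. (\<forall>k. uk k \<in> AC_maps {a..b} U) \<and>
        (\<exists>K::real. \<forall>k. total_variation a b (uk k) \<le> ennreal K) \<and>
        (\<forall>\<tau>\<in>{a..b}. approximates_at f g a b xbar u v x \<tau> uk))"

lemma simple_limit_solution_imp_limit_solution:
  "simple_limit_solution f g a b U xbar u v x \<Longrightarrow> limit_solution f g a b U xbar u v x"
  unfolding simple_limit_solution_def limit_solution_def by blast

lemma BV_simple_limit_solution_imp_simple_limit_solution:
  "BV_simple_limit_solution f g a b U xbar u v x \<Longrightarrow> simple_limit_solution f g a b U xbar u v x"
  unfolding BV_simple_limit_solution_def simple_limit_solution_def by blast


section \<open>Graph completion solutions\<close>

definition space_time_controls ::
    "real \<Rightarrow> real \<Rightarrow> (real^'m) set \<Rightarrow> ((real \<Rightarrow> real) \<times> (real \<Rightarrow> real^'m)) set" where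
  "space_time_controls a b U =
     {(\<phi>0, \<phi>). (\<exists>L. L-lipschitz_on {0..1} (\<lambda>s. (\<phi>0 s, \<phi> s))) \<and>
        \<phi> ` {0..1} \<subseteq> U \<and> mono_on {0..1} \<phi>0 \<and> \<phi>0 ` {0..1} = {a..b}}"

definition space_time_solution ::
    "(real \<Rightarrow> real^'n \<Rightarrow> real^'m \<Rightarrow> real^'l \<Rightarrow> real^'n) \<Rightarrow> ('m \<Rightarrow> real^'n \<Rightarrow> real^'n) \<Rightarrow>
     real \<Rightarrow> real^'n \<Rightarrow> (real \<Rightarrow> real) \<Rightarrow> (real \<Rightarrow> real^'m) \<Rightarrow> (real \<Rightarrow> real^'l) \<Rightarrow>
     (real \<Rightarrow> real) \<Rightarrow> (real \<Rightarrow> real^'n) \<Rightarrow> bool" where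
  "space_time_solution f g a xbar \<phi>0 \<phi> \<psi> y0 y \<longleftrightarrow>
     abs_continuous_on {0..1} y0 \<and> abs_continuous_on {0..1} y \<and> y0 0 = a \<and> y 0 = xbar \<and>
     (AE s in lebesgue_on {0..1}.
        (y0 has_vector_derivative vector_derivative \<phi>0 (at s within {0..1})) (at s within {0..1}) \<and>
        (y has_vector_derivative
           (vector_derivative \<phi>0 (at s within {0..1}) *\<^sub>R f (y0 s) (y s) (\<phi> s) (\<psi> s) +
            (\<Sum>\<alpha>\<in>UNIV. (vector_derivative \<phi> (at s within {0..1}) $ \<alpha>) *\<^sub>R g \<alpha> (y s))))
        (at s within {0..1}))"

definition borel_representative ::
    "real \<Rightarrow> real \<Rightarrow> (real^'l) set \<Rightarrow> (real \<Rightarrow> real^'l) \<Rightarrow> (real \<Rightarrow> real^'l) \<Rightarrow> bool" where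
  "borel_representative a b V v w \<longleftrightarrow>
     w \<in> borel_measurable (restrict_space borel {a..b}) \<and> w ` {a..b} \<subseteq> V \<and>
     (AE t in lebesgue_on {a..b}. w t = v t)"

definition graph_completion ::
    "real \<Rightarrow> real \<Rightarrow> (real^'m) set \<Rightarrow> (real \<Rightarrow> real^'m) \<Rightarrow>
     (real \<Rightarrow> real) \<Rightarrow> (real \<Rightarrow> real^'m) \<Rightarrow> bool" where
  "graph_completion a b U u \<phi>0 \<phi> \<longleftrightarrow>
     (\<phi>0, \<phi>) \<in> space_time_controls a b U \<and>
     (\<forall>t\<in>{a..b}. \<exists>s\<in>{0..1}. (t, u t) = (\<phi>0 s, \<phi> s))"

definition is_clock ::
    "real \<Rightarrow> real \<Rightarrow> (real \<Rightarrow> real^'m) \<Rightarrow> (real \<Rightarrow> real) \<Rightarrow> (real \<Rightarrow> real^'m) \<Rightarrow>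
     (real \<Rightarrow> real) \<Rightarrow> bool" where
  "is_clock a b u \<phi>0 \<phi> \<sigma> \<longleftrightarrow>
     (\<forall>t\<in>{a..b}. \<sigma> t \<in> {0..1} \<and> (\<phi>0 (\<sigma> t), \<phi> (\<sigma> t)) = (t, u t))"

text \<open>
  The solution \<open>(y0, y)\<close> of the space-time system is unique and does not depend on the choice of
  the Borel representative \<open>w\<close> of \<open>v\<close>, so existential quantifiers express the mathematical
  definition.
\<close>
definition gc_solution ::
    "(real \<Rightarrow> real^'n \<Rightarrow> real^'m \<Rightarrow> real^'l \<Rightarrow> real^'n) \<Rightarrow> ('m \<Rightarrow> real^'n \<Rightarrow> real^'n) \<Rightarrow>
     real \<Rightarrow> real \<Rightarrow> (real^'m) set \<Rightarrow> (real^'l) set \<Rightarrow>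
     real^'n \<Rightarrow> (real \<Rightarrow> real^'m) \<Rightarrow> (real \<Rightarrow> real^'l) \<Rightarrow> (real \<Rightarrow> real^'n) \<Rightarrow> bool" where
  "gc_solution f g a b U V xbar u v x \<longleftrightarrow>
     x a = xbar \<and>
     (\<exists>\<phi>0 \<phi> \<sigma> w y0 y.
        graph_completion a b U u \<phi>0 \<phi> \<and> is_clock a b u \<phi>0 \<phi> \<sigma> \<and>
        borel_representative a b V v w \<and>
        space_time_solution f g a xbar \<phi>0 \<phi> (w \<circ> \<phi>0) y0 y \<and>
        (\<forall>t\<in>{a..b}. x t = y (\<sigma> t)))"

end

theory Submission
  imports Defs "HOL-Complex_Analysis.Great_Picard"
begin

text \<open>
  Both kinds of solutions are described by one estimate that is free of derivatives of the
  control. Let \<open>H\<close> be the indefinite integral of the drift along the solution. An absolutely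
  continuous \<open>X\<close> with \<open>X' = H' + \<Sum>\<^sub>\<alpha> g\<^sub>\<alpha>(X) u\<^sub>\<alpha>'\<close> satisfies
  \<open>X(t) - X(s) = H(t) - H(s) + \<Sum>\<^sub>\<alpha> g\<^sub>\<alpha>(X(s)) (u\<^sub>\<alpha>(t) - u\<^sub>\<alpha>(s)) + O(m(s,t)\<^sup>2)\<close>, where \<open>m(s,t)\<close> is \<open>t - s\<close> plus
  the variation of \<open>u\<close> on \<open>[s,t]\<close>; conversely the estimate returns the differential equation at every
  point where \<open>H\<close> and \<open>u\<close> are differentiable. The estimate is invariant under
  reparametrization and passes to pointwise limits.

  Given a BV simple limit solution, parametrize the graphs of the inputs \<open>u\<^sub>k\<close> by arc length. By
  Arzela-Ascoli a subsequence of the reparametrized triples (time, input, trajectory) converges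
  uniformly, and the limit solves the space-time system by the estimate; a clock at \<open>t\<close> is any
  cluster point of the arc-length parameters of \<open>t\<close>. Conversely, a clock \<open>\<sigma>\<close> of a graph completion
  is increasing, hence the pointwise limit of increasing Lipschitz maps \<open>\<sigma>\<^sub>k\<close> that agree with \<open>\<sigma>\<close> on
  larger and larger finite sets, which eventually contain each discontinuity. The inputs
  \<open>\<phi> \<circ> \<sigma>\<^sub>k\<close> have bounded variation, and a Gronwall argument based on the estimate compares their
  trajectories with \<open>y \<circ> \<sigma>\<^sub>k\<close>.
\<close>

section \<open>Absolutely continuous functions\<close>

text \<open>The obstacle is the product of \<open>g \<alpha> (X t)\<close> with the derivative of
  the input: pointwise convergence of inputs of bounded variation gives no convergence of their
  derivatives, and both factors jump together. The increment estimate contains only values of the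
  input, so limits and time changes act on it term by term. The drift enters through its integral.
  Where \<open>\<phi>0\<close> has nonzero derivative its level set is a single point, so every
  clock passes through it; elsewhere the drift is multiplied by 0. Hence the drift integral along a
  completion is \<open>integral {a..t} (\<lambda>r. f r (x r) (u r) (v r))\<close> composed with
  \<open>\<phi>0\<close>, and a merely measurable \<open>v\<close> causes no trouble. Variation is
  measured through any \<open>\<nu>\<close> with
  \<open>norm (u t - u s) \<le> \<nu> t - \<nu> s\<close>: the variation function in one direction,
  \<open>L * \<sigma>k\<close> in the other. In the Gronwall step the drift error is uniformly
  small, but its increments are not small relative to those of time and variation, so it is added to
  the difference of trajectories before increments are taken.\<close>

lemma division_of_real_interval:
  fixes k :: "real set"
  assumes "d division_of T" "k \<in> d"
  shows "k = {Inf k..Sup k}" "Inf k \<le> Sup k" "Inf k \<in> T" "Sup k \<in> T"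
proof -
  obtain p q where k: "k = cbox p q" using division_ofD(4)[OF assms] by blast
  have "k \<noteq> {}" "k \<subseteq> T" using division_ofD(2,3)[OF assms] by auto
  then show "k = {Inf k..Sup k}" "Inf k \<le> Sup k" "Inf k \<in> T" "Sup k \<in> T"
    using k by auto
qed

lemma division_of_measure_eq:
  fixes k :: "real set"
  assumes "d division_of T" "k \<in> d"
  shows "measure lebesgue k = Sup k - Inf k" "measure lborel k = Sup k - Inf k"
proof -
  have "k = {Inf k..Sup k}" "Inf k \<le> Sup k" using division_of_real_interval[OF assms] by auto
  moreover have "measure lborel {x..y} = y - x" "measure lebesgue {x..y} = y - x" if "x \<le> y" for x y :: real
    using that by simp_all
  ultimately show "measure lebesgue k = Sup k - Inf k" "measure lborel k = Sup k - Inf k" by metis+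
qed

lemma abs_continuous_on_subset:
  "abs_continuous_on S h \<Longrightarrow> S' \<subseteq> S \<Longrightarrow> abs_continuous_on S' h"
  unfolding abs_continuous_on_def by (meson order_trans)

lemma abs_continuous_on_dominated:
  assumes g: "abs_continuous_on S g" and C: "0 \<le> C"
    and le: "\<And>s t. s \<in> S \<Longrightarrow> t \<in> S \<Longrightarrow> s \<le> t \<Longrightarrow> norm (h t - h s) \<le> C * norm (g t - g s)"
  shows "abs_continuous_on S h"
  unfolding abs_continuous_on_def
proof (intro allI impI)
  fix \<epsilon> :: real assume "0 < \<epsilon>"
  \<comment> \<open>\<open>C + 1\<close> because \<open>C\<close> may be 0.\<close>
  then have "0 < \<epsilon> / (C + 1)" using C by simp
  then obtain \<delta> where "\<delta> > 0" and \<delta>: "\<And>d T. d division_of T \<Longrightarrow> T \<subseteq> S \<Longrightarrow> (\<Sum>k\<in>d. Sup k - Inf k) < \<delta> \<Longrightarrow>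
        (\<Sum>k\<in>d. norm (g (Sup k) - g (Inf k))) < \<epsilon> / (C + 1)"
    using g unfolding abs_continuous_on_def by meson
  show "\<exists>\<delta>>0. \<forall>d T. d division_of T \<and> T \<subseteq> S \<and> (\<Sum>k\<in>d. Sup k - Inf k) < \<delta> \<longrightarrow>
        (\<Sum>k\<in>d. norm (h (Sup k) - h (Inf k))) < \<epsilon>"
  proof (intro exI[of _ \<delta>] conjI allI impI)
    fix d T assume d: "d division_of T \<and> T \<subseteq> S \<and> (\<Sum>k\<in>d. Sup k - Inf k) < \<delta>"
    have "(\<Sum>k\<in>d. norm (h (Sup k) - h (Inf k))) \<le> (\<Sum>k\<in>d. C * norm (g (Sup k) - g (Inf k)))"
    proof (rule sum_mono)
      fix k assume "k \<in> d"
      with d division_of_real_interval[of d T k] show "norm (h (Sup k) - h (Inf k)) \<le> C * norm (g (Sup k) - g (Inf k))"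
        by (intro le) auto
    qed
    also have "\<dots> = C * (\<Sum>k\<in>d. norm (g (Sup k) - g (Inf k)))" by (simp add: sum_distrib_left)
    also have "\<dots> \<le> C * (\<epsilon> / (C + 1))"
      using \<delta>[of d T] d C by (intro mult_left_mono) auto
    also have "\<dots> < \<epsilon>" using \<open>0 < \<epsilon>\<close> C by (simp add: field_simps)
    finally show "(\<Sum>k\<in>d. norm (h (Sup k) - h (Inf k))) < \<epsilon>" .
  qed (fact \<open>\<delta> > 0\<close>)
qed

lemma abs_continuous_on_ident: "abs_continuous_on S (\<lambda>t. t)"
  unfolding abs_continuous_on_def
proof (intro allI impI)
  fix \<epsilon> :: real assume "0 < \<epsilon>"
  show "\<exists>\<delta>>0. \<forall>d T. d division_of T \<and> T \<subseteq> S \<and> (\<Sum>k\<in>d. Sup k - Inf k) < \<delta> \<longrightarrow>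
        (\<Sum>k\<in>d. norm (Sup k - Inf k)) < \<epsilon>"
  proof (intro exI[of _ \<epsilon>] conjI allI impI)
    fix d T assume d: "d division_of T \<and> T \<subseteq> S \<and> (\<Sum>k\<in>d. Sup k - Inf k) < \<epsilon>"
    have "(\<Sum>k\<in>d. norm (Sup k - Inf k)) = (\<Sum>k\<in>d. Sup k - Inf k)"
      using division_of_real_interval(2)[of d T] d by (intro sum.cong) auto
    then show "(\<Sum>k\<in>d. norm (Sup k - Inf k)) < \<epsilon>" using d by simp
  qed (fact \<open>0 < \<epsilon>\<close>)
qed

lemma abs_continuous_on_lipschitz:
  assumes "\<And>s t. s \<in> S \<Longrightarrow> t \<in> S \<Longrightarrow> s \<le> t \<Longrightarrow> norm (h t - h s) \<le> C * (t - s)"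
  shows "abs_continuous_on S h"
proof (rule abs_continuous_on_dominated[OF abs_continuous_on_ident, of "max 0 C"])
  fix s t assume "s \<in> S" "t \<in> S" "s \<le> t"
  then have "norm (h t - h s) \<le> C * (t - s)" by (rule assms)
  also have "\<dots> \<le> max 0 C * norm (t - s)"
    using \<open>s \<le> t\<close> by (auto intro!: mult_right_mono)
  finally show "norm (h t - h s) \<le> max 0 C * norm (t - s)" .
qed simp

text \<open>Sums and differences share one proof, since their increments obey the same triangle
  inequality.\<close>

lemma abs_continuous_on_add_dominated:
  assumes f: "abs_continuous_on S f" and g: "abs_continuous_on S g"
    and le: "\<And>s t. s \<in> S \<Longrightarrow> t \<in> S \<Longrightarrow> s \<le> t \<Longrightarrow> norm (h t - h s) \<le> norm (f t - f s) + norm (g t - g s)"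
  shows "abs_continuous_on S h"
  unfolding abs_continuous_on_def
proof (intro allI impI)
  fix \<epsilon> :: real assume "0 < \<epsilon>"
  then have e: "0 < \<epsilon> / 2" by simp
  obtain \<delta>1 where "\<delta>1 > 0" and \<delta>1: "\<And>d T. d division_of T \<Longrightarrow> T \<subseteq> S \<Longrightarrow> (\<Sum>k\<in>d. Sup k - Inf k) < \<delta>1 \<Longrightarrow>
        (\<Sum>k\<in>d. norm (f (Sup k) - f (Inf k))) < \<epsilon> / 2"
    using f e unfolding abs_continuous_on_def by meson
  obtain \<delta>2 where "\<delta>2 > 0" and \<delta>2: "\<And>d T. d division_of T \<Longrightarrow> T \<subseteq> S \<Longrightarrow> (\<Sum>k\<in>d. Sup k - Inf k) < \<delta>2 \<Longrightarrow>
        (\<Sum>k\<in>d. norm (g (Sup k) - g (Inf k))) < \<epsilon> / 2"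
    using g e unfolding abs_continuous_on_def by meson
  show "\<exists>\<delta>>0. \<forall>d T. d division_of T \<and> T \<subseteq> S \<and> (\<Sum>k\<in>d. Sup k - Inf k) < \<delta> \<longrightarrow>
        (\<Sum>k\<in>d. norm (h (Sup k) - h (Inf k))) < \<epsilon>"
  proof (intro exI[of _ "min \<delta>1 \<delta>2"] conjI allI impI)
    fix d T assume d: "d division_of T \<and> T \<subseteq> S \<and> (\<Sum>k\<in>d. Sup k - Inf k) < min \<delta>1 \<delta>2"
    have "(\<Sum>k\<in>d. norm (h (Sup k) - h (Inf k)))
        \<le> (\<Sum>k\<in>d. norm (f (Sup k) - f (Inf k)) + norm (g (Sup k) - g (Inf k)))"
    proof (rule sum_mono)
      fix k assume "k \<in> d"
      with d division_of_real_interval[of d T k]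
      show "norm (h (Sup k) - h (Inf k)) \<le> norm (f (Sup k) - f (Inf k)) + norm (g (Sup k) - g (Inf k))"
        by (intro le) auto
    qed
    also have "\<dots> < \<epsilon> / 2 + \<epsilon> / 2"
      unfolding sum.distrib using \<delta>1[of d T] \<delta>2[of d T] d by (intro add_strict_mono) auto
    finally show "(\<Sum>k\<in>d. norm (h (Sup k) - h (Inf k))) < \<epsilon>" by simp
  qed (use \<open>\<delta>1 > 0\<close> \<open>\<delta>2 > 0\<close> in auto)
qed

lemma abs_continuous_on_diff:
  assumes f: "abs_continuous_on S f" and g: "abs_continuous_on S g"
  shows "abs_continuous_on S (\<lambda>t. f t - g t)"
proof (rule abs_continuous_on_add_dominated[OF f g])
  fix s t
  have "f t - g t - (f s - g s) = (f t - f s) - (g t - g s)" by simp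
  then show "norm (f t - g t - (f s - g s)) \<le> norm (f t - f s) + norm (g t - g s)"
    by (metis norm_triangle_ineq4)
qed

lemma abs_continuous_on_add:
  assumes f: "abs_continuous_on S f" and g: "abs_continuous_on S g"
  shows "abs_continuous_on S (\<lambda>t. f t + g t)"
proof (rule abs_continuous_on_add_dominated[OF f g])
  fix s t
  have "f t + g t - (f s + g s) = (f t - f s) + (g t - g s)" by simp
  then show "norm (f t + g t - (f s + g s)) \<le> norm (f t - f s) + norm (g t - g s)"
    by (metis norm_triangle_ineq)
qed

lemma abs_continuous_on_small_interval:
  assumes "abs_continuous_on {a..b} h" "0 < \<epsilon>"
  obtains \<delta> where "0 < \<delta>"
    "\<And>s t. a \<le> s \<Longrightarrow> s \<le> t \<Longrightarrow> t \<le> b \<Longrightarrow> t - s < \<delta> \<Longrightarrow> norm (h t - h s) < \<epsilon>"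
proof -
  obtain \<delta> where "\<delta> > 0" and \<delta>: "\<And>d T. d division_of T \<Longrightarrow> T \<subseteq> {a..b} \<Longrightarrow> (\<Sum>k\<in>d. Sup k - Inf k) < \<delta> \<Longrightarrow>
        (\<Sum>k\<in>d. norm (h (Sup k) - h (Inf k))) < \<epsilon>"
    using assms unfolding abs_continuous_on_def by meson
  have "norm (h t - h s) < \<epsilon>" if "a \<le> s" "s \<le> t" "t \<le> b" "t - s < \<delta>" for s t
  proof -
    have "{{s..t}} division_of {s..t}"
      using division_of_self[of s t] that by simp
    from \<delta>[OF this] show ?thesis using that by simp
  qed
  with \<open>\<delta> > 0\<close> that show ?thesis by blast
qed

lemma abs_continuous_on_imp_continuous_on:
  assumes "abs_continuous_on {a..b} h"
  shows "continuous_on {a..b} h"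
  unfolding continuous_on_iff
proof (intro ballI allI impI)
  fix x \<epsilon> :: real assume x: "x \<in> {a..b}" and "0 < \<epsilon>"
  obtain \<delta> where "0 < \<delta>" and
    \<delta>: "\<And>s t. a \<le> s \<Longrightarrow> s \<le> t \<Longrightarrow> t \<le> b \<Longrightarrow> t - s < \<delta> \<Longrightarrow> norm (h t - h s) < \<epsilon>"
    using abs_continuous_on_small_interval[OF assms \<open>0 < \<epsilon>\<close>] by blast
  show "\<exists>\<delta>>0. \<forall>x'\<in>{a..b}. dist x' x < \<delta> \<longrightarrow> dist (h x') (h x) < \<epsilon>"
  proof (intro exI[of _ \<delta>] conjI ballI impI)
    fix x' assume "x' \<in> {a..b}" "dist x' x < \<delta>"
    then show "dist (h x') (h x) < \<epsilon>"
      using \<delta>[of x x'] \<delta>[of x' x] x by (cases "x \<le> x'") (auto simp: dist_norm norm_minus_commute)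
  qed (fact \<open>0 < \<delta>\<close>)
qed

section \<open>Differentiation of indefinite integrals\<close>

text \<open>In this form a derivative is an estimate of increments, which covers the end points of
  an interval and combines directly with the increment estimates below.\<close>

lemma has_vector_derivative_within_alt:
  "(h has_vector_derivative h') (at x within S) \<longleftrightarrow>
    (\<forall>e>0. \<exists>d>0. \<forall>y\<in>S. \<bar>y - x\<bar> < d \<longrightarrow> norm (h y - h x - (y - x) *\<^sub>R h') \<le> e * \<bar>y - x\<bar>)"
  unfolding has_vector_derivative_def has_derivative_within_alt
  by (simp add: bounded_linear_scaleR_left)

text \<open>Lebesgue differentiation by Henstock's lemma: the short intervals between
  \<open>x\<close> and \<open>y\<close> on which the integral misses \<open>f x\<close> by more than
  the factor \<open>c\<close> cover the exceptional set in the sense of Vitali. Finitely many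
  disjoint ones, tagged at \<open>x\<close>, form a fine partial division with total error below
  \<open>e * c\<close>; hence their total length is at most \<open>e\<close>.\<close>

lemma negligible_bad_increments:
  fixes f :: "real \<Rightarrow> 'e::euclidean_space"
  assumes f: "f integrable_on {a..b}" and c: "0 < c"
  shows "negligible {x \<in> {a..b}. \<forall>d>0. \<exists>y\<in>{a..b}. \<bar>y - x\<bar> < d \<and>
           c * \<bar>y - x\<bar> < norm (\<bar>y - x\<bar> *\<^sub>R f x - integral {min x y..max x y} f)}" (is "negligible ?E")
  unfolding negligible_outer_le
proof (intro allI impI)
  fix e :: real assume "0 < e"
  then have ec: "0 < e * c" using c by simp
  have fab: "f integrable_on cbox a b" using f by simp
  obtain \<gamma> where \<gamma>: "gauge \<gamma>" and
    hen: "\<And>p. \<lbrakk>p tagged_partial_division_of (cbox a b); \<gamma> fine p\<rbrakk> \<Longrightarrow>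
             (\<Sum>(x,k)\<in>p. norm (measure lborel k *\<^sub>R f x - integral k f)) < e * c"
    by (rule Henstock_lemma[OF fab ec]) auto
  \<comment> \<open>An interval is coded by the pair of its tag and its other end point, because
    Vitali's theorem speaks of centres and radii while the tag for Henstock's lemma has to be an end
    point.\<close>
  define iv where "iv = (\<lambda>(x::real,y). {min x y..max x y})"
  define ctr where "ctr = (\<lambda>(x::real,y). (x + y) / 2)"
  define rad where "rad = (\<lambda>(x::real,y). \<bar>y - x\<bar> / 2)"
  have iv_cball: "cball (ctr i) (rad i) = iv i" for i
    by (cases i) (auto simp: iv_def ctr_def rad_def cball_eq_atLeastAtMost min_def max_def field_simps abs_if)
  define K where "K = {(x,y). x \<in> {a..b} \<and> y \<in> {a..b} \<and> x \<noteq> y \<and> iv (x,y) \<subseteq> \<gamma> x \<and>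
     c * \<bar>y - x\<bar> < norm (\<bar>y - x\<bar> *\<^sub>R f x - integral (iv (x,y)) f)}"
  have r: "0 < rad i" if "i \<in> K" for i
    using that by (auto simp: K_def rad_def)
  have cov: "\<exists>i. i \<in> K \<and> x \<in> cball (ctr i) (rad i) \<and> rad i < d" if x: "x \<in> ?E" and d: "0 < d" for x d
  proof -
    have "open (\<gamma> x)" "x \<in> \<gamma> x" using \<gamma> by (auto simp: gauge_def)
    then obtain \<rho> where \<rho>: "0 < \<rho>" "ball x \<rho> \<subseteq> \<gamma> x" by (meson openE)
    obtain y where y: "y \<in> {a..b}" "\<bar>y - x\<bar> < min d \<rho>"
       "c * \<bar>y - x\<bar> < norm (\<bar>y - x\<bar> *\<^sub>R f x - integral {min x y..max x y} f)"
    proof -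
      have "0 < min d \<rho>" using d \<rho>(1) by simp
      moreover have "\<forall>d>0. \<exists>y\<in>{a..b}. \<bar>y - x\<bar> < d \<and>
           c * \<bar>y - x\<bar> < norm (\<bar>y - x\<bar> *\<^sub>R f x - integral {min x y..max x y} f)"
        using x by blast
      ultimately show ?thesis using that by blast
    qed
    have "y \<noteq> x" using y(3) by auto
    have "iv (x,y) \<subseteq> ball x \<rho>"
      using y(2) by (auto simp: iv_def ball_eq_greaterThanLessThan)
    then have "iv (x,y) \<subseteq> \<gamma> x" using \<rho>(2) by blast
    then have "(x,y) \<in> K" using x y \<open>y \<noteq> x\<close> by (auto simp: K_def iv_def)
    moreover have "x \<in> cball (ctr (x,y)) (rad (x,y))" unfolding iv_cball by (auto simp: iv_def)
    moreover have "rad (x,y) < d" using y(2) by (auto simp: rad_def)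
    ultimately show ?thesis by blast
  qed
  obtain C where C: "countable C" "C \<subseteq> K"
     "pairwise (\<lambda>i j. disjnt (cball (ctr i) (rad i)) (cball (ctr j) (rad j))) C"
     "negligible (?E - (\<Union>i \<in> C. cball (ctr i) (rad i)))"
    using Vitali_covering_theorem_cballs[of K rad ?E ctr, OF r cov] by blast
  have bound: "measure lebesgue (\<Union>i\<in>F. iv i) \<le> e" if F: "F \<subseteq> C" "finite F" for F
  proof -
    have dj: "iv i \<inter> iv j = {}" if "i \<in> F" "j \<in> F" "i \<noteq> j" for i j
      using C(3) F that unfolding pairwise_def disjnt_def iv_cball by blast
    have ne: "fst i \<in> iv i" for i by (cases i) (auto simp: iv_def)
    have inj: "inj_on (\<lambda>i. (fst i, iv i)) F"
      using dj ne by (intro inj_onI) blast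
    define p where "p = (\<lambda>i. (fst i, iv i)) ` F"
    have "p tagged_partial_division_of (cbox a b)"
      unfolding tagged_partial_division_of_def
    proof (intro conjI allI impI)
      show "finite p" using F by (simp add: p_def)
    next
      fix x k assume "(x,k) \<in> p"
      then obtain i where i: "i \<in> F" "x = fst i" "k = iv i" by (auto simp: p_def)
      have "i \<in> K" using i F C by blast
      then show "x \<in> k" "k \<subseteq> cbox a b" "\<exists>a b. k = cbox a b"
        using i ne by (auto simp: K_def iv_def)
    next
      fix x1 k1 x2 k2 assume "(x1, k1) \<in> p \<and> (x2, k2) \<in> p \<and> (x1, k1) \<noteq> (x2, k2)"
      then obtain i j where "i \<in> F" "j \<in> F" "k1 = iv i" "k2 = iv j" "i \<noteq> j" by (auto simp: p_def)
      then have "k1 \<inter> k2 = {}" using dj by blast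
      then show "interior k1 \<inter> interior k2 = {}" using interior_subset by fastforce
    qed
    moreover have "\<gamma> fine p"
    proof (rule fineI)
      fix x k assume "(x,k) \<in> p"
      then obtain i where i: "i \<in> F" "x = fst i" "k = iv i" by (auto simp: p_def)
      have "i \<in> K" using i F C by blast
      then show "k \<subseteq> \<gamma> x" using i by (auto simp: K_def)
    qed
    ultimately have "(\<Sum>(x,k)\<in>p. norm (measure lborel k *\<^sub>R f x - integral k f)) < e * c" by (rule hen)
    then have le: "(\<Sum>i\<in>F. norm (measure lborel (iv i) *\<^sub>R f (fst i) - integral (iv i) f)) < e * c"
      unfolding p_def by (subst (asm) sum.reindex[OF inj]) simp
    have "measure lebesgue (\<Union>i\<in>F. iv i) \<le> (\<Sum>i\<in>F. measure lborel (iv i))"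
    proof -
      have "measure lebesgue (\<Union>i\<in>F. iv i) \<le> (\<Sum>i\<in>F. measure lebesgue (iv i))"
        using F(2) by (intro measure_UNION_le) (auto simp: iv_def)
      also have "\<dots> = (\<Sum>i\<in>F. measure lborel (iv i))"
        by (intro sum.cong) (auto simp: iv_def)
      finally show ?thesis .
    qed
    also have "\<dots> \<le> (\<Sum>i\<in>F. norm (measure lborel (iv i) *\<^sub>R f (fst i) - integral (iv i) f) / c)"
    proof (rule sum_mono)
      fix i assume "i \<in> F"
      then have "i \<in> K" using F C by blast
      then show "measure lborel (iv i) \<le> norm (measure lborel (iv i) *\<^sub>R f (fst i) - integral (iv i) f) / c"
        using c by (cases i) (auto simp: K_def iv_def field_simps min_def max_def abs_if split: if_splits)
    qed
    also have "\<dots> \<le> e"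
      using le c by (simp add: sum_divide_distrib[symmetric] field_simps)
    finally show ?thesis .
  qed
  have lm: "iv i \<in> lmeasurable" for i by (cases i) (auto simp: iv_def)
  have U: "(\<Union>i\<in>C. iv i) \<in> lmeasurable" "measure lebesgue (\<Union>i\<in>C. iv i) \<le> e"
    using fmeasurable_UN_bound[OF C(1) lm bound] measure_UN_bound[OF C(1) lm bound] by auto
  have N: "?E - (\<Union>i\<in>C. iv i) \<in> lmeasurable" "measure lebesgue (?E - (\<Union>i\<in>C. iv i)) = 0"
    using C(4) unfolding iv_cball
    by (auto intro: negligible_imp_measurable negligible_imp_measure0)
  show "\<exists>T. ?E \<subseteq> T \<and> T \<in> lmeasurable \<and> measure lebesgue T \<le> e"
  proof (intro exI conjI)
    show "?E \<subseteq> (?E - (\<Union>i\<in>C. iv i)) \<union> (\<Union>i\<in>C. iv i)" by blast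
    show "(?E - (\<Union>i\<in>C. iv i)) \<union> (\<Union>i\<in>C. iv i) \<in> lmeasurable" using N U by blast
    show "measure lebesgue ((?E - (\<Union>i\<in>C. iv i)) \<union> (\<Union>i\<in>C. iv i)) \<le> e"
      using measure_Un_le[of "?E - (\<Union>i\<in>C. iv i)" lebesgue "\<Union>i\<in>C. iv i"] N U
      by (auto dest: fmeasurableD)
  qed
qed

text \<open>Differentiability amounts to countably many conditions, one for each factor
  \<open>1 / (n + 1)\<close>, so the exceptional set lies in a countable union of negligible
  sets.\<close>

theorem indefinite_integral_has_vector_derivative_ae:
  fixes f :: "real \<Rightarrow> 'e::euclidean_space"
  assumes f: "f integrable_on {a..b}"
  shows "negligible {x \<in> {a..b}. \<not> ((\<lambda>t. integral {a..t} f) has_vector_derivative f x) (at x within {a..b})}"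
proof -
  define E where "E = (\<lambda>n::nat. {x \<in> {a..b}. \<forall>d>0. \<exists>y\<in>{a..b}. \<bar>y - x\<bar> < d \<and>
           inverse (Suc n) * \<bar>y - x\<bar> < norm (\<bar>y - x\<bar> *\<^sub>R f x - integral {min x y..max x y} f)})"
  have "negligible (\<Union>n. E n)"
    unfolding E_def by (intro negligible_Union_nat allI negligible_bad_increments[OF f]) auto
  moreover have "{x \<in> {a..b}. \<not> ((\<lambda>t. integral {a..t} f) has_vector_derivative f x) (at x within {a..b})} \<subseteq> (\<Union>n. E n)"
  proof (rule subsetI, rule ccontr)
    fix x assume xx: "x \<in> {x \<in> {a..b}. \<not> ((\<lambda>t. integral {a..t} f) has_vector_derivative f x) (at x within {a..b})}"
      and notE: "x \<notin> (\<Union>n. E n)"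
    then have x: "x \<in> {a..b}" by blast
    from xx have "\<not> ((\<lambda>t. integral {a..t} f) has_vector_derivative f x) (at x within {a..b})" by blast
    moreover have "((\<lambda>t. integral {a..t} f) has_vector_derivative f x) (at x within {a..b})"
      unfolding has_vector_derivative_within_alt
    proof (intro allI impI)
      fix e :: real assume "0 < e"
      then obtain n where n: "inverse (Suc n) < e" using reals_Archimedean by blast
      have "x \<notin> E n" using notE by blast
      then obtain d where d: "d > 0" and small: "\<And>y. y \<in> {a..b} \<Longrightarrow> \<bar>y - x\<bar> < d \<Longrightarrow>
         norm (\<bar>y - x\<bar> *\<^sub>R f x - integral {min x y..max x y} f) \<le> inverse (Suc n) * \<bar>y - x\<bar>"
        using x unfolding E_def by (smt (verit, best) mem_Collect_eq)
      show "\<exists>d>0. \<forall>y\<in>{a..b}. \<bar>y - x\<bar> < d \<longrightarrow>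
         norm (integral {a..y} f - integral {a..x} f - (y - x) *\<^sub>R f x) \<le> e * \<bar>y - x\<bar>"
      proof (intro exI[of _ d] conjI ballI impI)
        fix y assume y: "y \<in> {a..b}" "\<bar>y - x\<bar> < d"
        have comb: "integral {a..t} f - integral {a..s} f = integral {s..t} f"
          if "a \<le> s" "s \<le> t" "t \<le> b" for s t
        proof -
          have "f integrable_on {a..t}" using f that by (auto intro: integrable_on_subinterval)
          from Henstock_Kurzweil_Integration.integral_combine[OF that(1,2) this] show ?thesis by (simp add: algebra_simps)
        qed
        have "norm (integral {a..y} f - integral {a..x} f - (y - x) *\<^sub>R f x)
           = norm (\<bar>y - x\<bar> *\<^sub>R f x - integral {min x y..max x y} f)"
        proof (cases "x \<le> y")
          case True
          then show ?thesis using comb[of x y] x y by (simp add: norm_minus_commute)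
        next
          case False
          then have "integral {a..y} f - integral {a..x} f = - integral {y..x} f"
            using comb[of y x] x y by (simp add: algebra_simps)
          then have "integral {a..y} f - integral {a..x} f - (y - x) *\<^sub>R f x = (x - y) *\<^sub>R f x - integral {y..x} f"
            by (simp only:) (simp add: algebra_simps)
          moreover have "\<bar>y - x\<bar> = x - y" "min x y = y" "max x y = x" using False by auto
          ultimately show ?thesis by (simp only:)
        qed
        also have "\<dots> \<le> inverse (Suc n) * \<bar>y - x\<bar>" using small y by blast
        also have "\<dots> \<le> e * \<bar>y - x\<bar>" using n by (intro mult_right_mono) auto
        finally show "norm (integral {a..y} f - integral {a..x} f - (y - x) *\<^sub>R f x) \<le> e * \<bar>y - x\<bar>" .
      qed (fact d)
    qed
    ultimately show False by blast
  qed
  ultimately show ?thesis using negligible_subset by blast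
qed

section \<open>Variation functions\<close>

definition increments :: "(real \<Rightarrow> 'e::euclidean_space) \<Rightarrow> real set set \<Rightarrow> real" where
  "increments u d = (\<Sum>k\<in>d. norm (u (Sup k) - u (Inf k)))"

definition partial_divisions :: "real set \<Rightarrow> real set set set" where
  "partial_divisions S = {d. d division_of \<Union>d \<and> \<Union>d \<subseteq> S}"

definition variation_in :: "(real \<Rightarrow> 'e::euclidean_space) \<Rightarrow> real set \<Rightarrow> real" where
  "variation_in u S = (SUP d\<in>partial_divisions S. increments u d)"

lemma empty_partial_division: "{} \<in> partial_divisions S"
  by (auto simp: partial_divisions_def)

lemma increments_nonneg: "0 \<le> increments u d"
  unfolding increments_def by (intro sum_nonneg) auto

lemma partial_divisions_mono: "S \<subseteq> T \<Longrightarrow> partial_divisions S \<subseteq> partial_divisions T"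
  by (auto simp: partial_divisions_def)

text \<open>A division of a subset extends to one of the whole interval, and the added terms are
  nonnegative.\<close>

lemma increments_le_total_variation:
  assumes tv: "total_variation a b u \<le> ennreal K" and d: "d \<in> partial_divisions {a..b}"
  shows "increments u d \<le> max 0 K"
proof -
  have dd: "d division_of \<Union>d" "\<Union>d \<subseteq> cbox a b" using d by (auto simp: partial_divisions_def)
  obtain q where q: "d \<subseteq> q" "q division_of cbox a b"
    by (rule partial_division_extend_interval[OF dd])
  have "finite q" using q(2) by (simp add: division_of_finite)
  have "ennreal (increments u q) \<le> total_variation a b u"
    unfolding total_variation_def increments_def using q(2) by (intro SUP_upper2[of q]) auto
  \<comment> \<open>\<open>ennreal\<close> sends negative numbers to 0, so the real bound is
    \<open>max 0 K\<close>.\<close>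
  also have "\<dots> \<le> ennreal (max 0 K)" using tv by (metis ennreal_leI max.cobounded2 order_trans)
  finally have "increments u q \<le> max 0 K" by (subst (asm) ennreal_le_iff) auto
  moreover have "increments u d \<le> increments u q"
    unfolding increments_def using q(1) \<open>finite q\<close> by (intro sum_mono2) auto
  ultimately show ?thesis by linarith
qed

context
  fixes u :: "real \<Rightarrow> 'e::euclidean_space" and a b K :: real
  assumes tv: "total_variation a b u \<le> ennreal K"
begin

lemma bdd_above_increments: "S \<subseteq> {a..b} \<Longrightarrow> bdd_above (increments u ` partial_divisions S)"
  using increments_le_total_variation[OF tv] partial_divisions_mono[of S "{a..b}"]
  by (intro bdd_aboveI2[of _ _ "max 0 K"]) blast

lemma increments_le_variation_in:
  "S \<subseteq> {a..b} \<Longrightarrow> d \<in> partial_divisions S \<Longrightarrow> increments u d \<le> variation_in u S"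
  unfolding variation_in_def by (intro cSUP_upper bdd_above_increments)

text \<open>Adjoining \<open>{s..t}\<close> to a family inside \<open>{r..s}\<close> gives a family
  inside \<open>{r..t}\<close>.\<close>

lemma variation_in_superadd:
  assumes "a \<le> r" "r \<le> s" "s \<le> t" "t \<le> b"
  shows "variation_in u {r..s} + norm (u t - u s) \<le> variation_in u {r..t}"
proof -
  have "increments u d \<le> variation_in u {r..t} - norm (u t - u s)"
    if d: "d \<in> partial_divisions {r..s}" for d
  proof -
    have d1: "d division_of \<Union>d" "\<Union>d \<subseteq> {r..s}" using d by (auto simp: partial_divisions_def)
    have d2: "{{s..t}} division_of {s..t}" using division_of_self[of s t] assms by simp
    have "interior (\<Union>d) \<subseteq> interior {r..s}" by (rule interior_mono[OF d1(2)])
    then have "interior (\<Union>d) \<inter> interior {s..t} = {}"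
      by (auto simp: interior_atLeastAtMost_real)
    from division_disjoint_union[OF d1(1) d2 this]
    have "d \<union> {{s..t}} division_of (\<Union>d \<union> {s..t})" .
    moreover have "\<Union>(d \<union> {{s..t}}) = \<Union>d \<union> {s..t}" by (simp add: Un_commute)
    moreover have "\<Union>d \<union> {s..t} \<subseteq> {r..t}" using d1(2) assms by (intro Un_least) auto
    ultimately have pd: "d \<union> {{s..t}} \<in> partial_divisions {r..t}"
      unfolding partial_divisions_def by simp
    have fin: "finite d" using d1(1) by (simp add: division_of_finite)
    have "increments u (d \<union> {{s..t}}) = increments u d + increments u {{s..t}}"
      unfolding increments_def
    proof (rule sum.union_inter_neutral)
      \<comment> \<open>\<open>{s..t}\<close> can already belong to \<open>d\<close> only when it is
        a point, and then its increment is 0.\<close>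
      show "\<forall>k\<in>d \<inter> {{s..t}}. norm (u (Sup k) - u (Inf k)) = 0"
      proof
        fix k assume "k \<in> d \<inter> {{s..t}}"
        then have "{s..t} \<subseteq> {r..s}" using d1(2) by blast
        then have "s = t" using assms by auto
        then show "norm (u (Sup k) - u (Inf k)) = 0" using \<open>k \<in> d \<inter> {{s..t}}\<close> by simp
      qed
    qed (use fin in auto)
    moreover have "increments u {{s..t}} = norm (u t - u s)"
      using assms by (simp add: increments_def)
    moreover have "increments u (d \<union> {{s..t}}) \<le> variation_in u {r..t}"
      using assms by (intro increments_le_variation_in[OF _ pd]) auto
    ultimately show ?thesis by linarith
  qed
  then have "variation_in u {r..s} \<le> variation_in u {r..t} - norm (u t - u s)"
    unfolding variation_in_def[of u "{r..s}"] using empty_partial_division by (intro cSUP_least) auto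
  then show ?thesis by linarith
qed

text \<open>A monotone clamping map cuts a family of intervals down to \<open>{p..q}\<close>; the
  images stay nonoverlapping because each nondegenerate image lies in its original. This is how
  intervals that cross a point are split for subadditivity.\<close>

lemma increments_clamped:
  assumes d: "d \<in> partial_divisions {a..b}" and m: "mono m"
    and rng: "\<And>x. a \<le> x \<Longrightarrow> x \<le> b \<Longrightarrow> m x \<in> {p..q}" and pq: "a \<le> p" "q \<le> b"
    and inc: "\<And>k. k \<in> d \<Longrightarrow> m (Inf k) < m (Sup k) \<Longrightarrow> Inf k \<le> m (Inf k) \<and> m (Sup k) \<le> Sup k"
  shows "(\<Sum>k\<in>d. norm (u (m (Sup k)) - u (m (Inf k)))) \<le> variation_in u {p..q}"
proof -
  have dd: "d division_of \<Union>d" "\<Union>d \<subseteq> {a..b}" using d by (auto simp: partial_divisions_def)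
  have fin: "finite d" using dd(1) by (simp add: division_of_finite)
  note kk = division_of_real_interval[OF dd(1)]
  \<comment> \<open>Collapsed intervals contribute 0 and must go: two of them may have the same
    image, which would break the reindexing.\<close>
  define d' where "d' = {k \<in> d. m (Inf k) < m (Sup k)}"
  define j where "j = (\<lambda>k. {m (Inf k)..m (Sup k)})"
  have sub: "j k \<subseteq> k" if "k \<in> d'" for k
  proof -
    have "k \<in> d" "m (Inf k) < m (Sup k)" using that by (auto simp: d'_def)
    then have "{m (Inf k)..m (Sup k)} \<subseteq> {Inf k..Sup k}" using inc[of k] by auto
    then show ?thesis using kk(1)[OF \<open>k \<in> d\<close>] by (simp add: j_def)
  qed
  have ne: "interior (j k) \<noteq> {}" if "k \<in> d'" for k
    using that by (auto simp: j_def d'_def interior_atLeastAtMost_real)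
  have disj: "interior (j k) \<inter> interior (j l) = {}" if "k \<in> d'" "l \<in> d'" "k \<noteq> l" for k l
  proof -
    have "interior k \<inter> interior l = {}"
      using division_ofD(5)[OF dd(1), of k l] that by (auto simp: d'_def)
    then show ?thesis using interior_mono[OF sub[OF that(1)]] interior_mono[OF sub[OF that(2)]] by blast
  qed
  have inj: "inj_on j d'"
    by (rule inj_onI) (metis Int_absorb disj ne)
  have pd: "j ` d' \<in> partial_divisions {p..q}"
    unfolding partial_divisions_def
  proof (intro CollectI conjI division_ofI)
    show "finite (j ` d')" using fin by (simp add: d'_def)
    show "\<Union> (j ` d') = \<Union> (j ` d')" ..
    fix K assume "K \<in> j ` d'"
    then obtain k where k: "k \<in> d'" "K = j k" by blast
    show "K \<subseteq> \<Union> (j ` d')" using k by blast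
    show "K \<noteq> {}" using ne[OF k(1)] k(2) by auto
    show "\<exists>a b. K = cbox a b" using k(2) unfolding j_def box_real[symmetric] by blast
    fix L assume "L \<in> j ` d'" "K \<noteq> L"
    then obtain l where "l \<in> d'" "L = j l" "k \<noteq> l" using k by blast
    then show "interior K \<inter> interior L = {}" using disj k by blast
  next
    show "\<Union> (j ` d') \<subseteq> {p..q}"
    proof clarsimp
      fix x k assume k: "k \<in> d'" "x \<in> j k"
      then have "Inf k \<in> {a..b}" "Sup k \<in> {a..b}" using kk(3,4)[of k] dd(2) by (auto simp: d'_def)
      then show "p \<le> x \<and> x \<le> q" using rng[of "Inf k"] rng[of "Sup k"] k(2) by (auto simp: j_def)
    qed
  qed
  have "(\<Sum>k\<in>d. norm (u (m (Sup k)) - u (m (Inf k)))) = (\<Sum>k\<in>d'. norm (u (m (Sup k)) - u (m (Inf k))))"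
  proof (rule sum.mono_neutral_right[OF fin])
    show "d' \<subseteq> d" by (auto simp: d'_def)
    show "\<forall>k\<in>d - d'. norm (u (m (Sup k)) - u (m (Inf k))) = 0"
    proof
      fix k assume "k \<in> d - d'"
      then have "\<not> m (Inf k) < m (Sup k)" "m (Inf k) \<le> m (Sup k)"
        using kk(2)[of k] m by (auto simp: d'_def mono_def)
      then show "norm (u (m (Sup k)) - u (m (Inf k))) = 0" by simp
    qed
  qed
  also have "\<dots> = increments u (j ` d')"
    unfolding increments_def sum.reindex[OF inj]
    by (rule sum.cong) (auto simp: j_def d'_def)
  also have "\<dots> \<le> variation_in u {p..q}"
    using pq by (intro increments_le_variation_in[OF _ pd]) auto
  finally show ?thesis .
qed

lemma variation_in_subadd:
  assumes "a \<le> s" "s \<le> t" "t \<le> b"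
  shows "variation_in u {a..t} \<le> variation_in u {a..s} + variation_in u {s..t}"
  unfolding variation_in_def[of u "{a..t}"]
proof (rule cSUP_least)
  show "partial_divisions {a..t} \<noteq> {}" using empty_partial_division by blast
  fix d assume d: "d \<in> partial_divisions {a..t}"
  then have d': "d \<in> partial_divisions {a..b}" using assms partial_divisions_mono[of "{a..t}" "{a..b}"] by auto
  have dd: "d division_of \<Union>d" "\<Union>d \<subseteq> {a..t}" using d by (auto simp: partial_divisions_def)
  note kk = division_of_real_interval[OF dd(1)]
  have rng: "Inf k \<in> {a..t}" "Sup k \<in> {a..t}" if "k \<in> d" for k using kk(3,4)[OF that] dd(2) by auto
  have "increments u d \<le> (\<Sum>k\<in>d. norm (u (min s (Sup k)) - u (min s (Inf k)))) +
       (\<Sum>k\<in>d. norm (u (max s (min t (Sup k))) - u (max s (min t (Inf k)))))"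
    unfolding increments_def sum.distrib[symmetric]
  proof (rule sum_mono)
    fix k assume k: "k \<in> d"
    \<comment> \<open>For an interval that crosses \<open>s\<close>, the two clamped increments
      belong to its parts left and right of \<open>s\<close>; otherwise one of them
      vanishes.\<close>
    have *: "u (Sup k) - u (Inf k) = (u (min s (Sup k)) - u (min s (Inf k))) + (u (max s (min t (Sup k))) - u (max s (min t (Inf k))))"
      using rng[OF k] kk(2)[OF k] by (auto simp: min_def max_def)
    show "norm (u (Sup k) - u (Inf k)) \<le> norm (u (min s (Sup k)) - u (min s (Inf k))) +
       norm (u (max s (min t (Sup k))) - u (max s (min t (Inf k))))"
      by (subst *) (rule norm_triangle_ineq)
  qed
  also have "(\<Sum>k\<in>d. norm (u (min s (Sup k)) - u (min s (Inf k)))) \<le> variation_in u {a..s}"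
  proof (rule increments_clamped[OF d', of "\<lambda>x. min s x"])
    show "mono (min s)" by (auto simp: mono_def min_def)
  qed (use assms in \<open>auto simp: min_def split: if_splits\<close>)
  also have "(\<Sum>k\<in>d. norm (u (max s (min t (Sup k))) - u (max s (min t (Inf k))))) \<le> variation_in u {s..t}"
  proof (rule increments_clamped[OF d', of "\<lambda>x. max s (min t x)"])
    show "mono (\<lambda>x. max s (min t x))" by (auto simp: mono_def min_def max_def)
    fix k assume "k \<in> d" "max s (min t (Inf k)) < max s (min t (Sup k))"
    then show "Inf k \<le> max s (min t (Inf k)) \<and> max s (min t (Sup k)) \<le> Sup k"
      using rng[of k] by (simp add: min_def max_def split: if_splits)
  next
    show "max s (min t x) \<in> {s..t}" for x using assms by (simp add: min_def max_def)
  qed (use assms in auto)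
  finally show "increments u d \<le> variation_in u {a..s} + variation_in u {s..t}" by simp
qed

text \<open>Inside each interval of a short family take a nearly optimal division. Together these
  form a single family of no larger total length, so the absolute continuity of \<open>u\<close>
  bounds the sum of all the variations at once.\<close>

lemma abs_continuous_on_variation:
  assumes u: "abs_continuous_on {a..b} u"
  shows "abs_continuous_on {a..b} (\<lambda>t. variation_in u {a..t})"
  unfolding abs_continuous_on_def
proof (intro allI impI)
  fix \<epsilon> :: real assume "0 < \<epsilon>"
  then have e: "0 < \<epsilon> / 4" by simp
  obtain \<delta> where "\<delta> > 0" and \<delta>: "\<And>d T. d division_of T \<Longrightarrow> T \<subseteq> {a..b} \<Longrightarrow> (\<Sum>k\<in>d. Sup k - Inf k) < \<delta> \<Longrightarrow>
        (\<Sum>k\<in>d. norm (u (Sup k) - u (Inf k))) < \<epsilon> / 4"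
    using u e unfolding abs_continuous_on_def by meson
  show "\<exists>\<delta>>0. \<forall>d T. d division_of T \<and> T \<subseteq> {a..b} \<and> (\<Sum>k\<in>d. Sup k - Inf k) < \<delta> \<longrightarrow>
        (\<Sum>k\<in>d. norm (variation_in u {a..Sup k} - variation_in u {a..Inf k})) < \<epsilon>"
  proof (intro exI[of _ \<delta>] conjI allI impI)
    fix d T assume "d division_of T \<and> T \<subseteq> {a..b} \<and> (\<Sum>k\<in>d. Sup k - Inf k) < \<delta>"
    then have d: "d division_of T" "T \<subseteq> {a..b}" "(\<Sum>k\<in>d. Sup k - Inf k) < \<delta>" by auto
    have fin: "finite d" using d(1) by (simp add: division_of_finite)
    note kk = division_of_real_interval[OF d(1)]
    have kab: "k \<subseteq> {a..b}" if "k \<in> d" for k using division_ofD(2)[OF d(1) that] d(2) by blast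
    \<comment> \<open>The loss from nearly optimal divisions is spread over the
      \<open>card d\<close> intervals; the \<open>+ 1\<close> covers the empty family.\<close>
    define \<eta> where "\<eta> = \<epsilon> / (4 * (card d + 1))"
    have \<eta>: "0 < \<eta>" using \<open>0 < \<epsilon>\<close> by (simp add: \<eta>_def)
    have "\<exists>D. D \<in> partial_divisions k \<and> variation_in u k < increments u D + \<eta>" if kd: "k \<in> d" for k
    proof -
      have "variation_in u k - \<eta> < (SUP d\<in>partial_divisions k. increments u d)"
        using \<eta> by (simp add: variation_in_def)
      then obtain D where "D \<in> partial_divisions k" "variation_in u k - \<eta> < increments u D"
        using empty_partial_division
        by (subst (asm) less_cSUP_iff[OF _ bdd_above_increments[OF kab[OF kd]]]) auto
      then show ?thesis by (intro exI[of _ D]) auto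
    qed
    then obtain D where D: "\<And>k. k \<in> d \<Longrightarrow> D k \<in> partial_divisions k"
        "\<And>k. k \<in> d \<Longrightarrow> variation_in u k < increments u (D k) + \<eta>" by metis
    \<comment> \<open>Point intervals are removed: neighbours in \<open>d\<close> may share an end
      point, and the families \<open>D' k\<close> have to be disjoint.\<close>
    define D' where "D' = (\<lambda>k. {j \<in> D k. Inf j < Sup j})"
    have Dk: "D k division_of \<Union>(D k)" "\<Union>(D k) \<subseteq> k" "finite (D k)" if "k \<in> d" for k
      using D(1)[OF that] by (auto simp: partial_divisions_def division_of_finite)
    have fD': "finite (D' k)" if "k \<in> d" for k using Dk(3)[OF that] by (simp add: D'_def)
    have jint: "interior j \<noteq> {}" if "k \<in> d" "j \<in> D' k" for j k
    proof -
      have "j = {Inf j..Sup j}" "Inf j < Sup j"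
        using division_of_real_interval(1)[OF Dk(1)[OF that(1)], of j] that(2) by (auto simp: D'_def)
      then have "(Inf j + Sup j) / 2 \<in> {Inf j<..<Sup j}" by auto
      then show ?thesis
        by (metis \<open>j = {Inf j..Sup j}\<close> empty_iff interior_atLeastAtMost_real)
    qed
    have jk: "j \<subseteq> k" if "k \<in> d" "j \<in> D' k" for j k using Dk(2)[OF that(1)] that(2) by (auto simp: D'_def)
    have cross: "interior j \<inter> interior j' = {}" if "k \<in> d" "k' \<in> d" "k \<noteq> k'" "j \<in> D' k" "j' \<in> D' k'" for j j' k k'
    proof -
      have "interior k \<inter> interior k' = {}" using division_ofD(5)[OF d(1)] that by blast
      then show ?thesis using interior_mono[OF jk[OF that(1,4)]] interior_mono[OF jk[OF that(2,5)]] by blast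
    qed
    have disj: "\<forall>k\<in>d. \<forall>k'\<in>d. k \<noteq> k' \<longrightarrow> D' k \<inter> D' k' = {}"
    proof (intro ballI impI)
      fix k k' assume k: "k \<in> d" "k' \<in> d" "k \<noteq> k'"
      show "D' k \<inter> D' k' = {}"
      proof (rule ccontr)
        assume "D' k \<inter> D' k' \<noteq> {}"
        then obtain j where "j \<in> D' k" "j \<in> D' k'" by blast
        then show False using cross[OF k, of j j] jint[OF k(1), of j] by auto
      qed
    qed
    let ?E = "\<Union>k\<in>d. D' k"
    have div: "?E division_of \<Union>?E"
    proof (rule division_ofI)
      show "finite ?E" using fin fD' by blast
      show "\<Union>?E = \<Union>?E" ..
      fix j assume "j \<in> ?E"
      then obtain k where k: "k \<in> d" "j \<in> D' k" by blast
      show "j \<subseteq> \<Union>?E" using k by blast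
      show "j \<noteq> {}" using jint[OF k] by auto
      show "\<exists>a b. j = cbox a b" using division_ofD(4)[OF Dk(1)[OF k(1)]] k(2) by (auto simp: D'_def)
      fix j' assume "j' \<in> ?E" "j \<noteq> j'"
      then obtain k' where k': "k' \<in> d" "j' \<in> D' k'" by blast
      show "interior j \<inter> interior j' = {}"
      proof (cases "k = k'")
        case True
        then show ?thesis using division_ofD(5)[OF Dk(1)[OF k(1)]] k k' \<open>j \<noteq> j'\<close> by (auto simp: D'_def)
      next
        case False
        then show ?thesis using cross k k' by blast
      qed
    qed
    have "\<Union>?E \<subseteq> {a..b}" using jk kab by blast
    have "(\<Sum>j\<in>?E. Sup j - Inf j) = (\<Sum>k\<in>d. \<Sum>j\<in>D' k. Sup j - Inf j)"
      using fin fD' disj by (intro sum.UNION_disjoint) auto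
    also have "\<dots> \<le> (\<Sum>k\<in>d. Sup k - Inf k)"
    proof (rule sum_mono)
      fix k assume k: "k \<in> d"
      have dv: "D' k division_of \<Union>(D' k)"
        by (rule division_of_subset[OF Dk(1)[OF k]]) (auto simp: D'_def)
      have "(\<Sum>j\<in>D' k. Sup j - Inf j) = (\<Sum>j\<in>D' k. measure lborel j)"
      by (intro sum.cong) (auto simp: division_of_measure_eq[OF dv])
      also have "\<dots> \<le> measure lborel (cbox (Inf k) (Sup k))"
        using jk[OF k] kk(1)[OF k] by (intro subadditive_content_division[OF dv]) auto
      also have "\<dots> = Sup k - Inf k" using kk(2)[OF k] by simp
      finally show "(\<Sum>j\<in>D' k. Sup j - Inf j) \<le> Sup k - Inf k" .
    qed
    also have "\<dots> < \<delta>" by (rule d(3))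
    finally have "(\<Sum>k\<in>?E. norm (u (Sup k) - u (Inf k))) < \<epsilon> / 4"
      by (intro \<delta>[OF div \<open>\<Union>?E \<subseteq> {a..b}\<close>])
    then have small: "(\<Sum>k\<in>d. increments u (D' k)) < \<epsilon> / 4"
      unfolding increments_def using fin fD' disj by (subst (asm) sum.UNION_disjoint) auto
    have "(\<Sum>k\<in>d. norm (variation_in u {a..Sup k} - variation_in u {a..Inf k})) \<le> (\<Sum>k\<in>d. increments u (D' k) + \<eta>)"
    proof (rule sum_mono)
      fix k assume k: "k \<in> d"
      have ends: "a \<le> Inf k" "Inf k \<le> Sup k" "Sup k \<le> b" using kk[OF k] d(2) by auto
      have "variation_in u {a..Inf k} \<le> variation_in u {a..Sup k}"
        using variation_in_superadd[of a "Inf k" "Sup k"] ends norm_ge_zero[of "u (Sup k) - u (Inf k)"] by linarith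
      moreover have "variation_in u {a..Sup k} - variation_in u {a..Inf k} \<le> variation_in u k"
        using variation_in_subadd[OF ends] kk(1)[OF k] by simp
      moreover have "increments u (D k) = increments u (D' k)"
        unfolding increments_def
      proof (rule sum.mono_neutral_right[OF Dk(3)[OF k]])
        show "D' k \<subseteq> D k" by (auto simp: D'_def)
        show "\<forall>j\<in>D k - D' k. norm (u (Sup j) - u (Inf j)) = 0"
        proof
          fix j assume j: "j \<in> D k - D' k"
          then have "Inf j \<le> Sup j" using division_of_real_interval(2)[OF Dk(1)[OF k], of j] by auto
          then have "Inf j = Sup j" using j by (auto simp: D'_def)
          then show "norm (u (Sup j) - u (Inf j)) = 0" by simp
        qed
      qed
      ultimately show "norm (variation_in u {a..Sup k} - variation_in u {a..Inf k}) \<le> increments u (D' k) + \<eta>"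
        using D(2)[OF k] by simp
    qed
    also have "\<dots> = (\<Sum>k\<in>d. increments u (D' k)) + card d * \<eta>" by (simp add: sum.distrib)
    also have "\<dots> < \<epsilon> / 4 + \<epsilon> / 4"
    proof (rule add_strict_mono[OF small])
      have "card d * \<eta> = \<epsilon> / 4 * (card d / (card d + 1))" by (simp add: \<eta>_def)
      also have "\<dots> < \<epsilon> / 4 * 1" using \<open>0 < \<epsilon>\<close> by (intro mult_strict_left_mono) auto
      finally show "card d * \<eta> < \<epsilon> / 4" by simp
    qed
    also have "\<dots> < \<epsilon>" using \<open>0 < \<epsilon>\<close> by simp
    finally show "(\<Sum>k\<in>d. norm (variation_in u {a..Sup k} - variation_in u {a..Inf k})) < \<epsilon>" .
  qed (fact \<open>\<delta> > 0\<close>)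
qed

lemma variation_in_le: "variation_in u {a..b} \<le> max 0 K"
  unfolding variation_in_def using empty_partial_division increments_le_total_variation[OF tv]
  by (intro cSUP_least) auto

end

text \<open>The later estimates see the variation of \<open>u\<close> only through such a dominating
  function, which leaves room for others, such as multiples of a clock.\<close>

lemma dominating_abs_continuous_function:
  assumes ab: "a \<le> b" and u: "abs_continuous_on {a..b} u" and tv: "total_variation a b u \<le> ennreal K"
  obtains \<nu> :: "real \<Rightarrow> real" where "abs_continuous_on {a..b} \<nu>"
    "\<And>s t. a \<le> s \<Longrightarrow> s \<le> t \<Longrightarrow> t \<le> b \<Longrightarrow> norm (u t - u s) \<le> \<nu> t - \<nu> s"
    "\<nu> b - \<nu> a \<le> max 0 K"
proof (rule that[of "\<lambda>t. variation_in u {a..t}"])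
  show "abs_continuous_on {a..b} (\<lambda>t. variation_in u {a..t})"
    by (rule abs_continuous_on_variation[OF tv u])
  show "norm (u t - u s) \<le> variation_in u {a..t} - variation_in u {a..s}"
    if "a \<le> s" "s \<le> t" "t \<le> b" for s t
    using variation_in_superadd[OF tv, of a s t] that by simp
  have "increments u {} \<le> variation_in u {a..a}"
    using ab by (intro increments_le_variation_in[OF tv] empty_partial_division) auto
  then show "variation_in u {a..b} - variation_in u {a..a} \<le> max 0 K"
    using increments_nonneg[of u "{}"] variation_in_le[OF tv] by linarith
qed

section \<open>Increments of absolutely continuous functions\<close>

text \<open>Cousin's argument: a fine tagged division splits into tags outside \<open>N\<close>,
  where the derivatives compare the increment of \<open>Z\<close> with that of \<open>\<nu>\<close>
  up to a multiple of \<open>e\<close>, and tags in \<open>N\<close>, whose intervals lie in an open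
  set of measure below the \<open>\<delta>\<close> of the absolute continuity of \<open>Z\<close>.
  No derivative of \<open>\<nu>\<close> is taken: \<open>norm w'\<close> is bounded by increments of
  \<open>u\<close>, hence of \<open>\<nu>\<close>.\<close>

theorem increment_le_dominated:
  fixes Z :: "real \<Rightarrow> 'e::euclidean_space" and u :: "real \<Rightarrow> 'f::euclidean_space"
  assumes pq: "p \<le> q" and Z: "abs_continuous_on {p..q} Z" and N: "negligible N" and B: "0 \<le> B"
    and der: "\<And>t. t \<in> {p..q} - N \<Longrightarrow> \<exists>z' w'. (Z has_vector_derivative z') (at t within {p..q}) \<and>
        (u has_vector_derivative w') (at t within {p..q}) \<and> norm z' \<le> B * norm w'"
    and dom: "\<And>s t. p \<le> s \<Longrightarrow> s \<le> t \<Longrightarrow> t \<le> q \<Longrightarrow> norm (u t - u s) \<le> \<nu> t - \<nu> s"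
  shows "norm (Z q - Z p) \<le> B * (\<nu> q - \<nu> p)"
proof -
  have step: "norm (Z q - Z p) \<le> B * (\<nu> q - \<nu> p) + ((B + 1) * (q - p) + 1) * e" if e: "0 < e" for e
  proof -
    obtain \<delta> where "\<delta> > 0" and \<delta>: "\<And>d T. d division_of T \<Longrightarrow> T \<subseteq> {p..q} \<Longrightarrow> (\<Sum>k\<in>d. Sup k - Inf k) < \<delta> \<Longrightarrow>
        (\<Sum>k\<in>d. norm (Z (Sup k) - Z (Inf k))) < e"
      using Z e unfolding abs_continuous_on_def by meson
    have Nl: "N \<in> sets lebesgue" "emeasure lebesgue N = 0"
      using N by (auto simp: negligible_iff_null_sets)
    obtain T where T: "open T" "N \<subseteq> T" "T - N \<in> lmeasurable" "emeasure lebesgue (T - N) < ennreal \<delta>"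
      using sets_lebesgue_outer_open[OF Nl(1) \<open>\<delta> > 0\<close>] by blast
    have "T = (T - N) \<union> N" using T(2) by blast
    then have Tm: "T \<in> lmeasurable" "measure lebesgue T < \<delta>"
    proof -
      have "N \<in> lmeasurable" using N by (rule negligible_imp_measurable)
      then show "T \<in> lmeasurable" using T(3) \<open>T = (T - N) \<union> N\<close> by (metis fmeasurable.Un)
      have "measure lebesgue (T - N) < \<delta>"
        using T(4) \<open>\<delta> > 0\<close> by (simp add: emeasure_eq_measure2[OF T(3)] ennreal_less_iff)
      moreover have "measure lebesgue T \<le> measure lebesgue (T - N) + measure lebesgue N"
        using \<open>T = (T - N) \<union> N\<close> measure_Un_le[of "T - N" lebesgue N] T(3) \<open>N \<in> lmeasurable\<close>
        by (metis fmeasurableD)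
      ultimately show "measure lebesgue T < \<delta>" using N by (simp add: negligible_imp_measure0)
    qed
    \<comment> \<open>The tag lies between \<open>s\<close> and \<open>r\<close>, so that the local
      estimate applies to a whole interval of the division.\<close>
    define good where "good = (\<lambda>t d. 0 < d \<and> (\<forall>s r. s \<in> {p..q} \<longrightarrow> r \<in> {p..q} \<longrightarrow> s \<le> t \<longrightarrow> t \<le> r \<longrightarrow>
      {s..r} \<subseteq> ball t d \<longrightarrow> norm (Z r - Z s) \<le> B * (\<nu> r - \<nu> s) + (B + 1) * e * (r - s)))"
    have "\<exists>d. good t d" if t: "t \<in> {p..q} - N" for t
    proof -
      obtain z' w' where Z': "(Z has_vector_derivative z') (at t within {p..q})"
        and u': "(u has_vector_derivative w') (at t within {p..q})" and le: "norm z' \<le> B * norm w'"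
        using der[OF t] by blast
      obtain d1 where d1: "d1 > 0" "\<And>y. y \<in> {p..q} \<Longrightarrow> \<bar>y - t\<bar> < d1 \<Longrightarrow> norm (Z y - Z t - (y - t) *\<^sub>R z') \<le> e * \<bar>y - t\<bar>"
        using Z' e unfolding has_vector_derivative_within_alt by blast
      obtain d2 where d2: "d2 > 0" "\<And>y. y \<in> {p..q} \<Longrightarrow> \<bar>y - t\<bar> < d2 \<Longrightarrow> norm (u y - u t - (y - t) *\<^sub>R w') \<le> e * \<bar>y - t\<bar>"
        using u' e unfolding has_vector_derivative_within_alt by blast
      have "good t (min d1 d2)"
        unfolding good_def
      proof (intro conjI allI impI)
        show "0 < min d1 d2" using d1 d2 by simp
        fix s r assume sr: "s \<in> {p..q}" "r \<in> {p..q}" "s \<le> t" "t \<le> r" "{s..r} \<subseteq> ball t (min d1 d2)"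
        have "s \<in> {s..r}" "r \<in> {s..r}" using sr(3,4) by auto
        then have "s \<in> ball t (min d1 d2)" "r \<in> ball t (min d1 d2)" using sr(5) by blast+
        then have cl: "\<bar>s - t\<bar> < d1" "\<bar>r - t\<bar> < d1" "\<bar>s - t\<bar> < d2" "\<bar>r - t\<bar> < d2"
          by (auto simp: dist_real_def)
        have gen: "norm ((h r - h s) - (r - s) *\<^sub>R h') \<le> e * (r - s)"
          if "norm (h r - h t - (r - t) *\<^sub>R h') \<le> e * \<bar>r - t\<bar>" "norm (h s - h t - (s - t) *\<^sub>R h') \<le> e * \<bar>s - t\<bar>"
          for h :: "real \<Rightarrow> 'x::euclidean_space" and h'
        proof -
          have "(h r - h s) - (r - s) *\<^sub>R h' = (h r - h t - (r - t) *\<^sub>R h') - (h s - h t - (s - t) *\<^sub>R h')"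
            by (simp add: algebra_simps)
          then have "norm ((h r - h s) - (r - s) *\<^sub>R h') \<le> norm (h r - h t - (r - t) *\<^sub>R h') + norm (h s - h t - (s - t) *\<^sub>R h')"
            by (metis norm_triangle_ineq4)
          also have "\<dots> \<le> e * \<bar>r - t\<bar> + e * \<bar>s - t\<bar>" by (rule add_mono[OF that])
          also have "\<dots> = e * (r - s)" using sr by (simp add: algebra_simps)
          finally show ?thesis .
        qed
        have 1: "norm ((Z r - Z s) - (r - s) *\<^sub>R z') \<le> e * (r - s)"
          by (rule gen) (use d1(2) sr cl in blast)+
        have 2: "norm ((u r - u s) - (r - s) *\<^sub>R w') \<le> e * (r - s)"
          by (rule gen) (use d2(2) sr cl in blast)+
        have rs: "0 \<le> r - s" using sr by simp
        have "(r - s) * norm w' = norm ((r - s) *\<^sub>R w')" using rs by simp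
        also have "\<dots> \<le> norm (u r - u s) + e * (r - s)"
          using 2 norm_triangle_ineq3[of "(r - s) *\<^sub>R w'" "u r - u s"] by (simp add: norm_minus_commute)
        also have "\<dots> \<le> (\<nu> r - \<nu> s) + e * (r - s)" using dom[of s r] sr by simp
        finally have 3: "(r - s) * norm w' \<le> (\<nu> r - \<nu> s) + e * (r - s)" .
        have "norm (Z r - Z s) \<le> norm ((r - s) *\<^sub>R z') + e * (r - s)"
          using 1 norm_triangle_ineq2[of "Z r - Z s" "(r - s) *\<^sub>R z'"] by simp
        also have "norm ((r - s) *\<^sub>R z') = (r - s) * norm z'" using rs by simp
        also have "(r - s) * norm z' \<le> (r - s) * (B * norm w')" using rs le by (rule mult_left_mono[rotated])
        also have "\<dots> = B * ((r - s) * norm w')" by simp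
        also have "\<dots> \<le> B * ((\<nu> r - \<nu> s) + e * (r - s))" using 3 B by (rule mult_left_mono)
        finally show "norm (Z r - Z s) \<le> B * (\<nu> r - \<nu> s) + (B + 1) * e * (r - s)"
          by (simp add: algebra_simps)
      qed
      then show ?thesis by blast
    qed
    then obtain D where D: "\<And>t. t \<in> {p..q} - N \<Longrightarrow> good t (D t)" by metis
    \<comment> \<open>Tags in \<open>N\<close> are confined to the thin open set \<open>T\<close>,
      the others to the ball of their local estimate; the radius 1 outside \<open>{p..q}\<close> is
      arbitrary.\<close>
    define \<gamma> where "\<gamma> = (\<lambda>t. if t \<in> N then T else if t \<in> {p..q} then ball t (D t) else ball t 1)"
    have "gauge \<gamma>"
      unfolding gauge_def \<gamma>_def using T(1,2) D by (auto simp: good_def)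
    then obtain P where P: "P tagged_division_of {p..q}" "\<gamma> fine P"
      by (rule fine_division_exists_real)
    have finP: "finite P" using P(1) by (simp add: tagged_division_of_finite)
    have mem: "x \<in> k" "k = {Inf k..Sup k}" "Inf k \<le> x" "x \<le> Sup k" "Inf k \<in> {p..q}" "Sup k \<in> {p..q}" "x \<in> {p..q}"
      if xkP: "(x,k) \<in> P" for x k
    proof -
      obtain c d where cd: "k = cbox c d" using tagged_division_ofD(4)[OF P(1) xkP] by blast
      have xk: "x \<in> k" "k \<subseteq> {p..q}" using tagged_division_ofD(2,3)[OF P(1) xkP] by auto
      show "x \<in> k" by (rule xk)
      show "k = {Inf k..Sup k}" "Inf k \<le> x" "x \<le> Sup k" "Inf k \<in> {p..q}" "Sup k \<in> {p..q}" "x \<in> {p..q}"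
        using cd xk by auto
    qed
    define P1 where "P1 = {(x,k) \<in> P. x \<in> N}"
    define P2 where "P2 = P - P1"
    have P12: "P = P1 \<union> P2" "P1 \<inter> P2 = {}" "finite P1" "finite P2"
      using finP rev_finite_subset[OF finP, of P1] by (auto simp: P1_def P2_def)
    have zlen: "(\<Sum>(x,k)\<in>P. Sup k - Inf k) = q - p"
      using additive_tagged_division_1[OF pq P(1), of "\<lambda>x. x"] by simp
    have znu: "(\<Sum>(x,k)\<in>P. \<nu> (Sup k) - \<nu> (Inf k)) = \<nu> q - \<nu> p"
      by (rule additive_tagged_division_1[OF pq P(1)])
    have "Z q - Z p = (\<Sum>(x,k)\<in>P. Z (Sup k) - Z (Inf k))"
      by (rule additive_tagged_division_1[OF pq P(1), symmetric])
    then have "norm (Z q - Z p) \<le> (\<Sum>(x,k)\<in>P. norm (Z (Sup k) - Z (Inf k)))"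
      by (auto simp: case_prod_unfold intro: norm_sum)
    also have "\<dots> = (\<Sum>(x,k)\<in>P1. norm (Z (Sup k) - Z (Inf k))) + (\<Sum>(x,k)\<in>P2. norm (Z (Sup k) - Z (Inf k)))"
      using P12 by (subst P12(1), subst sum.union_disjoint) auto
    also have "(\<Sum>(x,k)\<in>P2. norm (Z (Sup k) - Z (Inf k))) \<le> (\<Sum>(x,k)\<in>P2. B * (\<nu> (Sup k) - \<nu> (Inf k)) + (B + 1) * e * (Sup k - Inf k))"
    proof (rule sum_mono, clarify)
      fix x k assume xk: "(x,k) \<in> P2"
      then have xP: "(x,k) \<in> P" and xN: "x \<in> {p..q} - N" using mem(7) by (auto simp: P1_def P2_def)
      have "k \<subseteq> ball x (D x)" using P(2) xP xN unfolding fine_def \<gamma>_def by fastforce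
      then have "{Inf k..Sup k} \<subseteq> ball x (D x)" using mem(2)[OF xP] by simp
      then show "norm (Z (Sup k) - Z (Inf k)) \<le> B * (\<nu> (Sup k) - \<nu> (Inf k)) + (B + 1) * e * (Sup k - Inf k)"
        using D[OF xN] mem[OF xP] unfolding good_def by blast
    qed
    also have "\<dots> \<le> (\<Sum>(x,k)\<in>P. B * (\<nu> (Sup k) - \<nu> (Inf k)) + (B + 1) * e * (Sup k - Inf k))"
    proof (rule sum_mono2[OF finP], use P12 in blast, clarify)
      fix x k assume xP: "(x,k) \<in> P"
      have "0 \<le> norm (u (Sup k) - u (Inf k))" by simp
      also have "\<dots> \<le> \<nu> (Sup k) - \<nu> (Inf k)" using mem[OF xP] by (intro dom) auto
      finally have "0 \<le> B * (\<nu> (Sup k) - \<nu> (Inf k))" using B by simp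
      moreover have "0 \<le> (B + 1) * e * (Sup k - Inf k)" using B e mem(3,4)[OF xP] by simp
      ultimately show "0 \<le> B * (\<nu> (Sup k) - \<nu> (Inf k)) + (B + 1) * e * (Sup k - Inf k)" by linarith
    qed
    also have "\<dots> = B * (\<nu> q - \<nu> p) + (B + 1) * e * (q - p)"
      unfolding znu[symmetric] zlen[symmetric] by (simp add: sum.distrib sum_distrib_left case_prod_unfold)
    also have "(\<Sum>(x,k)\<in>P1. norm (Z (Sup k) - Z (Inf k))) \<le> e"
    proof -
      have part: "P1 tagged_partial_division_of {p..q}"
        using tagged_division_ofD(1-5)[OF P(1)]
        by (intro tagged_partial_division_subset[of P _ P1]) (use P(1) in \<open>auto simp: P1_def tagged_division_of_def\<close>)
      have td: "P1 tagged_division_of \<Union>(snd ` P1)"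
        using tagged_partial_division_of_Union_self[OF part] by simp
      have dv: "snd ` P1 division_of \<Union>(snd ` P1)"
        using division_of_tagged_division[OF td] .
      have subT: "\<Union>(snd ` P1) \<subseteq> T"
      proof clarify
        fix x y k assume "(y,k) \<in> P1" "x \<in> snd (y,k)"
        then show "x \<in> T" using P(2) unfolding fine_def \<gamma>_def P1_def by fastforce
      qed
      have "(\<Sum>k\<in>snd ` P1. Sup k - Inf k) = (\<Sum>k\<in>snd ` P1. measure lebesgue k)"
      by (intro sum.cong) (auto simp: division_of_measure_eq[OF dv])
      also have "\<dots> = measure lebesgue (\<Union>(snd ` P1))"
        using content_division[OF dv] by simp
      also have "\<dots> \<le> measure lebesgue T"
        using division_of_finite[OF dv] dv subT Tm(1) by (intro measure_mono_fmeasurable) (auto intro!: sets.finite_Union lmeasurable_division[THEN fmeasurableD])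
      also have "\<dots> < \<delta>" by (rule Tm)
      finally have lt: "(\<Sum>k\<in>snd ` P1. Sup k - Inf k) < \<delta>" .
      have "\<Union>(snd ` P1) \<subseteq> {p..q}"
        using tagged_division_ofD(3)[OF P(1)] unfolding P1_def by fastforce
      from \<delta>[OF dv this lt] have "(\<Sum>k\<in>snd ` P1. norm (Z (Sup k) - Z (Inf k))) < e" .
      moreover have "(\<Sum>(x,k)\<in>P1. norm (Z (Sup k) - Z (Inf k))) = (\<Sum>k\<in>snd ` P1. norm (Z (Sup k) - Z (Inf k)))"
      proof -
        \<comment> \<open>Different tags can share an interval only if it is a point, and then the
          term is 0.\<close>
        have "(\<Sum>k\<in>snd ` P1. norm (Z (Sup k) - Z (Inf k))) = sum ((\<lambda>k. norm (Z (Sup k) - Z (Inf k))) \<circ> snd) P1"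
        proof (rule sum.reindex_nontrivial[OF P12(3)])
          fix i j assume "i \<in> P1" "j \<in> P1" "i \<noteq> j" "snd i = snd j"
          then obtain x y k where ij: "(x,k) \<in> P" "(y,k) \<in> P" "(x,k) \<noteq> (y,k)" "k = snd i"
            by (cases i, cases j) (auto simp: P1_def)
          then have "interior k = {}" using tagged_division_ofD(5)[OF P(1) ij(1-3)] by simp
          then have "\<not> Inf k < Sup k"
            using mem(2)[OF ij(1)] interior_atLeastAtMost_real[of "Inf k" "Sup k"] dense[of "Inf k" "Sup k"] by auto
          then have "Inf k = Sup k" using mem(3,4)[OF ij(1)] by simp
          then show "norm (Z (Sup (snd i)) - Z (Inf (snd i))) = 0" using ij(4) by simp
        qed
        then show ?thesis by (simp add: case_prod_unfold o_def)
      qed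
      ultimately show ?thesis by simp
    qed
    finally show ?thesis by (simp add: algebra_simps)
  qed
  let ?c = "(B + 1) * (q - p) + 1"
  have c: "0 < ?c" using B pq by (simp add: add_nonneg_pos)
  show ?thesis
  proof (rule field_le_epsilon)
    fix e :: real assume "0 < e"
    then have "0 < e / ?c" using c by simp
    from step[OF this] show "norm (Z q - Z p) \<le> B * (\<nu> q - \<nu> p) + e" using c by simp
  qed
qed

text \<open>On a stretch where \<open>L\<close> times the increment of \<open>\<mu>\<close> is at
  most 1/2, the maximum of \<open>norm (D r)\<close> is absorbed and is at most twice the starting
  value plus \<open>e\<close>. \<open>n\<close> counts such stretches, and the recursion from
  \<open>c\<close> to \<open>2 * c + 1\<close> produces \<open>2 ^ n - 1\<close>.\<close>

lemma gronwall_increments: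
  fixes D :: "real \<Rightarrow> 'e::euclidean_space" and \<mu> :: "real \<Rightarrow> real"
  assumes D: "continuous_on {a..b} D" and \<mu>: "continuous_on {a..b} \<mu>"
    and mono: "\<And>s t. a \<le> s \<Longrightarrow> s \<le> t \<Longrightarrow> t \<le> b \<Longrightarrow> \<mu> s \<le> \<mu> t"
    and L: "0 \<le> L" and e: "0 \<le> e" and Da: "D a = 0"
    and inc: "\<And>s t B. a \<le> s \<Longrightarrow> s \<le> t \<Longrightarrow> t \<le> b \<Longrightarrow> (\<And>r. s \<le> r \<Longrightarrow> r \<le> t \<Longrightarrow> norm (D r) \<le> B) \<Longrightarrow>
        norm (D t - D s) \<le> L * (B + e) * (\<mu> t - \<mu> s)"
    and t: "a \<le> t" "t \<le> b" "2 * L * (\<mu> t - \<mu> a) \<le> real n"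
  shows "norm (D t) \<le> (2 ^ n - 1) * e"
  using t
proof (induction n arbitrary: t)
  case 0
  \<comment> \<open>For \<open>n = 0\<close> the total growth is nonpositive, so any bound on
    \<open>D\<close> makes the right-hand side nonpositive.\<close>
  obtain B where B: "0 < B" "\<forall>x\<in>D ` {a..b}. norm x \<le> B"
    using compact_imp_bounded[OF compact_continuous_image[OF D compact_Icc]] unfolding bounded_pos by blast
  have "norm (D t - D a) \<le> L * (B + e) * (\<mu> t - \<mu> a)"
    using 0 B(2) by (intro inc) auto
  also have "\<dots> = (B + e) * (L * (\<mu> t - \<mu> a))" by simp
  also have "\<dots> \<le> 0"
  proof (rule mult_nonneg_nonpos)
    show "0 \<le> B + e" using B(1) e by simp
    show "L * (\<mu> t - \<mu> a) \<le> 0" using 0 by simp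
  qed
  finally show ?case using Da by simp
next
  case (Suc n)
  show ?case
  proof (cases "2 * L * (\<mu> t - \<mu> a) \<le> real n")
    case True
    have "(2 ^ n - 1) * e \<le> (2 ^ Suc n - 1) * e" using e by (intro mult_right_mono) auto
    with Suc.IH[OF Suc.prems(1,2) True] show ?thesis by linarith
  next
    case False
    have "continuous_on {a..t} (\<lambda>r. 2 * L * (\<mu> r - \<mu> a))"
      using continuous_on_subset[OF \<mu>, of "{a..t}"] Suc.prems by (auto intro!: continuous_intros)
    \<comment> \<open>The last stretch starts where the growth is exactly \<open>n\<close>;
      continuity of \<open>\<mu>\<close> provides such a point.\<close>
    then obtain t0 where t0: "a \<le> t0" "t0 \<le> t" "2 * L * (\<mu> t0 - \<mu> a) = real n"
      using IVT'[of "\<lambda>r. 2 * L * (\<mu> r - \<mu> a)" a "real n" t] False Suc.prems by auto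
    have IH: "norm (D t0) \<le> (2 ^ n - 1) * e" using t0 Suc.prems by (intro Suc.IH) auto
    have "continuous_on {t0..t} (\<lambda>r. norm (D r))"
      using continuous_on_subset[OF D, of "{t0..t}"] Suc.prems t0 by (auto intro!: continuous_intros)
    then obtain m where m: "m \<in> {t0..t}" "\<And>r. r \<in> {t0..t} \<Longrightarrow> norm (D r) \<le> norm (D m)"
      using continuous_attains_sup[of "{t0..t}" "\<lambda>r. norm (D r)"] t0(2) by auto
    have "norm (D m - D t0) \<le> L * (norm (D m) + e) * (\<mu> m - \<mu> t0)"
      using m t0 Suc.prems by (intro inc) auto
    also have "\<dots> = (norm (D m) + e) * (L * (\<mu> m - \<mu> t0))" by simp
    also have "\<dots> \<le> (norm (D m) + e) * (1 / 2)"
    proof (rule mult_left_mono)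
      have "\<mu> m \<le> \<mu> t" using m t0 Suc.prems by (intro mono) auto
      then have "L * \<mu> m \<le> L * \<mu> t" using L by (rule mult_left_mono)
      then show "L * (\<mu> m - \<mu> t0) \<le> 1 / 2" using t0(3) Suc.prems(3) by (simp add: algebra_simps)
    qed (use e in auto)
    finally have "norm (D m) \<le> norm (D t0) + (norm (D m) + e) / 2"
      using norm_triangle_ineq2[of "D m" "D t0"] by linarith
    then have "norm (D m) \<le> 2 * norm (D t0) + e" by argo
    also have "\<dots> \<le> 2 * ((2 ^ n - 1) * e) + e" using IH by simp
    also have "\<dots> = (2 ^ Suc n - 1) * e" by (simp add: algebra_simps)
    finally show ?thesis using m(2)[of t] t0(2) by simp
  qed
qed

text \<open>Bisection at the midpoint of the values of \<open>\<mu>\<close>, not of time: the linear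
  terms add up exactly, while the two halves together carry only half of the quadratic
  error.\<close>

lemma quadratic_error_negligible:
  fixes D :: "real \<Rightarrow> 'e::euclidean_space" and \<mu> :: "real \<Rightarrow> real"
  assumes \<mu>: "continuous_on {p..q} \<mu>" and pq: "p \<le> q" and C: "0 \<le> C"
    and mono: "\<And>s t. p \<le> s \<Longrightarrow> s \<le> t \<Longrightarrow> t \<le> q \<Longrightarrow> \<mu> s \<le> \<mu> t"
    and inc: "\<And>s t. p \<le> s \<Longrightarrow> s \<le> t \<Longrightarrow> t \<le> q \<Longrightarrow>
        norm (D t - D s) \<le> A * (\<mu> t - \<mu> s) + C * (\<mu> t - \<mu> s)\<^sup>2"
  shows "norm (D q - D p) \<le> A * (\<mu> q - \<mu> p)"
proof -
  have *: "norm (D t - D s) \<le> A * (\<mu> t - \<mu> s) + C * (\<mu> t - \<mu> s)\<^sup>2 / 2 ^ n"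
    if "p \<le> s" "s \<le> t" "t \<le> q" for s t n
    using that
  proof (induction n arbitrary: s t)
    case 0 then show ?case using inc by simp
  next
    case (Suc n)
    have "continuous_on {s..t} \<mu>" using Suc.prems by (intro continuous_on_subset[OF \<mu>]) auto
    then obtain r where r: "s \<le> r" "r \<le> t" "\<mu> r = (\<mu> s + \<mu> t) / 2"
      using IVT'[of \<mu> s "(\<mu> s + \<mu> t) / 2" t] mono[of s t] Suc.prems by auto
    have "norm (D t - D s) \<le> norm (D t - D r) + norm (D r - D s)"
      using norm_triangle_ineq[of "D t - D r" "D r - D s"] by simp
    also have "\<dots> \<le> (A * (\<mu> t - \<mu> r) + C * (\<mu> t - \<mu> r)\<^sup>2 / 2 ^ n) + (A * (\<mu> r - \<mu> s) + C * (\<mu> r - \<mu> s)\<^sup>2 / 2 ^ n)"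
      using r Suc.prems by (intro add_mono Suc.IH) auto
    also have "\<dots> = A * (\<mu> t - \<mu> s) + C * (\<mu> t - \<mu> s)\<^sup>2 / 2 ^ Suc n"
      unfolding r(3) by (simp add: field_simps power2_eq_square)
    finally show ?case .
  qed
  have "(\<lambda>n. A * (\<mu> q - \<mu> p) + C * (\<mu> q - \<mu> p)\<^sup>2 * (1 / 2) ^ n) \<longlonglongrightarrow> A * (\<mu> q - \<mu> p) + C * (\<mu> q - \<mu> p)\<^sup>2 * 0"
    by (intro tendsto_intros LIMSEQ_realpow_zero) auto
  then show ?thesis
    using *[of p q] pq by (intro LIMSEQ_le_const[where x="A * (\<mu> q - \<mu> p)"]) (auto simp: power_one_over field_simps)
qed

section \<open>Absolutely continuous functions as indefinite integrals\<close>

text \<open>The epsilon-delta condition makes the Stieltjes measure of \<open>F\<close> absolutely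
  continuous with respect to Lebesgue measure; \<open>g\<close> is its Radon-Nikodym
  density.\<close>

lemma increasing_abs_continuous_is_integral:
  fixes F :: "real \<Rightarrow> real"
  assumes ab: "a \<le> b" and F: "abs_continuous_on {a..b} F"
    and mono: "\<And>s t. a \<le> s \<Longrightarrow> s \<le> t \<Longrightarrow> t \<le> b \<Longrightarrow> F s \<le> F t"
  obtains g where "g absolutely_integrable_on {a..b}"
    "\<And>t. t \<in> {a..b} \<Longrightarrow> (g has_integral F t - F a) {a..t}"
proof -
  \<comment> \<open>Constant continuation outside the interval gives a Stieltjes measure that is
    carried by \<open>{a..b}\<close>.\<close>
  define G where "G = (\<lambda>x. F (max a (min b x)))"
  have G_mono: "G x \<le> G y" if "x \<le> y" for x y
    unfolding G_def using that ab by (intro mono) (auto simp: max_def min_def)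
  have G_cont: "continuous_on UNIV G"
    unfolding G_def using ab
    by (intro continuous_on_compose2[OF abs_continuous_on_imp_continuous_on[OF F]] continuous_intros) auto
  have G_F: "G x = F x" if "x \<in> {a..b}" for x using that by (simp add: G_def)
  define \<mu> where "\<mu> = interval_measure G"
  have sets_\<mu>: "sets \<mu> = sets borel" by (simp add: \<mu>_def)
  have \<mu>_Icc: "emeasure \<mu> {x..y} = ennreal (G y - G x)" if "x \<le> y" for x y
    unfolding \<mu>_def using emeasure_interval_measure_Icc[OF that G_mono G_cont] by simp
  have fm: "{x..y} \<in> fmeasurable \<mu>" for x y
    by (cases "x \<le> y") (auto intro!: fmeasurableI simp: sets_\<mu> \<mu>_Icc)
  have \<mu>_outside: "emeasure \<mu> (-{a..b}) = 0"
  proof -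
    have sub: "-{a..b} \<subseteq> (\<Union>n::nat. {a - n..a} \<union> {b..b + n})"
    proof
      fix x assume x: "x \<in> -{a..b}"
      obtain n::nat where "\<bar>x\<bar> + \<bar>a\<bar> + \<bar>b\<bar> \<le> n" using real_arch_simple by blast
      then have "x \<in> {a - n..a} \<union> {b..b + n}" using x by auto
      then show "x \<in> (\<Union>n::nat. {a - n..a} \<union> {b..b + n})" by blast
    qed
    have z: "{a - real n..a} \<union> {b..b + real n} \<in> null_sets \<mu>" for n
    proof (rule null_sets.Un)
      have "G (a - n) = G a" "G (b + n) = G b" using ab by (auto simp: G_def max_def min_def)
      then show "{a - real n..a} \<in> null_sets \<mu>" "{b..b + real n} \<in> null_sets \<mu>"
        by (auto simp: null_sets_def sets_\<mu> \<mu>_Icc)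
    qed
    have "(\<Union>n::nat. {a - n..a} \<union> {b..b + n}) \<in> null_sets \<mu>"
      by (rule null_sets_UN[OF z])
    then have "-{a..b} \<in> null_sets \<mu>"
      by (rule null_sets_subset) (use sub in \<open>auto simp: sets_\<mu>\<close>)
    then show ?thesis by auto
  qed
  have null_in: "emeasure \<mu> (N \<inter> {a..b}) = 0" if N: "N \<in> null_sets lborel" for N
  \<comment> \<open>The covering lemma used below asks for an interval with interior points; a
    single point has measure 0 anyway.\<close>
  proof (cases "a = b")
    case True
    have "emeasure \<mu> (N \<inter> {a..b}) \<le> emeasure \<mu> {a..b}"
      using N by (intro emeasure_mono) (auto simp: sets_\<mu>)
    then show ?thesis using True \<mu>_Icc[of b b] by simp
  next
    case False
    then have ab': "box a b \<noteq> {}" using ab by simp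
    let ?N = "N \<inter> {a..b}"
    have "?N \<in> null_sets lborel" using N by (rule null_set_Int2) auto
    then have Nl: "?N \<in> null_sets lebesgue" using null_sets_completionI by blast
    have small: "emeasure \<mu> ?N \<le> ennreal e" if e: "0 < e" for e
    proof -
      obtain \<delta> where "\<delta> > 0" and \<delta>: "\<And>d T. d division_of T \<Longrightarrow> T \<subseteq> {a..b} \<Longrightarrow> (\<Sum>k\<in>d. Sup k - Inf k) < \<delta> \<Longrightarrow>
          (\<Sum>k\<in>d. norm (F (Sup k) - F (Inf k))) < e"
        using F e unfolding abs_continuous_on_def by meson
      obtain T where T: "open T" "?N \<subseteq> T" "T - ?N \<in> lmeasurable" "emeasure lebesgue (T - ?N) < ennreal \<delta>"
        using sets_lebesgue_outer_open[OF null_setsD2[OF Nl] \<open>\<delta> > 0\<close>] by blast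
      have Tm: "T \<in> lmeasurable"
      proof -
        have "?N \<in> lmeasurable" using Nl by (simp add: fmeasurableI_null_sets)
        moreover have "T = (T - ?N) \<union> ?N" using T(2) by blast
        ultimately show ?thesis using T(3) by (metis fmeasurable.Un)
      qed
      have "measure lebesgue T = measure lebesgue (T - ?N)"
        using measure_Diff_null_set[OF fmeasurableD[OF Tm] Nl] by simp
      also have "\<dots> < \<delta>"
        using T(4) \<open>\<delta> > 0\<close> by (simp add: emeasure_eq_measure2[OF T(3)] ennreal_less_iff)
      finally have T\<delta>: "measure lebesgue T < \<delta>" .
      \<comment> \<open>This gauge forces every covering interval into \<open>T\<close>, since the
        point attached to it belongs to the null set.\<close>
      have g: "gauge (\<lambda>x. if x \<in> T then T else ball x 1)"
        using T(1) by (auto simp: gauge_def)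
      have Nab: "?N \<subseteq> cbox a b" by auto
      obtain \<D> where \<D>: "countable \<D>" "\<Union>\<D> \<subseteq> cbox a b"
        "\<And>K. K \<in> \<D> \<Longrightarrow> interior K \<noteq> {} \<and> (\<exists>c d. K = cbox c d)"
        "pairwise (\<lambda>A B. interior A \<inter> interior B = {}) \<D>"
        "\<And>K. K \<in> \<D> \<Longrightarrow> \<exists>x \<in> ?N \<inter> K. K \<subseteq> (if x \<in> T then T else ball x 1)" "?N \<subseteq> \<Union>\<D>"
        using covering_lemma[OF Nab ab' g] by metis
      have KT: "K \<subseteq> T" if "K \<in> \<D>" for K 
      proof -
        obtain x where x: "x \<in> ?N \<inter> K" "K \<subseteq> (if x \<in> T then T else ball x 1)" using \<D>(5)[OF \<open>K \<in> \<D>\<close>] by blast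
        then have "x \<in> T" using T(2) by blast
        with x show ?thesis by simp
      qed
      have Kfm: "K \<in> fmeasurable \<mu>" if "K \<in> \<D>" for K
        using \<D>(3)[OF that] fm by (metis box_real(2))
      \<comment> \<open>Absolute continuity speaks of finite families; the bound passes to the
        countable union because it is the same for all of them.\<close>
      have bound: "measure \<mu> (\<Union>K\<in>D. K) \<le> e" if D: "D \<subseteq> \<D>" "finite D" for D
      proof -
        have dv: "D division_of \<Union>D"
        proof (rule division_ofI)
          show "finite D" by (rule D)
          show "\<Union>D = \<Union>D" ..
          fix K assume K: "K \<in> D"
          then show "K \<subseteq> \<Union>D" by blast
          show "K \<noteq> {}" "\<exists>a b. K = cbox a b" using \<D>(3)[of K] K D by auto
          fix L assume "L \<in> D" "K \<noteq> L"
          then show "interior K \<inter> interior L = {}" using \<D>(4) K D unfolding pairwise_def by blast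
        qed
        note kk = division_of_real_interval[OF dv]
        have sub: "\<Union>D \<subseteq> {a..b}" using \<D>(2) D by auto
        have "(\<Sum>k\<in>D. Sup k - Inf k) = (\<Sum>k\<in>D. measure lebesgue k)"
        by (intro sum.cong) (auto simp: division_of_measure_eq[OF dv])
        also have "\<dots> = measure lebesgue (\<Union>D)"
          using content_division[OF dv] by simp
        also have "\<dots> \<le> measure lebesgue T"
          using KT D dv Tm by (intro measure_mono_fmeasurable) (auto intro!: lmeasurable_division[THEN fmeasurableD])
        also have "\<dots> < \<delta>" by (rule T\<delta>)
        finally have lt: "(\<Sum>k\<in>D. norm (F (Sup k) - F (Inf k))) < e"
          by (rule \<delta>[OF dv sub])
        have "measure \<mu> (\<Union>K\<in>D. K) \<le> (\<Sum>K\<in>D. measure \<mu> K)"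
          using D Kfm by (intro measure_UNION_le) (auto intro: fmeasurableD)
        also have "\<dots> = (\<Sum>k\<in>D. norm (F (Sup k) - F (Inf k)))"
        proof (rule sum.cong)
          fix k assume k: "k \<in> D"
          have "Inf k \<in> {a..b}" "Sup k \<in> {a..b}" using kk(3,4)[OF k] sub by auto
          then have "emeasure \<mu> k = ennreal (F (Sup k) - F (Inf k))" "F (Inf k) \<le> F (Sup k)"
            using kk(1,2)[OF k] \<mu>_Icc[OF kk(2)[OF k]] G_F mono by auto
          then show "measure \<mu> k = norm (F (Sup k) - F (Inf k))" by (simp add: measure_def)
        qed simp
        finally show ?thesis using lt by simp
      qed
      have "(\<Union>K\<in>\<D>. K) \<in> fmeasurable \<mu>" "measure \<mu> (\<Union>K\<in>\<D>. K) \<le> e"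
        using fmeasurable_UN_bound[OF \<D>(1) Kfm bound] measure_UN_bound[OF \<D>(1) Kfm bound] by auto
      then have "emeasure \<mu> (\<Union>\<D>) \<le> ennreal e" "\<Union>\<D> \<in> sets \<mu>"
        by (auto simp: emeasure_eq_measure2 intro: ennreal_leI)
      then show ?thesis using emeasure_mono[OF \<D>(6)] by (meson order_trans)
    qed
    show ?thesis
    proof (rule antisym[OF ennreal_le_epsilon])
      show "emeasure \<mu> ?N \<le> 0 + ennreal e" if "0 < e" for e using small[OF that] by simp
    qed auto
  qed
  have ac: "absolutely_continuous lborel \<mu>"
    unfolding absolutely_continuous_def
  proof
    fix N :: "real set" assume N: "N \<in> null_sets lborel"
    have Ns: "N \<in> sets \<mu>" using N by (auto simp: sets_\<mu>)
    have "emeasure \<mu> N \<le> emeasure \<mu> (N \<inter> {a..b}) + emeasure \<mu> (-{a..b})"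
      using Ns by (intro order_trans[OF emeasure_mono[of N "(N \<inter> {a..b}) \<union> (-{a..b})"] emeasure_subadditive]) (auto simp: sets_\<mu>)
    then show "N \<in> null_sets \<mu>" using null_in[OF N] \<mu>_outside Ns by (auto simp: null_sets_def)
  qed
  obtain f where f: "f \<in> borel_measurable lborel" "density lborel f = \<mu>"
    using sigma_finite_measure.Radon_Nikodym[OF sigma_finite_lborel ac] sets_\<mu> by auto
  \<comment> \<open>\<open>enn2real\<close> sends infinite values of the density to 0; on
    \<open>{a..b}\<close> these form a null set, the total mass being finite.\<close>
  define g where "g = (\<lambda>x. enn2real (f x))"
  have gm[measurable]: "g \<in> borel_measurable lborel" using f(1) by (simp add: g_def)
  have fI: "(\<integral>\<^sup>+x. f x * indicator {s..t} x \<partial>lborel) = ennreal (G t - G s)" if "s \<le> t" for s t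
    using emeasure_density[OF f(1), of "{s..t}"] f(2) \<mu>_Icc[OF that] by simp
  have "(\<integral>\<^sup>+x. f x * indicator {a..b} x \<partial>lborel) \<noteq> \<infinity>" using fI[OF ab] by simp
  then have fin: "AE x in lborel. f x * indicator {a..b} x \<noteq> \<infinity>"
    using f(1) by (intro nn_integral_PInf_AE) auto
  have gI: "(\<integral>\<^sup>+x. ennreal (indicator {a..t} x *\<^sub>R g x) \<partial>lborel) = ennreal (F t - F a)" if "t \<in> {a..b}" for t
  proof -
    have "(\<integral>\<^sup>+x. ennreal (indicator {a..t} x *\<^sub>R g x) \<partial>lborel) = (\<integral>\<^sup>+x. f x * indicator {a..t} x \<partial>lborel)"
    proof (rule nn_integral_cong_AE)
      show "AE x in lborel. ennreal (indicator {a..t} x *\<^sub>R g x) = f x * indicator {a..t} x"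
        using fin by eventually_elim (use that in \<open>auto simp: g_def indicator_def less_top split: if_splits\<close>)
    qed
    also have "\<dots> = ennreal (F t - F a)" using fI[of a t] that G_F by simp
    finally show ?thesis .
  qed
  have gint: "integrable lborel (\<lambda>x. indicator {a..t} x *\<^sub>R g x)" "(LINT x|lborel. indicator {a..t} x *\<^sub>R g x) = F t - F a"
    if t: "t \<in> {a..b}" for t
  proof -
    have "0 \<le> F t - F a" using mono[of a t] t by simp
    have nn: "AE x in lborel. 0 \<le> indicator {a..t} x *\<^sub>R g x" by (auto simp: g_def)
    show "integrable lborel (\<lambda>x. indicator {a..t} x *\<^sub>R g x)"
      using gI[OF t] nn by (intro integrableI_nonneg) auto
    show "(LINT x|lborel. indicator {a..t} x *\<^sub>R g x) = F t - F a"
      using gI[OF t] nn \<open>0 \<le> F t - F a\<close> by (subst integral_eq_nn_integral) auto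
  qed
  show ?thesis
  proof (rule that)
    show "g absolutely_integrable_on {a..b}"
    proof -
      have "set_integrable lborel {a..b} g" using gint(1)[of b] ab by (simp add: set_integrable_def)
      then have "set_integrable lebesgue {a..b} g" unfolding set_integrable_def
        by (subst integrable_completion) auto
      then show ?thesis .
    qed
    fix t assume t: "t \<in> {a..b}"
    have "set_integrable lborel {a..t} g" using gint(1)[OF t] by (simp add: set_integrable_def)
    show "(g has_integral F t - F a) {a..t}"
      using set_borel_integral_eq_integral[OF \<open>set_integrable lborel {a..t} g\<close>] gint(2)[OF t]
      by (simp add: set_lebesgue_integral_def has_integral_iff)
  qed
qed

text \<open>Each component of \<open>u\<close> becomes increasing after adding \<open>\<nu>\<close>,
  hence is a difference of two functions covered by the monotone case. The domination by
  \<open>\<nu>\<close> carries the absolute continuity over to \<open>u\<close>.\<close>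

theorem abs_continuous_is_integral:
  fixes u :: "real \<Rightarrow> 'e::euclidean_space"
  assumes ab: "a \<le> b" and \<nu>: "abs_continuous_on {a..b} \<nu>"
    and dom: "\<And>s t. a \<le> s \<Longrightarrow> s \<le> t \<Longrightarrow> t \<le> b \<Longrightarrow> norm (u t - u s) \<le> \<nu> t - \<nu> s"
  obtains h where "h absolutely_integrable_on {a..b}"
    "\<And>t. t \<in> {a..b} \<Longrightarrow> (h has_integral u t - u a) {a..t}"
    "negligible {x \<in> {a..b}. \<not> (u has_vector_derivative h x) (at x within {a..b})}"
proof -
  have \<nu>_mono: "\<nu> s \<le> \<nu> t" if "a \<le> s" "s \<le> t" "t \<le> b" for s t
    using dom[OF that] norm_ge_zero[of "u t - u s"] by linarith
  obtain g where g: "g absolutely_integrable_on {a..b}" "\<And>t. t \<in> {a..b} \<Longrightarrow> (g has_integral \<nu> t - \<nu> a) {a..t}"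
    using increasing_abs_continuous_is_integral[OF ab \<nu> \<nu>_mono] by blast
  have "\<exists>gi. gi absolutely_integrable_on {a..b} \<and> (\<forall>t\<in>{a..b}. (gi has_integral (\<nu> t + u t \<bullet> i) - (\<nu> a + u a \<bullet> i)) {a..t})"
    if i: "i \<in> Basis" for i
  proof -
    have c: "\<bar>u t \<bullet> i - u s \<bullet> i\<bar> \<le> \<nu> t - \<nu> s" if "a \<le> s" "s \<le> t" "t \<le> b" for s t
      using dom[OF that] Basis_le_norm[OF i, of "u t - u s"] by (simp add: inner_diff_left)
    have ac: "abs_continuous_on {a..b} (\<lambda>t. \<nu> t + u t \<bullet> i)"
    proof (rule abs_continuous_on_dominated[OF \<nu>, of 2])
      fix s t assume "s \<in> {a..b}" "t \<in> {a..b}" "s \<le> t"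
      then show "norm (\<nu> t + u t \<bullet> i - (\<nu> s + u s \<bullet> i)) \<le> 2 * norm (\<nu> t - \<nu> s)"
        using c[of s t] by auto
    qed simp
    have mono: "\<nu> s + u s \<bullet> i \<le> \<nu> t + u t \<bullet> i" if "a \<le> s" "s \<le> t" "t \<le> b" for s t
      using c[OF that] by (simp add: abs_le_iff)
    show ?thesis
      using increasing_abs_continuous_is_integral[OF ab ac mono] by metis
  qed
  then obtain gi where gi: "\<And>i. i \<in> Basis \<Longrightarrow> gi i absolutely_integrable_on {a..b}"
    "\<And>i t. i \<in> Basis \<Longrightarrow> t \<in> {a..b} \<Longrightarrow> (gi i has_integral (\<nu> t + u t \<bullet> i) - (\<nu> a + u a \<bullet> i)) {a..t}"
    by metis
  define h where "h = (\<lambda>x. \<Sum>i\<in>Basis. (gi i x - g x) *\<^sub>R i)"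
  have h1: "h absolutely_integrable_on {a..b}"
    unfolding h_def using gi(1) g(1)
    by (intro absolutely_integrable_sum absolutely_integrable_scaleR_right set_integral_diff(1) absolutely_integrable_scaleR_left) auto
  have h2: "(h has_integral u t - u a) {a..t}" if t: "t \<in> {a..b}" for t
  proof -
    have "(h has_integral (\<Sum>i\<in>Basis. (((\<nu> t + u t \<bullet> i) - (\<nu> a + u a \<bullet> i)) - (\<nu> t - \<nu> a)) *\<^sub>R i)) {a..t}"
      unfolding h_def using gi(2) g(2) t
      by (intro has_integral_sum has_integral_scaleR_left has_integral_diff) auto
    also have "(\<Sum>i\<in>Basis. (((\<nu> t + u t \<bullet> i) - (\<nu> a + u a \<bullet> i)) - (\<nu> t - \<nu> a)) *\<^sub>R i) = (\<Sum>i\<in>Basis. ((u t - u a) \<bullet> i) *\<^sub>R i)"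
      by (intro sum.cong) (auto simp: inner_diff_left)
    also have "\<dots> = u t - u a" by (rule euclidean_representation)
    finally show ?thesis .
  qed
  have hi: "h integrable_on {a..b}" using h1 set_lebesgue_integral_eq_integral(1) by blast
  have h3: "(u has_vector_derivative h x) (at x within {a..b})"
    if x: "x \<in> {a..b}" and d: "((\<lambda>t. integral {a..t} h) has_vector_derivative h x) (at x within {a..b})" for x
  proof (rule has_vector_derivative_transform[OF x])
    show "((\<lambda>t. u a + integral {a..t} h) has_vector_derivative h x) (at x within {a..b})"
      using has_vector_derivative_add[OF has_vector_derivative_const d, of "u a"] by simp
    show "u t = u a + integral {a..t} h" if "t \<in> {a..b}" for t
      using h2[OF that] by (simp add: integral_unique)
  qed
  have "negligible {x \<in> {a..b}. \<not> (u has_vector_derivative h x) (at x within {a..b})}"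
    by (rule negligible_subset[OF indefinite_integral_has_vector_derivative_ae[OF hi]]) (use h3 in blast)
  with h1 h2 that show ?thesis by blast
qed

lemma lipschitz_has_vector_derivative_ae:
  fixes u :: "real \<Rightarrow> 'e::euclidean_space"
  assumes ab: "a \<le> b"
    and dom: "\<And>s t. a \<le> s \<Longrightarrow> s \<le> t \<Longrightarrow> t \<le> b \<Longrightarrow> norm (u t - u s) \<le> C * (t - s)"
  shows "\<exists>h. h absolutely_integrable_on {a..b} \<and>
    negligible {x \<in> {a..b}. \<not> (u has_vector_derivative h x) (at x within {a..b})}"
proof (rule abs_continuous_is_integral[OF ab])
  show "abs_continuous_on {a..b} (\<lambda>t. C * t)"
    by (rule abs_continuous_on_lipschitz[of _ _ "\<bar>C\<bar>"]) (auto simp: right_diff_distrib[symmetric] abs_mult)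
  show "norm (u t - u s) \<le> C * t - C * s" if "a \<le> s" "s \<le> t" "t \<le> b" for s t
    using dom[OF that] by (simp add: right_diff_distrib)
  fix h assume "h absolutely_integrable_on {a..b}"
    "negligible {x \<in> {a..b}. \<not> (u has_vector_derivative h x) (at x within {a..b})}"
  then show ?thesis by blast
qed

text \<open>The derivative-free estimate, with \<open>\<Phi>\<close> as drift integral. Both bounds
  come from \<open>increment_le_dominated\<close>: the first for \<open>X - \<Phi>\<close>, whose
  derivative is \<open>\<Gamma> (X t) u'\<close>; the second after freezing the coefficient at the
  left end, where the first bound controls how far the coefficient moves. \<open>\<Gamma>\<close> is
  kept general because it stands both for the original fields and for fields composed with a
  projection onto a ball.\<close>

lemma
  fixes X :: "real \<Rightarrow> 'e::euclidean_space" and u :: "real \<Rightarrow> 'f::euclidean_space"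
  assumes X: "abs_continuous_on {p..q} X" and \<Phi>: "abs_continuous_on {p..q} \<Phi>" and u: "abs_continuous_on {p..q} u"
    and N: "negligible N" and lin: "\<And>x. bounded_linear (\<Gamma> x)"
    and der: "\<And>t. t \<in> {p..q} - N \<Longrightarrow> \<exists>\<phi>' u'. (\<Phi> has_vector_derivative \<phi>') (at t within {p..q}) \<and>
        (u has_vector_derivative u') (at t within {p..q}) \<and>
        (X has_vector_derivative \<phi>' + \<Gamma> (X t) u') (at t within {p..q})"
    and dom: "\<And>s t. p \<le> s \<Longrightarrow> s \<le> t \<Longrightarrow> t \<le> q \<Longrightarrow> norm (u t - u s) \<le> \<nu> t - \<nu> s"
    and dom\<Phi>: "\<And>s t. p \<le> s \<Longrightarrow> s \<le> t \<Longrightarrow> t \<le> q \<Longrightarrow> norm (\<Phi> t - \<Phi> s) \<le> M * (t - s)"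
    and B: "0 \<le> B" "\<And>t w. t \<in> {p..q} \<Longrightarrow> norm (\<Gamma> (X t) w) \<le> B * norm w"
    and L: "0 \<le> L" "\<And>s t w. s \<in> {p..q} \<Longrightarrow> t \<in> {p..q} \<Longrightarrow> norm (\<Gamma> (X t) w - \<Gamma> (X s) w) \<le> L * norm (X t - X s) * norm w"
    and st: "p \<le> s" "s \<le> t" "t \<le> q"
  shows sewing_estimate_lipschitz: "norm (X t - X s) \<le> M * (t - s) + B * (\<nu> t - \<nu> s)"
    and sewing_estimate_quadratic: "norm (X t - X s - (\<Phi> t - \<Phi> s) - \<Gamma> (X s) (u t - u s)) \<le> L * (M * (t - s) + B * (\<nu> t - \<nu> s)) * (\<nu> t - \<nu> s)"
proof -
  have M0: "0 \<le> M * (t - s)" if "p \<le> s" "s \<le> t" "t \<le> q" for s t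
    using dom\<Phi>[OF that] norm_ge_zero[of "\<Phi> t - \<Phi> s"] by linarith
  have \<nu>0: "\<nu> s \<le> \<nu> t" if "p \<le> s" "s \<le> t" "t \<le> q" for s t
    using dom[OF that] norm_ge_zero[of "u t - u s"] by linarith
  have der': "\<exists>\<phi>' u'. (\<Phi> has_vector_derivative \<phi>') (at r within {s..t}) \<and>
        (u has_vector_derivative u') (at r within {s..t}) \<and>
        (X has_vector_derivative \<phi>' + \<Gamma> (X r) u') (at r within {s..t})"
    if "r \<in> {s..t} - N" "p \<le> s" "t \<le> q" for r s t
  proof -
    have "r \<in> {p..q} - N" "{s..t} \<subseteq> {p..q}" using that by auto
    then show ?thesis using der by (meson has_vector_derivative_within_subset)
  qed
  have 1: "norm (X t - X s) \<le> M * (t - s) + B * (\<nu> t - \<nu> s)" if st: "p \<le> s" "s \<le> t" "t \<le> q" for s t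
  proof -
    have sub: "{s..t} \<subseteq> {p..q}" using st by auto
    have "norm ((X t - \<Phi> t) - (X s - \<Phi> s)) \<le> B * (\<nu> t - \<nu> s)"
    proof (rule increment_le_dominated[OF st(2) _ N B(1)])
      show "abs_continuous_on {s..t} (\<lambda>t. X t - \<Phi> t)"
        by (rule abs_continuous_on_subset[OF abs_continuous_on_diff[OF X \<Phi>] sub])
      show "norm (u r' - u r) \<le> \<nu> r' - \<nu> r" if "s \<le> r" "r \<le> r'" "r' \<le> t" for r r'
        using dom that st by auto
      fix r assume r: "r \<in> {s..t} - N"
      obtain \<phi>' u' where d: "(\<Phi> has_vector_derivative \<phi>') (at r within {s..t})"
        "(u has_vector_derivative u') (at r within {s..t})"
        "(X has_vector_derivative \<phi>' + \<Gamma> (X r) u') (at r within {s..t})"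
        using der'[OF r st(1,3)] by blast
      have "((\<lambda>t. X t - \<Phi> t) has_vector_derivative \<Gamma> (X r) u') (at r within {s..t})"
        using has_vector_derivative_diff[OF d(3,1)] by simp
      moreover have "norm (\<Gamma> (X r) u') \<le> B * norm u'" using r sub by (intro B(2)) auto
      ultimately show "\<exists>z' w'. ((\<lambda>t. X t - \<Phi> t) has_vector_derivative z') (at r within {s..t}) \<and>
          (u has_vector_derivative w') (at r within {s..t}) \<and> norm z' \<le> B * norm w'"
        using d(2) by blast
    qed
    moreover have "norm (X t - X s) \<le> norm ((X t - \<Phi> t) - (X s - \<Phi> s)) + norm (\<Phi> t - \<Phi> s)"
      using norm_triangle_ineq[of "(X t - \<Phi> t) - (X s - \<Phi> s)" "\<Phi> t - \<Phi> s"] by (simp add: algebra_simps)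
    ultimately show ?thesis using dom\<Phi>[OF st] by linarith
  qed
  show "norm (X t - X s) \<le> M * (t - s) + B * (\<nu> t - \<nu> s)" by (rule 1[OF st])
  interpret G: bounded_linear "\<Gamma> (X s)" by (rule lin)
  let ?A = "L * (M * (t - s) + B * (\<nu> t - \<nu> s))"
  have A0: "0 \<le> ?A" using L(1) M0[OF st] B(1) \<nu>0[OF st] by simp
  have sub: "{s..t} \<subseteq> {p..q}" using st by auto
  let ?Z = "\<lambda>r. X r - \<Phi> r - \<Gamma> (X s) (u r)"
  have "norm (?Z t - ?Z s) \<le> ?A * (\<nu> t - \<nu> s)"
  proof (rule increment_le_dominated[OF st(2) _ N A0])
    obtain K where K: "0 \<le> K" "\<And>w. norm (\<Gamma> (X s) w) \<le> norm w * K" using G.nonneg_bounded by blast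
    have "abs_continuous_on {p..q} (\<lambda>r. \<Gamma> (X s) (u r))"
      by (rule abs_continuous_on_dominated[OF u K(1)]) (use K(2) in \<open>simp add: G.diff[symmetric] mult.commute\<close>)
    then show "abs_continuous_on {s..t} ?Z"
      using abs_continuous_on_subset[OF _ sub] abs_continuous_on_diff X \<Phi> by blast
    show "norm (u r' - u r) \<le> \<nu> r' - \<nu> r" if "s \<le> r" "r \<le> r'" "r' \<le> t" for r r'
      using dom that st by auto
    fix r assume r: "r \<in> {s..t} - N"
    obtain \<phi>' u' where d: "(\<Phi> has_vector_derivative \<phi>') (at r within {s..t})"
      "(u has_vector_derivative u') (at r within {s..t})"
      "(X has_vector_derivative \<phi>' + \<Gamma> (X r) u') (at r within {s..t})"
      using der'[OF r st(1,3)] by blast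
    have d2: "((\<lambda>r. \<Gamma> (X s) (u r)) has_vector_derivative \<Gamma> (X s) u') (at r within {s..t})"
      by (rule G.has_vector_derivative[OF d(2)])
    have "(?Z has_vector_derivative \<phi>' + \<Gamma> (X r) u' - \<phi>' - \<Gamma> (X s) u') (at r within {s..t})"
      by (rule has_vector_derivative_diff[OF has_vector_derivative_diff[OF d(3,1)] d2])
    then have "(?Z has_vector_derivative \<Gamma> (X r) u' - \<Gamma> (X s) u') (at r within {s..t})" by simp
    moreover have "norm (\<Gamma> (X r) u' - \<Gamma> (X s) u') \<le> ?A * norm u'"
    proof -
      have rr: "p \<le> s" "s \<le> r" "r \<le> q" "r \<le> t" using r st by auto
      have "norm (\<Gamma> (X r) u' - \<Gamma> (X s) u') \<le> L * norm (X r - X s) * norm u'"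
        using rr by (intro L(2)) auto
      moreover have "norm (X r - X s) \<le> M * (t - s) + B * (\<nu> t - \<nu> s)"
      proof -
        have "norm (X r - X s) \<le> M * (r - s) + B * (\<nu> r - \<nu> s)" by (rule 1[OF rr(1-3)])
        moreover have "M * (r - s) \<le> M * (t - s)" using M0[of r t] rr st by (simp add: algebra_simps)
        moreover have "B * (\<nu> r - \<nu> s) \<le> B * (\<nu> t - \<nu> s)" using \<nu>0[of r t] rr st B(1) by (intro mult_left_mono) auto
        ultimately show ?thesis by linarith
      qed
      ultimately show ?thesis
        using L(1) by (meson mult_left_mono mult_right_mono norm_ge_zero order_trans)
    qed
    ultimately show "\<exists>z' w'. (?Z has_vector_derivative z') (at r within {s..t}) \<and>
          (u has_vector_derivative w') (at r within {s..t}) \<and> norm z' \<le> ?A * norm w'"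
      using d(2) by blast
  qed
  moreover have "?Z t - ?Z s = X t - X s - (\<Phi> t - \<Phi> s) - \<Gamma> (X s) (u t - u s)"
    by (simp add: G.diff)
  ultimately show "norm (X t - X s - (\<Phi> t - \<Phi> s) - \<Gamma> (X s) (u t - u s)) \<le> ?A * (\<nu> t - \<nu> s)" by simp
qed

section \<open>Ordinary differential equations with measurable right-hand sides\<close>

lemma AE_lebesgue_on_iff_negligible:
  "(AE x in lebesgue_on S. P x) \<longleftrightarrow> negligible {x \<in> S. \<not> P x}" if "S \<in> sets lebesgue"
proof -
  have "(AE x in lebesgue_on S. P x) \<longleftrightarrow> (AE x in lebesgue. x \<in> S \<longrightarrow> P x)"
    using that by (simp add: AE_restrict_space_iff)
  also have "\<dots> \<longleftrightarrow> negligible {x \<in> S. \<not> P x}"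
  proof
    assume "AE x in lebesgue. x \<in> S \<longrightarrow> P x"
    then obtain N where N: "N \<in> null_sets lebesgue" "{x \<in> space lebesgue. \<not> (x \<in> S \<longrightarrow> P x)} \<subseteq> N"
      unfolding eventually_ae_filter by blast
    have "negligible N" using N(1) by (simp add: negligible_iff_null_sets)
    moreover have "{x \<in> S. \<not> P x} \<subseteq> N" using N(2) by (simp add: subset_iff)
    ultimately show "negligible {x \<in> S. \<not> P x}" by (rule negligible_subset)
  next
    assume "negligible {x \<in> S. \<not> P x}"
    then show "AE x in lebesgue. x \<in> S \<longrightarrow> P x"
      by (intro AE_I'[of "{x \<in> S. \<not> P x}"]) (auto simp: negligible_iff_null_sets)
  qed
  finally show ?thesis .
qed

text \<open>\<open>h\<close> is replaced by maps with values in a countable dense subset of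
  \<open>S\<close>, for which measurability in \<open>t\<close> at fixed \<open>z\<close> suffices;
  continuity in \<open>z\<close> gives the limit. The dense set has to lie in \<open>S\<close>, as
  nothing is known of \<open>F\<close> outside.\<close>

lemma caratheodory_composition_measurable:
  fixes F :: "'t \<Rightarrow> 'z::{metric_space,second_countable_topology} \<Rightarrow> 'e::euclidean_space"
  assumes meas: "\<And>z. z \<in> S \<Longrightarrow> (\<lambda>t. F t z) \<in> borel_measurable M"
    and cont: "\<And>t. t \<in> space M \<Longrightarrow> continuous_on S (F t)"
    and h: "h \<in> borel_measurable M" "\<And>t. t \<in> space M \<Longrightarrow> h t \<in> S"
  shows "(\<lambda>t. F t (h t)) \<in> borel_measurable M"
proof (cases "space M = {}")
  case True
  then show ?thesis by (simp add: measurable_def)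
next
  case False
  then have "S \<noteq> {}" using h(2) by blast
  obtain T where T: "countable T" "T \<subseteq> S" "S \<subseteq> closure T" using separable by blast
  then have "T \<noteq> {}" using \<open>S \<noteq> {}\<close> by auto
  define d where "d = from_nat_into T"
  have dT: "d i \<in> T" for i unfolding d_def by (rule from_nat_into[OF \<open>T \<noteq> {}\<close>])
  have surj: "\<exists>i. d i = z" if "z \<in> T" for z
    using from_nat_into_surj[OF T(1) that] by (auto simp: d_def)
  \<comment> \<open>Taking the least admissible index makes the choice measurable.\<close>
  define idx where "idx = (\<lambda>k t. LEAST i. dist (h t) (d i) < inverse (Suc k))"
  have ex: "\<exists>i. dist (h t) (d i) < inverse (Suc k)" if "t \<in> space M" for t k
  proof -
    have "h t \<in> closure T" using h(2)[OF that] T(3) by blast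
    then obtain z where "z \<in> T" "dist z (h t) < inverse (Suc k)"
      unfolding closure_approachable by (metis inverse_positive_iff_positive of_nat_0_less_iff zero_less_Suc)
    then show ?thesis using surj by (metis dist_commute)
  qed
  have close: "dist (h t) (d (idx k t)) < inverse (Suc k)" if "t \<in> space M" for t k
    unfolding idx_def by (rule LeastI_ex[OF ex[OF that]])
  have idx_meas: "idx k \<in> measurable M (count_space UNIV)" for k
    unfolding idx_def using h(1) by measurable
  show ?thesis
  proof (rule borel_measurable_LIMSEQ_metric)
    fix k
    show "(\<lambda>t. F t (d (idx k t))) \<in> borel_measurable M"
      by (rule measurable_compose_countable[OF _ idx_meas]) (use meas dT T(2) in blast)
  next
    fix t assume t: "t \<in> space M"
    have "(\<lambda>k. dist (d (idx k t)) (h t)) \<longlonglongrightarrow> 0"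
    proof (rule tendsto_sandwich[OF _ _ tendsto_const LIMSEQ_inverse_real_of_nat])
      show "\<forall>\<^sub>F k in sequentially. dist (d (idx k t)) (h t) \<le> inverse (real (Suc k))"
        using close[OF t] by (intro always_eventually allI) (metis dist_commute less_imp_le)
    qed simp
    then have "(\<lambda>k. d (idx k t)) \<longlonglongrightarrow> h t" by (rule tendsto_dist_iff[THEN iffD2])
    then show "(\<lambda>k. F t (d (idx k t))) \<longlonglongrightarrow> F t (h t)"
      by (rule continuous_on_tendsto_compose[OF cont[OF t]]) (use h(2)[OF t] dT T(2) in \<open>auto intro!: always_eventually\<close>)
  qed
qed

lemma bounded_measurable_absolutely_integrable:
  fixes F :: "real \<Rightarrow> 'e::euclidean_space"
  assumes "F \<in> borel_measurable (lebesgue_on {a..b})" "\<And>t. t \<in> {a..b} \<Longrightarrow> norm (F t) \<le> B"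
  shows "F absolutely_integrable_on {a..b}"
  by (rule measurable_bounded_by_integrable_imp_absolutely_integrable[where g="\<lambda>_. B"]) (use assms in auto)

lemma integral_increment:
  fixes F :: "real \<Rightarrow> 'e::euclidean_space"
  assumes "F absolutely_integrable_on {a..b}" "a \<le> s" "s \<le> t" "t \<le> b"
  shows "integral {a..t} F - integral {a..s} F = integral {s..t} F"
proof -
  have "F integrable_on {a..b}" using assms(1) set_lebesgue_integral_eq_integral(1) by blast
  then have "F integrable_on {a..t}" using assms by (auto intro: integrable_on_subinterval)
  from Henstock_Kurzweil_Integration.integral_combine[OF assms(2,3) this] show ?thesis by (simp add: algebra_simps)
qed

lemma integral_lipschitz:
  fixes F :: "real \<Rightarrow> 'e::euclidean_space"
  assumes "F absolutely_integrable_on {a..b}" "\<And>t. t \<in> {a..b} \<Longrightarrow> norm (F t) \<le> B" "a \<le> s" "s \<le> t" "t \<le> b"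
  shows "norm (integral {a..t} F - integral {a..s} F) \<le> B * (t - s)"
proof -
  have "F integrable_on {a..b}" using assms(1) set_lebesgue_integral_eq_integral(1) by blast
  then have "F integrable_on {s..t}" using assms by (auto intro: integrable_on_subinterval)
  then have "(F has_integral integral {s..t} F) {s..t}" by (rule integrable_integral)
  moreover have "0 \<le> B" using assms(2)[of s] assms(3-5) norm_ge_zero[of "F s"] by (meson atLeastAtMost_iff order_trans)
  ultimately have "norm (integral {s..t} F) \<le> B * measure lborel {s..t}"
    using assms by (intro has_integral_bound_real[where f=F]) auto
  then show ?thesis using integral_increment[OF assms(1,3-5)] assms by simp
qed

text \<open>Picard iteration on the whole interval at once, by passing to the weighted unknown
  \<open>exp (- (\<Lambda> * (t - a))) *\<^sub>R X t\<close>: integrating the weight gains a factor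
  \<open>1 / \<Lambda>\<close>.\<close>

lemma integral_equation_solution_exists:
  fixes G :: "real \<Rightarrow> 'e::euclidean_space \<Rightarrow> 'e"
  assumes ab: "a \<le> b"
    and meas: "\<And>z. (\<lambda>t. G t z) \<in> borel_measurable (lebesgue_on {a..b})"
    and bound: "\<And>t z. t \<in> {a..b} \<Longrightarrow> norm (G t z) \<le> B"
    and lip: "\<And>t z z'. t \<in> {a..b} \<Longrightarrow> norm (G t z - G t z') \<le> L * norm (z - z')"
  obtains X where "continuous_on {a..b} X"
    "(\<lambda>r. G r (X r)) absolutely_integrable_on {a..b}"
    "\<And>t. t \<in> {a..b} \<Longrightarrow> X t = x0 + integral {a..t} (\<lambda>r. G r (X r))"
proof -
  \<comment> \<open>Chosen so that the contraction factor \<open>\<bar>L\<bar> / \<Lambda>\<close>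
    is at most 1/2; the \<open>+ 1\<close> keeps it positive when \<open>L = 0\<close>.\<close>
  define \<Lambda> where "\<Lambda> = 2 * \<bar>L\<bar> + 1"
  have \<Lambda>: "0 < \<Lambda>" "\<bar>L\<bar> / \<Lambda> \<le> 1 / 2" by (auto simp: \<Lambda>_def field_simps)
  have lip': "norm (G t z - G t z') \<le> \<bar>L\<bar> * norm (z - z')" if "t \<in> {a..b}" for t z z'
    using lip[OF that, of z z'] by (meson abs_ge_self mult_right_mono norm_ge_zero order_trans)
  have Gcont: "continuous_on UNIV (G t)" if "t \<in> {a..b}" for t
    by (rule lipschitz_on_continuous_on[of "\<bar>L\<bar>"]) (use lip'[OF that] in \<open>auto intro!: lipschitz_onI simp: dist_norm\<close>)
  have Gint: "(\<lambda>r. G r (X r)) absolutely_integrable_on {a..b}" if X: "continuous_on {a..b} X" for X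
  proof (rule bounded_measurable_absolutely_integrable)
    show "(\<lambda>r. G r (X r)) \<in> borel_measurable (lebesgue_on {a..b})"
      by (rule caratheodory_composition_measurable[where S=UNIV])
         (use meas Gcont continuous_imp_measurable_on_sets_lebesgue[OF X] in auto)
  qed (use bound in auto)
  \<comment> \<open>Clamping extends functions on \<open>{a..b}\<close> to bounded continuous
    functions on the line, a complete metric space in the form of a type.\<close>
  define c where "c = (\<lambda>t. max a (min b t))"
  have c: "c t \<in> {a..b}" for t using ab by (auto simp: c_def)
  have ccont: "continuous_on UNIV c" unfolding c_def by (intro continuous_intros)
  define I where "I = (\<lambda>z::real \<Rightarrow>\<^sub>C 'e. \<lambda>r. G r (exp (\<Lambda> * (r - a)) *\<^sub>R z r))"
  have Iint: "I z absolutely_integrable_on {a..b}" for z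
    unfolding I_def by (intro Gint continuous_intros continuous_on_apply_bcontfun)
  define T0 where "T0 = (\<lambda>z t. exp (- (\<Lambda> * (t - a))) *\<^sub>R (x0 + integral {a..t} (I z)))"
  have T0cont: "continuous_on {a..b} (T0 z)" for z
  proof -
    have "I z integrable_on {a..b}" using Iint[of z] set_lebesgue_integral_eq_integral(1) by blast
    then show ?thesis unfolding T0_def by (intro continuous_intros indefinite_integral_continuous_1)
  qed
  have Tb: "(\<lambda>t. T0 z (c t)) \<in> bcontfun" for z
  proof -
    obtain K where K: "\<forall>x\<in>T0 z ` {a..b}. norm x \<le> K"
      using compact_imp_bounded[OF compact_continuous_image[OF T0cont compact_Icc]] unfolding bounded_iff by blast
    show ?thesis
    proof (rule bcontfun_normI)
      show "continuous_on UNIV (\<lambda>t. T0 z (c t))"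
        by (rule continuous_on_compose2[OF T0cont ccont]) (use c in auto)
      show "norm (T0 z (c t)) \<le> K" for t using K c by blast
    qed
  qed
  define T where "T = (\<lambda>z. Bcontfun (\<lambda>t. T0 z (c t)))"
  have T_apply: "T z t = T0 z (c t)" for z t
    unfolding T_def using Tb by (simp add: Bcontfun_inverse)
  have contr: "dist (T z) (T w) \<le> (1 / 2) * dist z w" for z w
  proof (rule dist_bound)
    fix t
    let ?t = "c t"
    have t: "a \<le> ?t" "?t \<le> b" using c[of t] by auto
    have int: "I z integrable_on {a..?t}" "I w integrable_on {a..?t}"
      using Iint[of z] Iint[of w] set_lebesgue_integral_eq_integral(1) t
      by (meson atLeastatMost_subset_iff integrable_on_subinterval order_refl)+
    let ?K = "\<bar>L\<bar> * dist z w"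
    have FT: "((\<lambda>r. ?K * exp (\<Lambda> * (r - a))) has_integral (?K / \<Lambda> * exp (\<Lambda> * (?t - a)) - ?K / \<Lambda> * exp (\<Lambda> * (a - a)))) {a..?t}"
    proof (rule fundamental_theorem_of_calculus[OF t(1)])
      fix x
      show "((\<lambda>r. ?K / \<Lambda> * exp (\<Lambda> * (r - a))) has_vector_derivative ?K * exp (\<Lambda> * (x - a))) (at x within {a..?t})"
        using \<Lambda>(1) by (auto intro!: derivative_eq_intros simp: has_real_derivative_iff_has_vector_derivative[symmetric])
    qed
    have "norm (integral {a..?t} (\<lambda>r. I z r - I w r)) \<le> integral {a..?t} (\<lambda>r. ?K * exp (\<Lambda> * (r - a)))"
    proof (rule integral_norm_bound_integral)
      show "(\<lambda>r. I z r - I w r) integrable_on {a..?t}" using int by (rule integrable_diff)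
      show "(\<lambda>r. ?K * exp (\<Lambda> * (r - a))) integrable_on {a..?t}" using FT by blast
      fix r assume r: "r \<in> {a..?t}"
      have "norm (I z r - I w r) \<le> \<bar>L\<bar> * norm (exp (\<Lambda> * (r - a)) *\<^sub>R z r - exp (\<Lambda> * (r - a)) *\<^sub>R w r)"
        unfolding I_def using r t by (intro lip') auto
      also have "\<dots> = \<bar>L\<bar> * (exp (\<Lambda> * (r - a)) * dist (z r) (w r))"
        by (simp add: scaleR_diff_right[symmetric] dist_norm)
      also have "\<dots> \<le> \<bar>L\<bar> * (exp (\<Lambda> * (r - a)) * dist z w)"
        by (intro mult_left_mono dist_bounded) auto
      finally show "norm (I z r - I w r) \<le> ?K * exp (\<Lambda> * (r - a))" by (simp add: mult_ac)
    qed
    also have "\<dots> \<le> ?K / \<Lambda> * exp (\<Lambda> * (?t - a))"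
      unfolding integral_unique[OF FT] using \<Lambda>(1) by simp
    finally have le: "norm (integral {a..?t} (I z) - integral {a..?t} (I w)) \<le> ?K / \<Lambda> * exp (\<Lambda> * (?t - a))"
      by (simp add: integral_diff[OF int])
    have "dist (T z t) (T w t) = exp (- (\<Lambda> * (?t - a))) * norm (integral {a..?t} (I z) - integral {a..?t} (I w))"
      unfolding T_apply T0_def by (simp add: dist_norm scaleR_diff_right[symmetric])
    also have "\<dots> \<le> exp (- (\<Lambda> * (?t - a))) * (?K / \<Lambda> * exp (\<Lambda> * (?t - a)))"
      by (intro mult_left_mono le) simp
    also have "\<dots> = ?K / \<Lambda> * (exp (- (\<Lambda> * (?t - a))) * exp (\<Lambda> * (?t - a)))" by (simp only: mult_ac)
    also have "\<dots> = \<bar>L\<bar> / \<Lambda> * dist z w" by (simp add: exp_minus)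
    also have "\<dots> \<le> (1 / 2) * dist z w" by (intro mult_right_mono \<Lambda>(2)) simp
    finally show "dist (T z t) (T w t) \<le> (1 / 2) * dist z w" .
  qed
  then obtain z where z: "T z = z"
    using banach_fix_type[of "1/2" T] by auto
  define X where "X = (\<lambda>t. exp (\<Lambda> * (t - a)) *\<^sub>R z t)"
  have IX: "I z = (\<lambda>r. G r (X r))" by (simp add: I_def X_def)
  show ?thesis
  proof (rule that)
    show "continuous_on {a..b} X" unfolding X_def by (intro continuous_intros continuous_on_apply_bcontfun)
    show "(\<lambda>r. G r (X r)) absolutely_integrable_on {a..b}" using Iint[of z] IX by simp
    fix t assume "t \<in> {a..b}"
    then have "c t = t" by (auto simp: c_def)
    then have "z t = T0 z t" using T_apply[of z t] z by simp
    then have "X t = exp (\<Lambda> * (t - a)) *\<^sub>R T0 z t" by (simp add: X_def)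
    then show "X t = x0 + integral {a..t} (\<lambda>r. G r (X r))"
      unfolding T0_def IX by (simp add: exp_minus)
  qed
qed

text \<open>A Lebesgue number \<open>e\<close> of a finite cover by the local balls handles close
  points; for points at distance at least \<open>e\<close> the bound on \<open>F\<close> gives the
  slope \<open>2 * \<bar>B\<bar> / e\<close>. As \<open>K\<close> need not be convex, the local
  constants cannot be chained along segments.\<close>

lemma locally_lipschitz_bounded_imp_lipschitz_on_compact:
  fixes F :: "'i \<Rightarrow> 'z::euclidean_space \<Rightarrow> 'e::euclidean_space"
  assumes loc: "\<And>z. \<exists>r>0. \<exists>L. \<forall>i\<in>J. L-lipschitz_on (cball z r) (F i)"
    and K: "compact K" and bd: "\<And>i z. i \<in> J \<Longrightarrow> z \<in> K \<Longrightarrow> norm (F i z) \<le> B"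
  shows "\<exists>L\<ge>0. \<forall>i\<in>J. \<forall>z\<in>K. \<forall>z'\<in>K. norm (F i z - F i z') \<le> L * norm (z - z')"
proof -
  obtain r L where r: "\<And>z. 0 < r z" and L: "\<And>z i. i \<in> J \<Longrightarrow> (L z)-lipschitz_on (cball z (r z)) (F i)"
    using loc by metis
  have "K \<subseteq> (\<Union>z\<in>K. ball z (r z))" using r by auto
  then obtain Z where Z: "Z \<subseteq> K" "finite Z" "K \<subseteq> (\<Union>z\<in>Z. ball z (r z))"
    using compactE_image[OF K, of K "\<lambda>z. ball z (r z)"] by blast
  obtain e where e: "0 < e" "\<And>x. x \<in> K \<Longrightarrow> \<exists>G\<in>(\<lambda>z. ball z (r z)) ` Z. ball x e \<subseteq> G"
    using Heine_Borel_lemma[OF K Z(3)] by (metis (no_types, lifting) imageE open_ball)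
  define M where "M = (\<Sum>z\<in>Z. \<bar>L z\<bar>) + 2 * \<bar>B\<bar> / e"
  have M: "0 \<le> M" "2 * \<bar>B\<bar> / e \<le> M" "\<And>z. z \<in> Z \<Longrightarrow> L z \<le> M"
  proof -
    show "0 \<le> M" "2 * \<bar>B\<bar> / e \<le> M" using e by (auto simp: M_def intro!: add_nonneg_nonneg sum_nonneg)
    fix z assume "z \<in> Z"
    then have "\<bar>L z\<bar> \<le> (\<Sum>z\<in>Z. \<bar>L z\<bar>)" using Z(2) by (intro member_le_sum) auto
    moreover have "0 \<le> 2 * \<bar>B\<bar> / e" using e by simp
    ultimately show "L z \<le> M" unfolding M_def by linarith
  qed
  have "norm (F i z - F i z') \<le> M * norm (z - z')" if i: "i \<in> J" and zz: "z \<in> K" "z' \<in> K" for i z z'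
  proof (cases "dist z z' < e")
    case True
    obtain w where w: "w \<in> Z" "ball z e \<subseteq> ball w (r w)" using e(2)[OF zz(1)] by blast
    have "z \<in> ball z e" "z' \<in> ball z e" using True e(1) by simp_all
    then have "z \<in> cball w (r w)" "z' \<in> cball w (r w)" using w(2) ball_subset_cball by blast+
    then have "dist (F i z) (F i z') \<le> L w * dist z z'" using L[OF i] by (rule lipschitz_onD[rotated])
    also have "\<dots> \<le> M * dist z z'" using M(3)[OF w(1)] by (intro mult_right_mono) auto
    finally show ?thesis by (simp add: dist_norm)
  next
    case False
    have "norm (F i z - F i z') \<le> 2 * \<bar>B\<bar>"
      using bd[OF i zz(1)] bd[OF i zz(2)] norm_triangle_ineq4[of "F i z" "F i z'"] by linarith
    also have "\<dots> \<le> 2 * \<bar>B\<bar> / e * norm (z - z')"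
    proof -
      have "e * \<bar>B\<bar> \<le> norm (z - z') * \<bar>B\<bar>" using False by (intro mult_right_mono) (auto simp: dist_norm)
      then show ?thesis using e(1) by (simp add: field_simps)
    qed
    also have "\<dots> \<le> M * norm (z - z')" using M(2) by (intro mult_right_mono) auto
    finally show ?thesis .
  qed
  with M(1) show ?thesis by blast
qed

lemma C1_map_lipschitz_on_cball:
  fixes h :: "real^'n \<Rightarrow> real^'n"
  assumes "C1_map h"
  obtains C where "0 \<le> C" "\<And>x. x \<in> cball 0 R \<Longrightarrow> norm (h x) \<le> C"
    "\<And>x y. x \<in> cball 0 R \<Longrightarrow> y \<in> cball 0 R \<Longrightarrow> norm (h x - h y) \<le> C * norm (x - y)"
proof -
  obtain h' where h': "\<And>x. (h has_derivative blinfun_apply (h' x)) (at x)" "continuous_on UNIV h'"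
    using assms unfolding C1_map_def by blast
  have hc: "continuous_on (cball 0 R) h"
    by (rule has_derivative_continuous_on) (use h'(1) has_derivative_at_withinI in blast)
  obtain C1 where C1: "\<forall>x\<in>h ` cball 0 R. norm x \<le> C1"
    using compact_imp_bounded[OF compact_continuous_image[OF hc compact_cball]] unfolding bounded_iff by blast
  obtain C2 where C2: "\<forall>x\<in>h' ` cball 0 R. norm x \<le> C2"
    using compact_imp_bounded[OF compact_continuous_image[OF continuous_on_subset[OF h'(2)] compact_cball]]
    unfolding bounded_iff by blast
  have "norm (h x - h y) \<le> max 0 (max C1 C2) * norm (x - y)" if "x \<in> cball 0 R" "y \<in> cball 0 R" for x y
  proof (rule differentiable_bound[OF convex_cball _ _ that])
    fix z :: "real^'n" assume z: "z \<in> cball 0 R"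
    show "(h has_derivative blinfun_apply (h' z)) (at z within cball 0 R)"
      using h'(1) has_derivative_at_withinI by blast
    show "onorm (blinfun_apply (h' z)) \<le> max 0 (max C1 C2)"
      using C2 z by (auto simp: norm_blinfun.rep_eq[symmetric] le_max_iff_disj)
  qed
  moreover have "norm (h x) \<le> max 0 (max C1 C2)" if "x \<in> cball 0 R" for x
    using C1 that by (auto simp: le_max_iff_disj)
  ultimately show ?thesis using that[of "max 0 (max C1 C2)"] by auto
qed

section \<open>The control system\<close>

definition control_term :: "('m::finite \<Rightarrow> real^'n \<Rightarrow> real^'n) \<Rightarrow> real^'n \<Rightarrow> real^'m \<Rightarrow> real^'n" where
  "control_term g x w = (\<Sum>\<alpha>\<in>UNIV. (w $ \<alpha>) *\<^sub>R g \<alpha> x)"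

lemma norm_control_term_diff_le:
  "norm (control_term g x w - control_term g y w) \<le> (\<Sum>\<alpha>\<in>UNIV. norm (g \<alpha> x - g \<alpha> y)) * norm w"
proof -
  have "control_term g x w - control_term g y w = (\<Sum>\<alpha>\<in>UNIV. (w $ \<alpha>) *\<^sub>R (g \<alpha> x - g \<alpha> y))"
    by (simp add: control_term_def sum_subtractf scaleR_diff_right)
  also have "norm \<dots> \<le> (\<Sum>\<alpha>\<in>UNIV. norm w * norm (g \<alpha> x - g \<alpha> y))"
    by (intro sum_norm_le) (auto intro!: mult_right_mono component_le_norm_cart)
  finally show ?thesis by (simp add: sum_distrib_left[symmetric] mult.commute)
qed

lemma norm_control_term_le:
  "norm (control_term g x w) \<le> (\<Sum>\<alpha>\<in>UNIV. norm (g \<alpha> x)) * norm w"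
proof -
  have "norm (control_term g x w) \<le> (\<Sum>\<alpha>\<in>UNIV. norm w * norm (g \<alpha> x))"
    unfolding control_term_def
    by (intro sum_norm_le) (auto intro!: mult_right_mono component_le_norm_cart)
  then show ?thesis by (simp add: sum_distrib_left[symmetric] mult.commute)
qed

lemma bounded_linear_control_term: "bounded_linear (control_term g x)"
proof (rule bounded_linear_intro)
  show "control_term g x (w + w') = control_term g x w + control_term g x w'" for w w'
    by (simp add: control_term_def sum.distrib scaleR_left_distrib)
  show "control_term g x (c *\<^sub>R w) = c *\<^sub>R control_term g x w" for c w
    by (simp add: control_term_def scaleR_sum_right)
  show "norm (control_term g x w) \<le> norm w * (\<Sum>\<alpha>\<in>UNIV. norm (g \<alpha> x))" for w
    using norm_control_term_le[of g x w] by (simp add: mult.commute)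
qed

text \<open>An increasing function with equal values at two points is constant between them, which
  excludes a nonzero derivative at either. This forces a clock to return the parameter
  \<open>s\<close> itself.\<close>

lemma increasing_derivative_nonzero_imp_unique:
  fixes \<phi>0 :: "real \<Rightarrow> real"
  assumes mono: "mono_on {c..d} \<phi>0" and der: "(\<phi>0 has_vector_derivative p) (at s within {c..d})" and p: "p \<noteq> 0"
    and s: "s \<in> {c..d}" "s' \<in> {c..d}" "\<phi>0 s' = \<phi>0 s"
  shows "s' = s"
proof (rule ccontr)
  assume ne: "s' \<noteq> s"
  have "0 < \<bar>p\<bar> / 2" using p by simp
  then obtain \<delta> where \<delta>: "\<delta> > 0" "\<And>y. y \<in> {c..d} \<Longrightarrow> \<bar>y - s\<bar> < \<delta> \<Longrightarrow> norm (\<phi>0 y - \<phi>0 s - (y - s) *\<^sub>R p) \<le> \<bar>p\<bar> / 2 * \<bar>y - s\<bar>"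
    using der unfolding has_vector_derivative_within_alt by blast
  obtain y where y: "y \<in> {min s s'..max s s'}" "y \<noteq> s" "\<bar>y - s\<bar> < \<delta>"
  proof (cases "s < s'")
    case True
    show ?thesis by (rule that[of "min s' (s + \<delta> / 2)"]) (use True \<delta>(1) in \<open>auto simp: min_def\<close>)
  next
    case False
    show ?thesis by (rule that[of "max s' (s - \<delta> / 2)"]) (use False ne \<delta>(1) in \<open>auto simp: max_def\<close>)
  qed
  have yin: "y \<in> {c..d}" using y(1) s by auto
  have "\<phi>0 y = \<phi>0 s"
  proof (cases "s < s'")
    case True
    then have "\<phi>0 s \<le> \<phi>0 y" "\<phi>0 y \<le> \<phi>0 s'"
      using y(1) mono_onD[OF mono s(1) yin] mono_onD[OF mono yin s(2)] by auto
    then show ?thesis using s(3) by simp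
  next
    case False
    then have "\<phi>0 s' \<le> \<phi>0 y" "\<phi>0 y \<le> \<phi>0 s"
      using y(1) mono_onD[OF mono s(2) yin] mono_onD[OF mono yin s(1)] by auto
    then show ?thesis using s(3) by simp
  qed
  then have "\<bar>y - s\<bar> * \<bar>p\<bar> \<le> \<bar>p\<bar> / 2 * \<bar>y - s\<bar>" using \<delta>(2)[OF yin y(3)] by (simp add: abs_mult)
  then show False using p y(2) by simp
qed

text \<open>A chain rule along a time change that may stop. Where the derivative of
  \<open>\<phi>0\<close> is nonzero, preimages of null sets are null, so exceptional times,
  including those that violate \<open>P\<close>, can be ignored. Where it is 0, the Lipschitz bound
  of the integral gives derivative 0 whatever \<open>F\<close> does.\<close>

lemma reparametrized_integral_derivative_ae:
  fixes F :: "real \<Rightarrow> 'e::euclidean_space" and \<phi>0 :: "real \<Rightarrow> real"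
  assumes lip: "\<And>s t. 0 \<le> s \<Longrightarrow> s \<le> t \<Longrightarrow> t \<le> 1 \<Longrightarrow> \<bar>\<phi>0 t - \<phi>0 s\<bar> \<le> C * (t - s)"
    and img: "\<phi>0 ` {0..1} = {a..b}"
    and F: "F absolutely_integrable_on {a..b}" "\<And>t. t \<in> {a..b} \<Longrightarrow> norm (F t) \<le> B"
    and P: "negligible {r \<in> {a..b}. \<not> P r}"
  shows "negligible {s \<in> {0..1}. \<not> (\<exists>p. (\<phi>0 has_vector_derivative p) (at s within {0..1}) \<and>
     ((\<lambda>s. integral {a..\<phi>0 s} F) has_vector_derivative p *\<^sub>R F (\<phi>0 s)) (at s within {0..1}) \<and> (p = 0 \<or> P (\<phi>0 s)))}"
proof -
  obtain h where h: "negligible {s \<in> {0..1}. \<not> (\<phi>0 has_vector_derivative h s) (at s within {0..1})}"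
    using lipschitz_has_vector_derivative_ae[OF zero_le_one lip[folded real_norm_def]] by blast
  have Fi: "F integrable_on {a..b}" using F(1) set_lebesgue_integral_eq_integral(1) by blast
  define H where "H = (\<lambda>t. integral {a..t} F)"
  define N where "N = {r \<in> {a..b}. \<not> P r} \<union> {r \<in> {a..b}. \<not> (H has_vector_derivative F r) (at r within {a..b})}"
  have N: "negligible N" unfolding N_def H_def
    by (rule negligible_Un[OF P indefinite_integral_has_vector_derivative_ae[OF Fi]])
  define S where "S = {s \<in> {0..1}. (\<phi>0 has_vector_derivative h s) (at s within {0..1}) \<and> h s \<noteq> 0}"
  have "negligible {s \<in> S. \<phi>0 s \<in> N}"
  proof (rule negligible_differentiable_vimage[OF N])
    fix s assume s: "s \<in> S"
    show "inj (\<lambda>x. x *\<^sub>R h s)" using s by (auto simp: S_def inj_on_def)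
    have "(\<phi>0 has_vector_derivative h s) (at s within S)"
      by (rule has_vector_derivative_within_subset[of _ _ _ "{0..1}"]) (use s in \<open>auto simp: S_def\<close>)
    then show "(\<phi>0 has_derivative (\<lambda>x. x *\<^sub>R h s)) (at s within S)"
      by (simp add: has_vector_derivative_def)
  qed
  moreover have "{s \<in> {0..1}. \<not> (\<exists>p. (\<phi>0 has_vector_derivative p) (at s within {0..1}) \<and>
     ((\<lambda>s. integral {a..\<phi>0 s} F) has_vector_derivative p *\<^sub>R F (\<phi>0 s)) (at s within {0..1}) \<and> (p = 0 \<or> P (\<phi>0 s)))}
     \<subseteq> {s \<in> {0..1}. \<not> (\<phi>0 has_vector_derivative h s) (at s within {0..1})} \<union> {s \<in> S. \<phi>0 s \<in> N}"
  proof (rule subsetI, rule ccontr)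
    fix s
    assume bad: "s \<in> {s \<in> {0..1}. \<not> (\<exists>p. (\<phi>0 has_vector_derivative p) (at s within {0..1}) \<and>
       ((\<lambda>s. integral {a..\<phi>0 s} F) has_vector_derivative p *\<^sub>R F (\<phi>0 s)) (at s within {0..1}) \<and> (p = 0 \<or> P (\<phi>0 s)))}"
      and good: "s \<notin> {s \<in> {0..1}. \<not> (\<phi>0 has_vector_derivative h s) (at s within {0..1})} \<union> {s \<in> S. \<phi>0 s \<in> N}"
    from bad have s: "s \<in> {0..1}" by blast
    with good have d: "(\<phi>0 has_vector_derivative h s) (at s within {0..1})" by blast
    have \<phi>s: "\<phi>0 s \<in> {a..b}" if "s \<in> {0..1}" for s using img that by blast
    have "((\<lambda>s. H (\<phi>0 s)) has_vector_derivative h s *\<^sub>R F (\<phi>0 s)) (at s within {0..1}) \<and> (h s = 0 \<or> P (\<phi>0 s))"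
    proof (cases "h s = 0")
      case False
      then have "\<phi>0 s \<notin> N" using good s d by (auto simp: S_def)
      then have "P (\<phi>0 s)" "(H has_vector_derivative F (\<phi>0 s)) (at (\<phi>0 s) within \<phi>0 ` {0..1})"
        using \<phi>s[OF s] img by (auto simp: N_def)
      then show ?thesis using vector_diff_chain_within[OF d] by (simp add: o_def)
    next
      case True
      have "((\<lambda>s. H (\<phi>0 s)) has_vector_derivative 0) (at s within {0..1})"
        unfolding has_vector_derivative_within_alt
      proof (intro allI impI)
        fix e :: real assume "0 < e"
        then have "0 < e / (\<bar>B\<bar> + 1)" by simp
        then obtain \<delta> where \<delta>: "\<delta> > 0" "\<And>y. y \<in> {0..1} \<Longrightarrow> \<bar>y - s\<bar> < \<delta> \<Longrightarrow> norm (\<phi>0 y - \<phi>0 s - (y - s) *\<^sub>R h s) \<le> e / (\<bar>B\<bar> + 1) * \<bar>y - s\<bar>"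
          using d unfolding has_vector_derivative_within_alt by blast
        show "\<exists>\<delta>>0. \<forall>y\<in>{0..1}. \<bar>y - s\<bar> < \<delta> \<longrightarrow> norm (H (\<phi>0 y) - H (\<phi>0 s) - (y - s) *\<^sub>R 0) \<le> e * \<bar>y - s\<bar>"
        proof (intro exI[of _ \<delta>] conjI ballI impI)
          fix y assume y: "y \<in> {0..1}" "\<bar>y - s\<bar> < \<delta>"
          have "norm (H (\<phi>0 y) - H (\<phi>0 s)) \<le> B * \<bar>\<phi>0 y - \<phi>0 s\<bar>"
          proof (cases "\<phi>0 s \<le> \<phi>0 y")
            case True
            then show ?thesis using integral_lipschitz[OF F, of "\<phi>0 s" "\<phi>0 y"] \<phi>s[OF s] \<phi>s[OF y(1)] by (simp add: H_def)
          next
            case False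
            then show ?thesis using integral_lipschitz[OF F, of "\<phi>0 y" "\<phi>0 s"] \<phi>s[OF s] \<phi>s[OF y(1)]
              by (simp add: H_def norm_minus_commute)
          qed
          also have "\<dots> \<le> (\<bar>B\<bar> + 1) * \<bar>\<phi>0 y - \<phi>0 s\<bar>" by (intro mult_right_mono) auto
          also have "\<dots> \<le> (\<bar>B\<bar> + 1) * (e / (\<bar>B\<bar> + 1) * \<bar>y - s\<bar>)"
            using \<delta>(2)[OF y] True by (intro mult_left_mono) auto
          also have "\<dots> = e * \<bar>y - s\<bar>" by (simp add: field_simps)
          finally show "norm (H (\<phi>0 y) - H (\<phi>0 s) - (y - s) *\<^sub>R 0) \<le> e * \<bar>y - s\<bar>" by simp
        qed (fact \<delta>(1))
      qed
      then show ?thesis using True by simp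
    qed
    then show False using bad d s unfolding H_def by blast
  qed
  ultimately show ?thesis using h negligible_Un negligible_subset by blast
qed

text \<open>A quadratic error is negligible against \<open>t - s\<close>, so the derivatives of
  \<open>\<Phi>\<close> and \<open>\<phi>\<close> determine that of \<open>y\<close>. The estimate
  is based at left end points; for \<open>t < s\<close> the base has to move from \<open>t\<close>
  to \<open>s\<close>, which costs another quadratic term.\<close>

lemma sewing_derivative:
  fixes y :: "real \<Rightarrow> 'e::euclidean_space" and \<phi> :: "real \<Rightarrow> 'f::euclidean_space"
  assumes y: "\<And>s t. p \<le> s \<Longrightarrow> s \<le> t \<Longrightarrow> t \<le> q \<Longrightarrow> norm (y t - y s) \<le> K * (t - s)"
    and \<phi>: "\<And>s t. p \<le> s \<Longrightarrow> s \<le> t \<Longrightarrow> t \<le> q \<Longrightarrow> norm (\<phi> t - \<phi> s) \<le> K * (t - s)"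
    and lin: "\<And>x. bounded_linear (\<Gamma> x)"
    and L: "0 \<le> L" "\<And>s t w. s \<in> {p..q} \<Longrightarrow> t \<in> {p..q} \<Longrightarrow> norm (\<Gamma> (y t) w - \<Gamma> (y s) w) \<le> L * norm (y t - y s) * norm w"
    and quad: "\<And>s t. p \<le> s \<Longrightarrow> s \<le> t \<Longrightarrow> t \<le> q \<Longrightarrow>
       norm (y t - y s - (\<Phi> t - \<Phi> s) - \<Gamma> (y s) (\<phi> t - \<phi> s)) \<le> C * (t - s)\<^sup>2"
    and s: "s \<in> {p..q}" and d\<Phi>: "(\<Phi> has_vector_derivative \<Phi>') (at s within {p..q})"
    and d\<phi>: "(\<phi> has_vector_derivative \<phi>') (at s within {p..q})"
  shows "(y has_vector_derivative \<Phi>' + \<Gamma> (y s) \<phi>') (at s within {p..q})"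
proof -
  interpret G: bounded_linear "\<Gamma> (y s)" by (rule lin)
  \<comment> \<open>\<open>L * \<bar>K\<bar> * \<bar>K\<bar>\<close> pays for the change of base
    point; the \<open>+ 1\<close> makes the constant positive for the division below.\<close>
  let ?C = "\<bar>C\<bar> + L * \<bar>K\<bar> * \<bar>K\<bar> + 1"
  have C0: "0 < ?C" using L(1) by (simp add: add_nonneg_pos)
  have two: "norm (y t - y s - (\<Phi> t - \<Phi> s) - \<Gamma> (y s) (\<phi> t - \<phi> s)) \<le> ?C * (t - s)\<^sup>2" if t: "t \<in> {p..q}" for t
  proof (cases "s \<le> t")
    case True
    have "norm (y t - y s - (\<Phi> t - \<Phi> s) - \<Gamma> (y s) (\<phi> t - \<phi> s)) \<le> C * (t - s)\<^sup>2"
      using quad[of s t] True s t by simp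
    also have "\<dots> \<le> ?C * (t - s)\<^sup>2"
    proof (rule mult_right_mono)
      have "0 \<le> L * \<bar>K\<bar> * \<bar>K\<bar>" using L(1) by simp
      then show "C \<le> ?C" by linarith
    qed simp
    finally show ?thesis .
  next
    case False
    then have ts: "p \<le> t" "t \<le> s" "s \<le> q" using s t by auto
    interpret Gt: bounded_linear "\<Gamma> (y t)" by (rule lin)
    have eq: "y t - y s - (\<Phi> t - \<Phi> s) - \<Gamma> (y s) (\<phi> t - \<phi> s)
      = - (y s - y t - (\<Phi> s - \<Phi> t) - \<Gamma> (y t) (\<phi> s - \<phi> t)) - (\<Gamma> (y t) (\<phi> s - \<phi> t) - \<Gamma> (y s) (\<phi> s - \<phi> t))"
      by (simp add: G.diff)
    have "norm (\<Gamma> (y t) (\<phi> s - \<phi> t) - \<Gamma> (y s) (\<phi> s - \<phi> t)) \<le> L * norm (y t - y s) * norm (\<phi> s - \<phi> t)"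
      by (rule L(2)[OF s t])
    also have "\<dots> \<le> L * (\<bar>K\<bar> * (s - t)) * (\<bar>K\<bar> * (s - t))"
    proof (intro mult_mono order_refl)
      have K: "K * (s - t) \<le> \<bar>K\<bar> * (s - t)" using ts by (intro mult_right_mono) auto
      show "norm (y t - y s) \<le> \<bar>K\<bar> * (s - t)" using y[OF ts] K by (simp add: norm_minus_commute)
      show "norm (\<phi> s - \<phi> t) \<le> \<bar>K\<bar> * (s - t)" using \<phi>[OF ts] K by linarith
    qed (use L(1) ts in auto)
    finally have n2: "norm (\<Gamma> (y t) (\<phi> s - \<phi> t) - \<Gamma> (y s) (\<phi> s - \<phi> t)) \<le> L * \<bar>K\<bar> * \<bar>K\<bar> * (t - s)\<^sup>2"
      by (simp add: power2_eq_square algebra_simps)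
    have n1: "norm (y s - y t - (\<Phi> s - \<Phi> t) - \<Gamma> (y t) (\<phi> s - \<phi> t)) \<le> \<bar>C\<bar> * (t - s)\<^sup>2"
      using quad[OF ts] mult_right_mono[OF abs_ge_self[of C] zero_le_power2[of "t - s"]]
      by (simp add: power2_commute)
    have "norm (y t - y s - (\<Phi> t - \<Phi> s) - \<Gamma> (y s) (\<phi> t - \<phi> s)) \<le> \<bar>C\<bar> * (t - s)\<^sup>2 + L * \<bar>K\<bar> * \<bar>K\<bar> * (t - s)\<^sup>2"
      unfolding eq by (rule order_trans[OF norm_triangle_ineq4]) (use n1 n2 in \<open>simp add: norm_minus_commute add_mono norm_minus_cancel\<close>)
    also have "\<dots> \<le> ?C * (t - s)\<^sup>2" by (simp add: algebra_simps)
    finally show ?thesis .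
  qed
  have dZ: "((\<lambda>t. y t - \<Phi> t - \<Gamma> (y s) (\<phi> t)) has_vector_derivative 0) (at s within {p..q})"
    unfolding has_vector_derivative_within_alt
  proof (intro allI impI)
    fix e :: real assume e: "0 < e"
    show "\<exists>d>0. \<forall>t\<in>{p..q}. \<bar>t - s\<bar> < d \<longrightarrow>
       norm (y t - \<Phi> t - \<Gamma> (y s) (\<phi> t) - (y s - \<Phi> s - \<Gamma> (y s) (\<phi> s)) - (t - s) *\<^sub>R 0) \<le> e * \<bar>t - s\<bar>"
    proof (intro exI[of _ "e / ?C"] conjI ballI impI)
      show "0 < e / ?C" using e C0 by simp
      fix t assume t: "t \<in> {p..q}" "\<bar>t - s\<bar> < e / ?C"
      have "y t - \<Phi> t - \<Gamma> (y s) (\<phi> t) - (y s - \<Phi> s - \<Gamma> (y s) (\<phi> s)) - (t - s) *\<^sub>R 0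
        = y t - y s - (\<Phi> t - \<Phi> s) - \<Gamma> (y s) (\<phi> t - \<phi> s)" by (simp add: G.diff)
      then have "norm (y t - \<Phi> t - \<Gamma> (y s) (\<phi> t) - (y s - \<Phi> s - \<Gamma> (y s) (\<phi> s)) - (t - s) *\<^sub>R 0) \<le> ?C * (t - s)\<^sup>2"
        using two[OF t(1)] by (simp only:)
      also have "\<dots> = (?C * \<bar>t - s\<bar>) * \<bar>t - s\<bar>" by (simp add: power2_eq_square mult.assoc)
      also have "\<dots> \<le> e * \<bar>t - s\<bar>"
        using t(2) C0 by (intro mult_right_mono) (auto simp: field_simps)
      finally show "norm (y t - \<Phi> t - \<Gamma> (y s) (\<phi> t) - (y s - \<Phi> s - \<Gamma> (y s) (\<phi> s)) - (t - s) *\<^sub>R 0) \<le> e * \<bar>t - s\<bar>" .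
    qed
  qed
  have "((\<lambda>t. (y t - \<Phi> t - \<Gamma> (y s) (\<phi> t)) + (\<Phi> t + \<Gamma> (y s) (\<phi> t))) has_vector_derivative 0 + (\<Phi>' + \<Gamma> (y s) \<phi>')) (at s within {p..q})"
    by (intro has_vector_derivative_add dZ d\<Phi> G.has_vector_derivative d\<phi>)
  then show ?thesis by simp
qed

text \<open>The strict inequality makes derivatives within \<open>{a..b}\<close> unique at every
  point; the one-point interval is settled separately at the end.\<close>

locale control_system =
  fixes f :: "real \<Rightarrow> real^'n \<Rightarrow> real^'m \<Rightarrow> real^'l \<Rightarrow> real^'n"
    and g :: "'m \<Rightarrow> real^'n \<Rightarrow> real^'n"
    and a b :: real and U :: "(real^'m) set" and V :: "(real^'l) set"
  assumes a_less_b: "a < b" and compact_U: "compact U"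
    and f_measurable: "\<And>x u v. v \<in> V \<Longrightarrow> (\<lambda>t. f t x u v) \<in> borel_measurable (lebesgue_on {a..b})"
    and f_continuous: "\<And>t. t \<in> {a..b} \<Longrightarrow> continuous_on (UNIV \<times> UNIV \<times> V) (\<lambda>(x, u, v). f t x u v)"
    and f_lipschitz: "\<And>z. \<exists>r>0. \<exists>L. \<forall>t\<in>{a..b}. \<forall>v\<in>V. L-lipschitz_on (cball z r) (\<lambda>(x, u). f t x u v)"
    and g_C1: "\<And>\<alpha>. C1_map (g \<alpha>)"
    and growth: "\<exists>M>0. \<forall>x u. \<forall>t\<in>{a..b}. \<forall>v\<in>V.
           norm (f t x u v, \<chi> \<alpha>. g \<alpha> x) \<le> M * (1 + norm (x, u))"
begin

lemma drift_measurable: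
  assumes X: "X \<in> borel_measurable (lebesgue_on {a..b})" and u: "u \<in> borel_measurable (lebesgue_on {a..b})"
    and v: "v \<in> borel_measurable (lebesgue_on {a..b})" "\<And>t. t \<in> {a..b} \<Longrightarrow> v t \<in> V"
  shows "(\<lambda>t. f t (X t) (u t) (v t)) \<in> borel_measurable (lebesgue_on {a..b})"
proof -
  have "(\<lambda>t. (\<lambda>t (x, u, v). f t x u v) t (X t, u t, v t)) \<in> borel_measurable (lebesgue_on {a..b})"
  proof (rule caratheodory_composition_measurable[where S="UNIV \<times> UNIV \<times> V"])
    show "(\<lambda>t. (X t, u t, v t)) \<in> borel_measurable (lebesgue_on {a..b})"
      by (intro borel_measurable_Pair X u v)
  qed (use f_measurable f_continuous v(2) in auto)
  then show ?thesis by simp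
qed

text \<open>One constant for all four bounds, so that estimates for trajectories in a ball carry a
  single \<open>C\<close>.\<close>

definition local_bound :: "real \<Rightarrow> real \<Rightarrow> bool" where
  "local_bound R C \<longleftrightarrow> 0 \<le> C \<and>
    (\<forall>t\<in>{a..b}. \<forall>x\<in>cball 0 R. \<forall>u\<in>U. \<forall>v\<in>V. norm (f t x u v) \<le> C) \<and>
    (\<forall>t\<in>{a..b}. \<forall>x\<in>cball 0 R. \<forall>x'\<in>cball 0 R. \<forall>u\<in>U. \<forall>v\<in>V.
       norm (f t x u v - f t x' u v) \<le> C * norm (x - x')) \<and>
    (\<forall>x\<in>cball 0 R. \<forall>w. norm (control_term g x w) \<le> C * norm w) \<and>
    (\<forall>x\<in>cball 0 R. \<forall>x'\<in>cball 0 R. \<forall>w.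
       norm (control_term g x w - control_term g x' w) \<le> C * norm (x - x') * norm w)"

lemma local_boundD:
  assumes "local_bound R C"
  shows "0 \<le> C"
    "\<And>t x u v. t \<in> {a..b} \<Longrightarrow> x \<in> cball 0 R \<Longrightarrow> u \<in> U \<Longrightarrow> v \<in> V \<Longrightarrow> norm (f t x u v) \<le> C"
    "\<And>t x x' u v. t \<in> {a..b} \<Longrightarrow> x \<in> cball 0 R \<Longrightarrow> x' \<in> cball 0 R \<Longrightarrow> u \<in> U \<Longrightarrow> v \<in> V \<Longrightarrow>
       norm (f t x u v - f t x' u v) \<le> C * norm (x - x')"
    "\<And>x w. x \<in> cball 0 R \<Longrightarrow> norm (control_term g x w) \<le> C * norm w"
    "\<And>x x' w. x \<in> cball 0 R \<Longrightarrow> x' \<in> cball 0 R \<Longrightarrow>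
       norm (control_term g x w - control_term g x' w) \<le> C * norm (x - x') * norm w"
  using assms unfolding local_bound_def by blast+

lemma local_bound_exists: "\<exists>C. local_bound R C"
proof -
  obtain CU where CU: "\<And>u. u \<in> U \<Longrightarrow> norm u \<le> CU" using compact_imp_bounded[OF compact_U] unfolding bounded_iff by blast
  obtain M where M: "M > 0" "\<And>x u t v. t \<in> {a..b} \<Longrightarrow> v \<in> V \<Longrightarrow> norm (f t x u v, \<chi> \<alpha>. g \<alpha> x) \<le> M * (1 + norm (x, u))"
    using growth by blast
  let ?B = "M * (1 + (\<bar>R\<bar> + CU))"
  have fB: "norm (f t x u v) \<le> ?B" if "t \<in> {a..b}" "x \<in> cball 0 R" "u \<in> U" "v \<in> V" for t x u v
  proof -
    have "norm (f t x u v) \<le> norm (f t x u v, \<chi> \<alpha>. g \<alpha> x)" using norm_fst_le[of "f t x u v" "\<chi> \<alpha>. g \<alpha> x"] by simp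
    also have "\<dots> \<le> M * (1 + norm (x, u))" by (rule M(2)[OF that(1,4)])
    also have "\<dots> \<le> ?B" using M(1) norm_Pair_le[of x u] CU[OF that(3)] that(2) by (intro mult_left_mono) auto
    finally show ?thesis .
  qed
  define K where "K = cball (0::real^'n) R \<times> U"
  have K: "compact K" unfolding K_def by (intro compact_Times compact_cball compact_U)
  \<comment> \<open>The compactness lemma is applied with \<open>(t, v)\<close> as index and
    \<open>(x, u)\<close> as point, since the local Lipschitz constants are uniform in
    \<open>(t, v)\<close>.\<close>
  have loc: "\<exists>r>0. \<exists>L. \<forall>i\<in>{a..b} \<times> V. L-lipschitz_on (cball z r) ((\<lambda>(t, v) (x, u). f t x u v) i)" for z
    using f_lipschitz[of z] by auto
  have bd: "norm ((\<lambda>(t, v) (x, u). f t x u v) i z) \<le> ?B" if "i \<in> {a..b} \<times> V" "z \<in> K" for i z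
    using that fB[of "fst i" "fst z" "snd z" "snd i"] by (auto simp: K_def)
  obtain L where L: "0 \<le> L" "\<forall>i\<in>{a..b} \<times> V. \<forall>z\<in>K. \<forall>z'\<in>K.
      norm ((\<lambda>(t, v) (x, u). f t x u v) i z - (\<lambda>(t, v) (x, u). f t x u v) i z') \<le> L * norm (z - z')"
    using locally_lipschitz_bounded_imp_lipschitz_on_compact[OF loc K bd] by blast
  have "\<exists>C\<ge>0. (\<forall>x\<in>cball 0 R. norm (g \<alpha> x) \<le> C) \<and> (\<forall>x\<in>cball 0 R. \<forall>y\<in>cball 0 R. norm (g \<alpha> x - g \<alpha> y) \<le> C * norm (x - y))" for \<alpha>
    using C1_map_lipschitz_on_cball[OF g_C1[of \<alpha>], of R] by metis
  then obtain c where c: "\<And>\<alpha>. 0 \<le> c \<alpha>" "\<And>\<alpha> x. x \<in> cball 0 R \<Longrightarrow> norm (g \<alpha> x) \<le> c \<alpha>"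
    "\<And>\<alpha> x y. x \<in> cball 0 R \<Longrightarrow> y \<in> cball 0 R \<Longrightarrow> norm (g \<alpha> x - g \<alpha> y) \<le> c \<alpha> * norm (x - y)" by metis
  define D where "D = (\<Sum>\<alpha>\<in>UNIV. c \<alpha>)"
  have D0: "0 \<le> D" unfolding D_def using c(1) by (intro sum_nonneg) auto
  let ?C = "\<bar>?B\<bar> + L + D"
  have C: "0 \<le> ?C" "?B \<le> ?C" "L \<le> ?C" "D \<le> ?C" using D0 L(1) by auto
  show ?thesis
    unfolding local_bound_def
  proof (intro exI[of _ ?C] conjI ballI allI)
    show "0 \<le> ?C" by (rule C(1))
    show "norm (f t x u v) \<le> ?C" if "t \<in> {a..b}" "x \<in> cball 0 R" "u \<in> U" "v \<in> V" for t x u v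
      using fB[OF that] C(2) by linarith
    show "norm (f t x u v - f t x' u v) \<le> ?C * norm (x - x')"
      if "t \<in> {a..b}" "x \<in> cball 0 R" "x' \<in> cball 0 R" "u \<in> U" "v \<in> V" for t x x' u v
    proof -
      have "norm (f t x u v - f t x' u v) \<le> L * norm ((x, u) - (x', u))"
        using L(2)[rule_format, of "(t, v)" "(x, u)" "(x', u)"] that by (simp add: K_def)
      also have "\<dots> = L * norm (x - x')" by (simp add: norm_Pair)
      also have "\<dots> \<le> ?C * norm (x - x')" by (rule mult_right_mono[OF C(3)]) simp
      finally show ?thesis .
    qed
    show "norm (control_term g x w) \<le> ?C * norm w" if "x \<in> cball 0 R" for x w
    proof -
      have "(\<Sum>\<alpha>\<in>UNIV. norm (g \<alpha> x)) \<le> D" unfolding D_def using c(2)[OF that] by (intro sum_mono)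
      then have "(\<Sum>\<alpha>\<in>UNIV. norm (g \<alpha> x)) \<le> ?C" using C(4) by linarith
      then show ?thesis using norm_control_term_le[of g x w] by (meson mult_right_mono norm_ge_zero order_trans)
    qed
    show "norm (control_term g x w - control_term g x' w) \<le> ?C * norm (x - x') * norm w"
      if "x \<in> cball 0 R" "x' \<in> cball 0 R" for x x' w
    proof -
      have "(\<Sum>\<alpha>\<in>UNIV. norm (g \<alpha> x - g \<alpha> x')) \<le> D * norm (x - x')"
        unfolding D_def sum_distrib_right using c(3)[OF that] by (intro sum_mono)
      also have "\<dots> \<le> ?C * norm (x - x')" by (rule mult_right_mono[OF C(4)]) simp
      finally show ?thesis using norm_control_term_diff_le[of g x w x'] by (meson mult_right_mono norm_ge_zero order_trans)
    qed
  qed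
qed

text \<open>\<open>vector_derivative\<close> in the definition is a derivative only where one
  exists; domination by \<open>\<nu>\<close> provides it almost everywhere.\<close>

lemma caratheodory_solution_derivatives:
  assumes sol: "caratheodory_solution f g a b x0 u v X"
    and \<nu>: "abs_continuous_on {a..b} \<nu>"
    and dom: "\<And>s t. a \<le> s \<Longrightarrow> s \<le> t \<Longrightarrow> t \<le> b \<Longrightarrow> norm (u t - u s) \<le> \<nu> t - \<nu> s"
  obtains N where "negligible N" "\<And>t. t \<in> {a..b} - N \<Longrightarrow> \<exists>u'. (u has_vector_derivative u') (at t within {a..b}) \<and>
        (X has_vector_derivative f t (X t) (u t) (v t) + control_term g (X t) u') (at t within {a..b})"
proof -
  obtain h where h: "negligible {x \<in> {a..b}. \<not> (u has_vector_derivative h x) (at x within {a..b})}"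
    using abs_continuous_is_integral[OF less_imp_le[OF a_less_b] \<nu> dom] by blast
  have "AE t in lebesgue_on {a..b}. (X has_vector_derivative
           (f t (X t) (u t) (v t) + control_term g (X t) (vector_derivative u (at t within {a..b}))))
        (at t within {a..b})" (is "AE t in _. ?P t")
    using sol unfolding caratheodory_solution_def control_term_def by blast
  then have X: "negligible {t \<in> {a..b}. \<not> ?P t}" by (subst (asm) AE_lebesgue_on_iff_negligible) auto
  show ?thesis
  proof (rule that[OF negligible_Un[OF h X]])
    fix t assume t: "t \<in> {a..b} - ({x \<in> {a..b}. \<not> (u has_vector_derivative h x) (at x within {a..b})} \<union> {t \<in> {a..b}. \<not> ?P t})"
    then have d: "(u has_vector_derivative h t) (at t within {a..b})" and P: "?P t" by blast+
    have "vector_derivative u (at t within {a..b}) = h t"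
      using vector_derivative_within_cbox[of a b t u "h t"] a_less_b t d by simp
    then show "\<exists>u'. (u has_vector_derivative u') (at t within {a..b}) \<and>
        (X has_vector_derivative f t (X t) (u t) (v t) + control_term g (X t) u') (at t within {a..b})"
      using d P by auto
  qed
qed

text \<open>Limit solutions allow trajectories that vary with \<open>\<tau>\<close>; uniqueness
  merges them into one sequence. The proof is Gronwall's argument with error 0, driven by the path
  \<open>(t, u t)\<close> so that one term controls drift and input together.\<close>

lemma caratheodory_solution_unique:
  assumes X: "caratheodory_solution f g a b x0 u v X" and Y: "caratheodory_solution f g a b x0 u v Y"
    and \<nu>: "abs_continuous_on {a..b} \<nu>"
    and dom: "\<And>s t. a \<le> s \<Longrightarrow> s \<le> t \<Longrightarrow> t \<le> b \<Longrightarrow> norm (u t - u s) \<le> \<nu> t - \<nu> s"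
    and u: "\<And>t. t \<in> {a..b} \<Longrightarrow> u t \<in> U" and v: "\<And>t. t \<in> {a..b} \<Longrightarrow> v t \<in> V" and t: "t \<in> {a..b}"
  shows "X t = Y t"
proof -
  have acX: "abs_continuous_on {a..b} X" and acY: "abs_continuous_on {a..b} Y" and init: "X a = Y a"
    using X Y by (auto simp: caratheodory_solution_def)
  have "bounded (X ` {a..b} \<union> Y ` {a..b})"
    using compact_imp_bounded[OF compact_continuous_image[OF abs_continuous_on_imp_continuous_on[OF acX] compact_Icc]]
      compact_imp_bounded[OF compact_continuous_image[OF abs_continuous_on_imp_continuous_on[OF acY] compact_Icc]]
    by simp
  then obtain R where "\<forall>z\<in>X ` {a..b} \<union> Y ` {a..b}. norm z \<le> R"
    unfolding bounded_iff by blast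
  then have R: "\<And>t. t \<in> {a..b} \<Longrightarrow> X t \<in> cball 0 R" "\<And>t. t \<in> {a..b} \<Longrightarrow> Y t \<in> cball 0 R"
    by auto
  obtain C where "local_bound R C" using local_bound_exists by blast
  note C = local_boundD(1,3,5)[OF this]
  obtain N1 where N1: "negligible N1" "\<And>t. t \<in> {a..b} - N1 \<Longrightarrow> \<exists>u'. (u has_vector_derivative u') (at t within {a..b}) \<and>
        (X has_vector_derivative f t (X t) (u t) (v t) + control_term g (X t) u') (at t within {a..b})"
    using caratheodory_solution_derivatives[OF X \<nu> dom] by blast
  obtain N2 where N2: "negligible N2" "\<And>t. t \<in> {a..b} - N2 \<Longrightarrow> \<exists>u'. (u has_vector_derivative u') (at t within {a..b}) \<and>
        (Y has_vector_derivative f t (Y t) (u t) (v t) + control_term g (Y t) u') (at t within {a..b})"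
    using caratheodory_solution_derivatives[OF Y \<nu> dom] by blast
  define D where "D = (\<lambda>t. X t - Y t)"
  define \<mu> where "\<mu> = (\<lambda>t. t + \<nu> t)"
  have acD: "abs_continuous_on {a..b} D" unfolding D_def by (rule abs_continuous_on_diff[OF acX acY])
  have ac\<mu>: "abs_continuous_on {a..b} \<mu>" unfolding \<mu>_def by (rule abs_continuous_on_add[OF abs_continuous_on_ident \<nu>])
  have dom\<mu>: "norm ((t, u t) - (s, u s)) \<le> \<mu> t - \<mu> s" if "a \<le> s" "s \<le> t" "t \<le> b" for s t
    using norm_Pair_le[of "t - s" "u t - u s"] dom[OF that] that by (simp add: \<mu>_def)
  have mono\<mu>: "\<mu> s \<le> \<mu> t" if "a \<le> s" "s \<le> t" "t \<le> b" for s t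
    using dom\<mu>[OF that] norm_ge_zero[of "(t, u t) - (s, u s)"] by linarith
  obtain n :: nat where n: "2 * (2 * C) * (\<mu> t - \<mu> a) \<le> real n" using real_arch_simple by blast
  have "norm (D t) \<le> (2 ^ n - 1) * 0"
  proof (rule gronwall_increments[where D=D and \<mu>=\<mu> and a=a and b=b and L="2 * C" and n=n])
    show "continuous_on {a..b} D" "continuous_on {a..b} \<mu>"
      by (intro abs_continuous_on_imp_continuous_on acD ac\<mu>)+
    show "D a = 0" using init by (simp add: D_def)
    fix s t B assume st: "a \<le> s" "s \<le> t" "t \<le> b" and B: "\<And>r. s \<le> r \<Longrightarrow> r \<le> t \<Longrightarrow> norm (D r) \<le> B"
    have B0: "0 \<le> B" using B[of s] st norm_ge_zero[of "D s"] by linarith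
    have "norm (D t - D s) \<le> (2 * C * B) * (\<mu> t - \<mu> s)"
    proof (rule increment_le_dominated[where u="\<lambda>t. (t, u t)" and N="N1 \<union> N2", OF st(2)])
      show "abs_continuous_on {s..t} D" using st by (intro abs_continuous_on_subset[OF acD]) auto
      show "negligible (N1 \<union> N2)" by (rule negligible_Un[OF N1(1) N2(1)])
      show "0 \<le> 2 * C * B" using B0 C(1) by simp
      show "norm ((r', u r') - (r, u r)) \<le> \<mu> r' - \<mu> r" if "s \<le> r" "r \<le> r'" "r' \<le> t" for r r'
        using dom\<mu> that st by auto
      fix r assume r: "r \<in> {s..t} - (N1 \<union> N2)"
      then have rab: "r \<in> {a..b}" using st by auto
      obtain u1 where u1: "(u has_vector_derivative u1) (at r within {a..b})"
        "(X has_vector_derivative f r (X r) (u r) (v r) + control_term g (X r) u1) (at r within {a..b})"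
        using N1(2)[of r] r rab by blast
      obtain u2 where u2: "(u has_vector_derivative u2) (at r within {a..b})"
        "(Y has_vector_derivative f r (Y r) (u r) (v r) + control_term g (Y r) u2) (at r within {a..b})"
        using N2(2)[of r] r rab by blast
      have "u2 = u1"
        using vector_derivative_unique_within_closed_interval[of a b r u u2 u1] u1(1) u2(1) a_less_b rab by simp
      let ?d = "f r (X r) (u r) (v r) + control_term g (X r) u1 - (f r (Y r) (u r) (v r) + control_term g (Y r) u1)"
      have sub: "{s..t} \<subseteq> {a..b}" using st by auto
      have 1: "(D has_vector_derivative ?d) (at r within {s..t})"
        unfolding D_def using has_vector_derivative_diff[OF u1(2) u2(2)] \<open>u2 = u1\<close> sub
        by (auto intro: has_vector_derivative_within_subset)
      have 2: "((\<lambda>t. (t, u t)) has_vector_derivative (1, u1)) (at r within {s..t})"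
        using has_vector_derivative_within_subset[OF u1(1) sub]
        by (intro has_vector_derivative_Pair has_vector_derivative_id)
      have "?d = (f r (X r) (u r) (v r) - f r (Y r) (u r) (v r)) + (control_term g (X r) u1 - control_term g (Y r) u1)" by simp
      also have "norm \<dots> \<le> C * norm (X r - Y r) + C * norm (X r - Y r) * norm u1"
        using R[OF rab] u[OF rab] v[OF rab] rab by (intro norm_triangle_mono C(2,3))
      \<comment> \<open>\<open>norm (1, u1)\<close> is at least 1 and at least
        \<open>norm u1\<close>, so it dominates both terms.\<close>
      also have "\<dots> \<le> C * B * norm (1::real, u1) + C * B * norm (1::real, u1)"
      proof -
        have le: "norm (X r - Y r) \<le> B" using B[of r] r by (simp add: D_def)
        have n1: "1 \<le> norm (1::real, u1)" "norm u1 \<le> norm (1::real, u1)"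
          using norm_fst_le[of "1::real" u1] norm_snd_le[of u1 "1::real"] by auto
        have m1: "C * norm (X r - Y r) * 1 \<le> C * B * norm (1::real, u1)"
          using le n1 C(1) B0 by (intro mult_mono mult_left_mono) auto
        have m2: "C * norm (X r - Y r) * norm u1 \<le> C * B * norm (1::real, u1)"
          using le n1 C(1) B0 by (intro mult_mono mult_left_mono) auto
        show ?thesis using add_mono[OF m1 m2] by (simp only: mult_1_right)
      qed
      also have "\<dots> = 2 * C * B * norm (1::real, u1)" by simp
      finally show "\<exists>z' w'. (D has_vector_derivative z') (at r within {s..t}) \<and>
        ((\<lambda>t. (t, u t)) has_vector_derivative w') (at r within {s..t}) \<and> norm z' \<le> 2 * C * B * norm w'"
        using 1 2 by blast
    qed
    then show "norm (D t - D s) \<le> 2 * C * (B + 0) * (\<mu> t - \<mu> s)" by simp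
  qed (use C(1) mono\<mu> t n in auto)
  then show ?thesis by (simp add: D_def)
qed

text \<open>The drift of the space-time system is the derivative of a drift integral in original
  time. Where \<open>p\<close> is nonzero, \<open>s\<close> is the only parameter with its time, so
  the clock gives \<open>y s = x (\<phi>0 s)\<close> and \<open>\<phi> s = u (\<phi>0 s)\<close>;
  where \<open>p = 0\<close>, as on stretches that fill a jump, both sides vanish.\<close>

lemma space_time_drift_derivative_ae:
  fixes \<phi>0 :: "real \<Rightarrow> real"
  assumes lip: "\<And>s t. 0 \<le> s \<Longrightarrow> s \<le> t \<Longrightarrow> t \<le> 1 \<Longrightarrow> \<bar>\<phi>0 t - \<phi>0 s\<bar> \<le> K * (t - s)"
    and mono: "mono_on {0..1} \<phi>0" and img: "\<phi>0 ` {0..1} = {a..b}"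
    and clock: "\<And>r. r \<in> {a..b} \<Longrightarrow> \<sigma> r \<in> {0..1} \<and> \<phi>0 (\<sigma> r) = r \<and> \<phi> (\<sigma> r) = u r \<and> y (\<sigma> r) = x r"
    and F: "(\<lambda>r. f r (x r) (u r) (v r)) absolutely_integrable_on {a..b}"
      "\<And>r. r \<in> {a..b} \<Longrightarrow> norm (f r (x r) (u r) (v r)) \<le> B"
    and w: "AE t in lebesgue_on {a..b}. w t = v t"
  shows "negligible {s \<in> {0..1}. \<not> (\<exists>p. (\<phi>0 has_vector_derivative p) (at s within {0..1}) \<and>
     ((\<lambda>s. integral {a..\<phi>0 s} (\<lambda>r. f r (x r) (u r) (v r))) has_vector_derivative
        p *\<^sub>R f (\<phi>0 s) (y s) (\<phi> s) (w (\<phi>0 s))) (at s within {0..1}))}"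
proof (rule negligible_subset[OF reparametrized_integral_derivative_ae[OF lip img F, of "\<lambda>r. w r = v r"]])
  show "negligible {r \<in> {a..b}. w r \<noteq> v r}" using w by (subst (asm) AE_lebesgue_on_iff_negligible) auto
  show "{s \<in> {0..1}. \<not> (\<exists>p. (\<phi>0 has_vector_derivative p) (at s within {0..1}) \<and>
     ((\<lambda>s. integral {a..\<phi>0 s} (\<lambda>r. f r (x r) (u r) (v r))) has_vector_derivative
        p *\<^sub>R f (\<phi>0 s) (y s) (\<phi> s) (w (\<phi>0 s))) (at s within {0..1}))}
    \<subseteq> {s \<in> {0..1}. \<not> (\<exists>p. (\<phi>0 has_vector_derivative p) (at s within {0..1}) \<and>
     ((\<lambda>s. integral {a..\<phi>0 s} (\<lambda>r. f r (x r) (u r) (v r))) has_vector_derivative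
        p *\<^sub>R f (\<phi>0 s) (x (\<phi>0 s)) (u (\<phi>0 s)) (v (\<phi>0 s))) (at s within {0..1}) \<and> (p = 0 \<or> w (\<phi>0 s) = v (\<phi>0 s)))}"
  proof (rule subsetI, rule ccontr)
    fix s assume bad: "s \<in> {s \<in> {0..1}. \<not> (\<exists>p. (\<phi>0 has_vector_derivative p) (at s within {0..1}) \<and>
     ((\<lambda>s. integral {a..\<phi>0 s} (\<lambda>r. f r (x r) (u r) (v r))) has_vector_derivative
        p *\<^sub>R f (\<phi>0 s) (y s) (\<phi> s) (w (\<phi>0 s))) (at s within {0..1}))}"
      and "s \<notin> {s \<in> {0..1}. \<not> (\<exists>p. (\<phi>0 has_vector_derivative p) (at s within {0..1}) \<and>
     ((\<lambda>s. integral {a..\<phi>0 s} (\<lambda>r. f r (x r) (u r) (v r))) has_vector_derivative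
        p *\<^sub>R f (\<phi>0 s) (x (\<phi>0 s)) (u (\<phi>0 s)) (v (\<phi>0 s))) (at s within {0..1}) \<and> (p = 0 \<or> w (\<phi>0 s) = v (\<phi>0 s)))}"
    then obtain p where s: "s \<in> {0..1}" and p: "(\<phi>0 has_vector_derivative p) (at s within {0..1})"
      "((\<lambda>s. integral {a..\<phi>0 s} (\<lambda>r. f r (x r) (u r) (v r))) has_vector_derivative
        p *\<^sub>R f (\<phi>0 s) (x (\<phi>0 s)) (u (\<phi>0 s)) (v (\<phi>0 s))) (at s within {0..1})"
      "p = 0 \<or> w (\<phi>0 s) = v (\<phi>0 s)" by blast
    have "p *\<^sub>R f (\<phi>0 s) (x (\<phi>0 s)) (u (\<phi>0 s)) (v (\<phi>0 s)) = p *\<^sub>R f (\<phi>0 s) (y s) (\<phi> s) (w (\<phi>0 s))"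
    proof (cases "p = 0")
      case False
      have r: "\<phi>0 s \<in> {a..b}" using img s by blast
      have "\<sigma> (\<phi>0 s) = s"
        by (rule increasing_derivative_nonzero_imp_unique[OF mono p(1) False s]) (use clock[OF r] in auto)
      then show ?thesis using clock[OF r] p(3) False by simp
    qed simp
    then show False using bad p(1,2) by auto
  qed
qed

end

section \<open>From limit solutions to graph completions\<close>

text \<open>Time is added to \<open>\<nu>\<close> so that the arc length \<open>l\<close> is
  strictly increasing and has an inverse \<open>\<zeta>\<close>. Since the increments of time and of
  \<open>\<nu>\<close> are both nonnegative, the identity for their sum bounds each of them.\<close>

lemma arclength_parametrization:
  fixes \<nu> :: "real \<Rightarrow> real"
  assumes ab: "a < b" and cont: "continuous_on {a..b} \<nu>"
    and mono: "\<And>s t. a \<le> s \<Longrightarrow> s \<le> t \<Longrightarrow> t \<le> b \<Longrightarrow> \<nu> s \<le> \<nu> t"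
  shows "\<exists>\<zeta> l :: real \<Rightarrow> real. \<zeta> 0 = a \<and> (\<forall>s\<in>{0..1}. \<zeta> s \<in> {a..b}) \<and> (\<forall>t\<in>{a..b}. l t \<in> {0..1} \<and> \<zeta> (l t) = t) \<and>
    (\<forall>s s'. 0 \<le> s \<longrightarrow> s \<le> s' \<longrightarrow> s' \<le> 1 \<longrightarrow> \<zeta> s \<le> \<zeta> s' \<and>
       (\<zeta> s' - \<zeta> s) + (\<nu> (\<zeta> s') - \<nu> (\<zeta> s)) = (b - a + (\<nu> b - \<nu> a)) * (s' - s))"
proof -
  define \<Lambda> where "\<Lambda> = b - a + (\<nu> b - \<nu> a)"
  have \<Lambda>: "0 < \<Lambda>" using mono[of a b] ab by (simp add: \<Lambda>_def)
  define l where "l = (\<lambda>t. ((t - a) + (\<nu> t - \<nu> a)) / \<Lambda>)"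
  have l01: "l a = 0" "l b = 1" using \<Lambda> by (auto simp: l_def \<Lambda>_def)
  have l_less: "l s < l t" if "a \<le> s" "s < t" "t \<le> b" for s t
    using mono[of s t] that \<Lambda> by (auto simp: l_def divide_strict_right_mono)
  have inj: "inj_on l {a..b}"
    by (rule inj_onI) (metis atLeastAtMost_iff l_less less_irrefl linorder_neqE_linordered_idom)
  have lcont: "continuous_on {a..b} l" unfolding l_def using \<Lambda> by (intro continuous_intros cont) auto
  have range: "l t \<in> {0..1}" if "t \<in> {a..b}" for t
    using l_less[of a t] l_less[of t b] l01 that by (cases "t = a"; cases "t = b") auto
  have surj: "\<exists>t\<in>{a..b}. l t = s" if "s \<in> {0..1}" for s
    using IVT'[of l a s b] lcont l01 that ab by auto
  define \<zeta> where "\<zeta> = inv_into {a..b} l"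
  have \<zeta>: "\<zeta> s \<in> {a..b}" "l (\<zeta> s) = s" if "s \<in> {0..1}" for s
  proof -
    have "s \<in> l ` {a..b}" using surj[OF that] by auto
    then show "\<zeta> s \<in> {a..b}" "l (\<zeta> s) = s" unfolding \<zeta>_def by (rule inv_into_into, rule f_inv_into_f)
  qed
  have \<zeta>l: "\<zeta> (l t) = t" if "t \<in> {a..b}" for t
    unfolding \<zeta>_def by (rule inv_into_f_f[OF inj that])
  show ?thesis
  proof (intro exI conjI ballI allI impI)
    show "\<zeta> 0 = a" using \<zeta>l[of a] l01 ab by simp
    show "\<zeta> s \<in> {a..b}" if "s \<in> {0..1}" for s by (rule \<zeta>[OF that])
    show "l t \<in> {0..1}" "\<zeta> (l t) = t" if "t \<in> {a..b}" for t using range \<zeta>l that by blast+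
  next
    fix s s' :: real assume s: "0 \<le> s" "s \<le> s'" "s' \<le> 1"
    have "\<zeta> s \<le> \<zeta> s'"
    proof (rule ccontr)
      assume "\<not> \<zeta> s \<le> \<zeta> s'"
      then have "l (\<zeta> s') < l (\<zeta> s)" using \<zeta>(1)[of s] \<zeta>(1)[of s'] s by (intro l_less) auto
      then show False using \<zeta>(2)[of s] \<zeta>(2)[of s'] s by simp
    qed
    then show "\<zeta> s \<le> \<zeta> s'" .
    have "(\<zeta> s' - \<zeta> s) + (\<nu> (\<zeta> s') - \<nu> (\<zeta> s)) = \<Lambda> * (l (\<zeta> s') - l (\<zeta> s))"
      using \<Lambda> by (simp add: l_def field_simps)
    also have "\<dots> = \<Lambda> * (s' - s)" using \<zeta>(2)[of s] \<zeta>(2)[of s'] s by simp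
    finally show "(\<zeta> s' - \<zeta> s) + (\<nu> (\<zeta> s') - \<nu> (\<zeta> s)) = (b - a + (\<nu> b - \<nu> a)) * (s' - s)"
      unfolding \<Lambda>_def .
  qed
qed

section \<open>Borel representatives, and pointwise limits from the mode of convergence\<close>

lemma lebesgue_measurable_eq_borel_ae:
  fixes h :: "'a::euclidean_space \<Rightarrow> 'e::euclidean_space"
  assumes "h \<in> borel_measurable lebesgue"
  obtains w where "w \<in> borel_measurable borel" "AE t in lebesgue. w t = h t"
proof -
  have "\<exists>wi. wi \<in> borel_measurable borel \<and> (AE t in lebesgue. h t \<bullet> i = wi t)" for i
  proof -
    have "(\<lambda>t. h t \<bullet> i) \<in> borel_measurable (completion lborel)" using assms by measurable
    then obtain wi where "wi \<in> borel_measurable lborel" "AE t in lborel. h t \<bullet> i = wi t"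
      using completion_ex_borel_measurable_real by blast
    then show ?thesis by (intro exI[of _ wi]) (auto intro: AE_completion)
  qed
  then obtain wi where wi: "\<And>i. wi i \<in> borel_measurable borel" "\<And>i. AE t in lebesgue. h t \<bullet> i = wi i t" by metis
  show ?thesis
  proof (rule that)
    show "(\<lambda>t. \<Sum>i\<in>Basis. wi i t *\<^sub>R i) \<in> borel_measurable borel"
      using wi(1) by measurable
    have "AE t in lebesgue. \<forall>i\<in>Basis. h t \<bullet> i = wi i t"
      using wi(2) by (subst AE_ball_countable) (auto intro: countable_finite)
    then show "AE t in lebesgue. (\<Sum>i\<in>Basis. wi i t *\<^sub>R i) = h t"
    proof eventually_elim
      case (elim t)
      then have "(\<Sum>i\<in>Basis. wi i t *\<^sub>R i) = (\<Sum>i\<in>Basis. (h t \<bullet> i) *\<^sub>R i)" by (intro sum.cong) auto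
      then show ?case by (simp only: euclidean_representation)
    qed
  qed
qed

lemma L1_maps_imp_measurable:
  "v \<in> L1_maps {a..b} V \<Longrightarrow> v \<in> borel_measurable (lebesgue_on {a..b})"
  using absolutely_integrable_measurable[of "{a..b}" v] by (simp add: L1_maps_def)

lemma borel_representative_exists:
  assumes ab: "a \<le> b" and V: "closed V" and v: "v \<in> L1_maps {a..b} V"
  obtains w where "borel_representative a b V v w"
proof -
  have vV: "v t \<in> V" if "t \<in> {a..b}" for t using v that by (auto simp: L1_maps_def)
  have vm: "v \<in> borel_measurable (lebesgue_on {a..b})"
    by (rule L1_maps_imp_measurable[OF v])
  have "(\<lambda>t. if t \<in> {a..b} then v t else 0) \<in> borel_measurable lebesgue"
    using vm by (subst borel_measurable_if) auto
  then obtain w0 where w0: "w0 \<in> borel_measurable borel" "AE t in lebesgue. w0 t = (if t \<in> {a..b} then v t else 0)"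
    by (rule lebesgue_measurable_eq_borel_ae)
  \<comment> \<open>On \<open>{a..b}\<close>, \<open>w0\<close> takes values in \<open>V\<close>
    outside a null set; elsewhere it is redirected to the point \<open>v a\<close>, and closedness
    of \<open>V\<close> keeps the result Borel.\<close>
  define w where "w = (\<lambda>t. if w0 t \<in> V then w0 t else v a)"
  have "{t. w0 t \<in> V} \<in> sets borel"
    using measurable_sets[OF w0(1), of V] V by (simp add: vimage_def borel_closed)
  then have "w \<in> borel_measurable borel" unfolding w_def using w0(1) by (intro measurable_If) auto
  then have "w \<in> borel_measurable (restrict_space borel {a..b})" by (rule measurable_restrict_space1)
  moreover have "w ` {a..b} \<subseteq> V" using vV[of a] ab by (auto simp: w_def)
  moreover have "AE t in lebesgue. t \<in> {a..b} \<longrightarrow> w t = v t"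
    using w0(2) by eventually_elim (use vV in \<open>auto simp: w_def\<close>)
  then have "AE t in lebesgue_on {a..b}. w t = v t" by (simp add: AE_restrict_space_iff)
  ultimately show ?thesis using that by (auto simp: borel_representative_def)
qed

lemma L1_norm_nonneg: "0 \<le> L1_norm S h"
  unfolding L1_norm_def set_lebesgue_integral_def by (intro integral_nonneg_AE) auto

lemma tendsto_at_and_L1_imp_tendsto:
  assumes "tendsto_at_and_L1 S \<tau> wk w"
  shows "(\<lambda>k. wk k \<tau>) \<longlonglongrightarrow> w \<tau>"
proof -
  have "(\<lambda>k. norm (wk k \<tau> - w \<tau>) + L1_norm S (\<lambda>t. wk k t - w t)) \<longlonglongrightarrow> 0"
    using assms by (simp add: tendsto_at_and_L1_def)
  then have "(\<lambda>k. norm (wk k \<tau> - w \<tau>)) \<longlonglongrightarrow> 0"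
    by (rule tendsto_sandwich[OF _ _ tendsto_const, rotated 2]) (auto simp: L1_norm_nonneg)
  then show ?thesis by (simp add: LIM_zero_iff tendsto_norm_zero_iff)
qed

context control_system
begin

lemma tendsto_control_term:
  assumes "(X \<longlongrightarrow> x) F" "(w \<longlongrightarrow> w0) F"
  shows "((\<lambda>k. control_term g (X k) (w k)) \<longlongrightarrow> control_term g x w0) F"
proof -
  have "isCont (g \<alpha>) x" for \<alpha>
    using g_C1[of \<alpha>] unfolding C1_map_def by (meson has_derivative_continuous)
  then show ?thesis unfolding control_term_def
    by (intro tendsto_sum tendsto_scaleR tendsto_vec_nth assms isCont_tendsto_compose[OF _ assms(1)])
qed

lemma BV_simple_limit_solution_imp_gc_solution:
  assumes lim: "BV_simple_limit_solution f g a b U xbar u v x"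
    and V: "closed V" and v: "v \<in> L1_maps {a..b} V"
  shows "gc_solution f g a b U V xbar u v x"
proof -
  have ab: "a \<le> b" using a_less_b by simp
  obtain uk K where uk: "\<And>k. uk k \<in> AC_maps {a..b} U" and tv: "\<And>k. total_variation a b (uk k) \<le> ennreal K"
    and app: "\<And>\<tau>. \<tau> \<in> {a..b} \<Longrightarrow> approximates_at f g a b xbar u v x \<tau> uk"
    using lim unfolding BV_simple_limit_solution_def by blast
  have uk_ac: "abs_continuous_on {a..b} (uk k)" and ukU: "\<And>t. t \<in> {a..b} \<Longrightarrow> uk k t \<in> U" for k
    using uk[of k] by (auto simp: AC_maps_def)
  have vV: "v t \<in> V" if "t \<in> {a..b}" for t using v that by (auto simp: L1_maps_def)
  have vm: "v \<in> borel_measurable (lebesgue_on {a..b})"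
    by (rule L1_maps_imp_measurable[OF v])
  have "\<exists>\<nu>. abs_continuous_on {a..b} \<nu> \<and>
    (\<forall>s t. a \<le> s \<longrightarrow> s \<le> t \<longrightarrow> t \<le> b \<longrightarrow> norm (uk k t - uk k s) \<le> \<nu> t - \<nu> s) \<and> \<nu> b - \<nu> a \<le> max 0 K" for k
    using dominating_abs_continuous_function[OF ab uk_ac tv] by metis
  then obtain \<nu> where \<nu>: "\<And>k. abs_continuous_on {a..b} (\<nu> k)"
    "\<And>k s t. a \<le> s \<Longrightarrow> s \<le> t \<Longrightarrow> t \<le> b \<Longrightarrow> norm (uk k t - uk k s) \<le> \<nu> k t - \<nu> k s"
    "\<And>k. \<nu> k b - \<nu> k a \<le> max 0 K" by metis
  have \<nu>_mono: "\<nu> k s \<le> \<nu> k t" if "a \<le> s" "s \<le> t" "t \<le> b" for k s t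
    using \<nu>(2)[OF that, of k] norm_ge_zero[of "uk k t - uk k s"] by linarith
  \<comment> \<open>The trajectories belonging to \<open>\<tau> = a\<close> are fixed; those for
    other \<open>\<tau>\<close> coincide with them by uniqueness.\<close>
  obtain X C where sol: "\<And>k. caratheodory_solution f g a b xbar (uk k) v (X k)"
    and C: "\<And>k t. t \<in> {a..b} \<Longrightarrow> norm (X k t) \<le> C"
  proof -
    have "a \<in> {a..b}" using ab by simp
    from app[OF this] show ?thesis using that unfolding approximates_at_def by blast
  qed
  have conv: "(\<lambda>k. uk k \<tau>) \<longlonglongrightarrow> u \<tau>" "(\<lambda>k. X k \<tau>) \<longlonglongrightarrow> x \<tau>" if \<tau>: "\<tau> \<in> {a..b}" for \<tau>
  proof -
    obtain Y where Y: "\<And>k. caratheodory_solution f g a b xbar (uk k) v (Y k)"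
      "tendsto_at_and_L1 {a..b} \<tau> (\<lambda>k t. (Y k t, uk k t)) (\<lambda>t. (x t, u t))"
      using app[OF \<tau>] unfolding approximates_at_def by blast
    have "Y k \<tau> = X k \<tau>" for k
      by (rule caratheodory_solution_unique[OF Y(1) sol \<nu>(1) \<nu>(2)]) (use ukU vV \<tau> in auto)
    then have "(\<lambda>k. (X k \<tau>, uk k \<tau>)) \<longlonglongrightarrow> (x \<tau>, u \<tau>)"
      using tendsto_at_and_L1_imp_tendsto[OF Y(2)] by simp
    from tendsto_snd[OF this] tendsto_fst[OF this]
    show "(\<lambda>k. uk k \<tau>) \<longlonglongrightarrow> u \<tau>" "(\<lambda>k. X k \<tau>) \<longlonglongrightarrow> x \<tau>" by simp_all
  qed
  have XC: "X k t \<in> cball 0 C" if "t \<in> {a..b}" for k t using C[OF that] by simp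
  obtain B where "local_bound C B" using local_bound_exists by blast
  note B = local_boundD(1,2,4,5)[OF this]
  have X_ac: "abs_continuous_on {a..b} (X k)" and X_a: "X k a = xbar" for k
    using sol[of k] by (auto simp: caratheodory_solution_def)
  note cont_meas = continuous_imp_measurable_on_sets_lebesgue[OF abs_continuous_on_imp_continuous_on]
  define F where "F = (\<lambda>k r. f r (X k r) (uk k r) (v r))"
  define F0 where "F0 = (\<lambda>r. f r (x r) (u r) (v r))"
  have Fm: "F k \<in> borel_measurable (lebesgue_on {a..b})" for k
    unfolding F_def by (intro drift_measurable cont_meas X_ac uk_ac vm vV) auto
  have FB: "norm (F k r) \<le> B" if "r \<in> {a..b}" for k r
    unfolding F_def using that XC ukU vV by (intro B(2)) auto
  have Flim: "(\<lambda>k. F k r) \<longlonglongrightarrow> F0 r" if r: "r \<in> {a..b}" for r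
  proof -
    have "(\<lambda>k. (\<lambda>(x, u, v). f r x u v) (X k r, uk k r, v r)) \<longlonglongrightarrow> (\<lambda>(x, u, v). f r x u v) (x r, u r, v r)"
    proof (rule continuous_on_tendsto_compose[OF f_continuous[OF r]])
      show "(\<lambda>k. (X k r, uk k r, v r)) \<longlonglongrightarrow> (x r, u r, v r)"
        using conv[OF r] by (intro tendsto_Pair tendsto_const)
    qed (use vV[OF r] in auto)
    then show ?thesis by (simp add: F_def F0_def)
  qed
  \<comment> \<open>\<open>x\<close> and \<open>u\<close> may be discontinuous; measurability and
    the bound of \<open>F0\<close> come from the approximations.\<close>
  have F0m: "F0 \<in> borel_measurable (lebesgue_on {a..b})"
    by (rule borel_measurable_LIMSEQ_metric[where f=F]) (use Fm Flim in auto)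
  have F0B: "norm (F0 r) \<le> B" if "r \<in> {a..b}" for r
    by (rule LIMSEQ_le_const2[OF tendsto_norm[OF Flim[OF that]]]) (use FB[OF that] in auto)
  have Fint: "F k absolutely_integrable_on {a..b}" for k
    by (rule bounded_measurable_absolutely_integrable[OF Fm FB])
  have F0int: "F0 absolutely_integrable_on {a..b}"
    by (rule bounded_measurable_absolutely_integrable[OF F0m F0B])
  define H where "H = (\<lambda>k t. integral {a..t} (F k))"
  define H0 where "H0 = (\<lambda>t. integral {a..t} F0)"
  have Hlip: "norm (H k t - H k s) \<le> B * (t - s)" if "a \<le> s" "s \<le> t" "t \<le> b" for k s t
    unfolding H_def by (rule integral_lipschitz[OF Fint FB that])
  \<comment> \<open>Only integrals of the drift have to converge, so pointwise convergence of inputs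
    and trajectories suffices.\<close>
  have Hlim: "(\<lambda>k. H k t) \<longlonglongrightarrow> H0 t" if t: "t \<in> {a..b}" for t
    unfolding H_def H0_def
  proof (rule dominated_convergence(2)[where h="\<lambda>_. B"])
    show "F k integrable_on {a..t}" for k
      by (rule integrable_subinterval_real[OF set_lebesgue_integral_eq_integral(1)[OF Fint]]) (use t in auto)
    show "norm (F k r) \<le> B" if "r \<in> {a..t}" for k r using FB[of r k] that t by auto
    show "(\<lambda>k. F k r) \<longlonglongrightarrow> F0 r" if "r \<in> {a..t}" for r using Flim[of r] that t by auto
  qed auto
  have Hac: "abs_continuous_on {a..b} (H k)" for k
    by (rule abs_continuous_on_lipschitz[of _ _ B]) (use Hlip in auto)
  have X_sew: "norm (X k t - X k s) \<le> B * (t - s) + B * (\<nu> k t - \<nu> k s)"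
      "norm (X k t - X k s - (H k t - H k s) - control_term g (X k s) (uk k t - uk k s))
        \<le> B * (B * (t - s) + B * (\<nu> k t - \<nu> k s)) * (\<nu> k t - \<nu> k s)"
    if st: "a \<le> s" "s \<le> t" "t \<le> b" for k s t
  proof -
    obtain N where N: "negligible N" "\<And>t. t \<in> {a..b} - N \<Longrightarrow> \<exists>u'. (uk k has_vector_derivative u') (at t within {a..b}) \<and>
        (X k has_vector_derivative f t (X k t) (uk k t) (v t) + control_term g (X k t) u') (at t within {a..b})"
      using caratheodory_solution_derivatives[OF sol \<nu>(1) \<nu>(2)] by blast
    let ?N = "N \<union> {t \<in> {a..b}. \<not> (H k has_vector_derivative F k t) (at t within {a..b})}"
    have N': "negligible ?N"
      unfolding H_def using N(1) indefinite_integral_has_vector_derivative_ae set_lebesgue_integral_eq_integral(1)[OF Fint]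
      by (intro negligible_Un) auto
    have der: "\<exists>\<phi>' u'. (H k has_vector_derivative \<phi>') (at t within {a..b}) \<and>
        (uk k has_vector_derivative u') (at t within {a..b}) \<and>
        (X k has_vector_derivative \<phi>' + control_term g (X k t) u') (at t within {a..b})"
      if t: "t \<in> {a..b} - ?N" for t
    proof -
      have "(H k has_vector_derivative F k t) (at t within {a..b})" using t by blast
      moreover have "t \<in> {a..b} - N" using t by blast
      ultimately show ?thesis using N(2)[of t] unfolding F_def by blast
    qed
    show "norm (X k t - X k s) \<le> B * (t - s) + B * (\<nu> k t - \<nu> k s)"
      by (rule sewing_estimate_lipschitz[where p=a and q=b and X="X k" and \<Phi>="H k" and u="uk k" and N="?N" and \<Gamma>="control_term g" and \<nu>="\<nu> k" and M=B and B=B and L=B and s=s and t=t])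
        (fact X_ac Hac uk_ac N' bounded_linear_control_term der \<nu>(2) Hlip B(1) st | use B(3,4) XC in blast)+
    show "norm (X k t - X k s - (H k t - H k s) - control_term g (X k s) (uk k t - uk k s))
        \<le> B * (B * (t - s) + B * (\<nu> k t - \<nu> k s)) * (\<nu> k t - \<nu> k s)"
      by (rule sewing_estimate_quadratic[where p=a and q=b and X="X k" and \<Phi>="H k" and u="uk k" and N="?N" and \<Gamma>="control_term g" and \<nu>="\<nu> k" and M=B and B=B and L=B and s=s and t=t])
        (fact X_ac Hac uk_ac N' bounded_linear_control_term der \<nu>(2) Hlip B(1) st | use B(3,4) XC in blast)+
  qed

  \<comment> \<open>Arc-length parametrization with bounds uniform in \<open>k\<close>\<close>
  define \<Lambda> where "\<Lambda> = b - a + max 0 K"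
  have \<Lambda>0: "0 \<le> \<Lambda>" using ab by (simp add: \<Lambda>_def)
  have "\<exists>\<zeta> l. \<zeta> 0 = a \<and> (\<forall>s\<in>{0..1}. \<zeta> s \<in> {a..b}) \<and> (\<forall>t\<in>{a..b}. l t \<in> {0..1} \<and> \<zeta> (l t) = t) \<and>
    (\<forall>s s'. 0 \<le> s \<longrightarrow> s \<le> s' \<longrightarrow> s' \<le> 1 \<longrightarrow> \<zeta> s \<le> \<zeta> s' \<and>
       (\<zeta> s' - \<zeta> s) + (\<nu> k (\<zeta> s') - \<nu> k (\<zeta> s)) = (b - a + (\<nu> k b - \<nu> k a)) * (s' - s))" for k
    by (rule arclength_parametrization[OF a_less_b abs_continuous_on_imp_continuous_on[OF \<nu>(1)]]) (rule \<nu>_mono)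
  then obtain \<zeta> l where \<zeta>: "\<And>k. \<zeta> k 0 = a" "\<And>k s. s \<in> {0..1} \<Longrightarrow> \<zeta> k s \<in> {a..b}"
    "\<And>k t. t \<in> {a..b} \<Longrightarrow> l k t \<in> {0..1} \<and> \<zeta> k (l k t) = t"
    "\<And>k s s'. 0 \<le> s \<Longrightarrow> s \<le> s' \<Longrightarrow> s' \<le> 1 \<Longrightarrow> \<zeta> k s \<le> \<zeta> k s' \<and>
       (\<zeta> k s' - \<zeta> k s) + (\<nu> k (\<zeta> k s') - \<nu> k (\<zeta> k s)) = (b - a + (\<nu> k b - \<nu> k a)) * (s' - s)"
    by metis
  have incr: "0 \<le> \<zeta> k s' - \<zeta> k s" "0 \<le> \<nu> k (\<zeta> k s') - \<nu> k (\<zeta> k s)"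
    "(\<zeta> k s' - \<zeta> k s) + (\<nu> k (\<zeta> k s') - \<nu> k (\<zeta> k s)) \<le> \<Lambda> * (s' - s)"
    if "0 \<le> s" "s \<le> s'" "s' \<le> 1" for k s s'
  proof -
    note z = \<zeta>(4)[OF that, of k]
    show "0 \<le> \<zeta> k s' - \<zeta> k s" using z by simp
    show "0 \<le> \<nu> k (\<zeta> k s') - \<nu> k (\<zeta> k s)"
      using \<nu>_mono[of "\<zeta> k s" "\<zeta> k s'" k] \<zeta>(2)[of s k] \<zeta>(2)[of s' k] z that by auto
    \<comment> \<open>The speeds of the parametrizations depend on \<open>k\<close>; the common
      bound on the variations majorizes them all by \<open>\<Lambda>\<close>.\<close>
    have "(b - a + (\<nu> k b - \<nu> k a)) * (s' - s) \<le> \<Lambda> * (s' - s)"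
      unfolding \<Lambda>_def using \<nu>(3)[of k] that by (intro mult_right_mono) auto
    then show "(\<zeta> k s' - \<zeta> k s) + (\<nu> k (\<zeta> k s') - \<nu> k (\<zeta> k s)) \<le> \<Lambda> * (s' - s)" using z by simp
  qed
  have \<zeta>_incr: "\<bar>\<zeta> k s' - \<zeta> k s\<bar> \<le> \<Lambda> * (s' - s)" "norm (uk k (\<zeta> k s') - uk k (\<zeta> k s)) \<le> \<Lambda> * (s' - s)"
    "norm (X k (\<zeta> k s') - X k (\<zeta> k s)) \<le> B * \<Lambda> * (s' - s)"
    "norm (X k (\<zeta> k s') - X k (\<zeta> k s) - (H k (\<zeta> k s') - H k (\<zeta> k s))
       - control_term g (X k (\<zeta> k s)) (uk k (\<zeta> k s') - uk k (\<zeta> k s))) \<le> (B * \<Lambda>)\<^sup>2 * (s' - s)\<^sup>2"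
    if s: "0 \<le> s" "s \<le> s'" "s' \<le> 1" for k s s'
  proof -
    note i = incr[OF s, of k]
    have z: "a \<le> \<zeta> k s" "\<zeta> k s \<le> \<zeta> k s'" "\<zeta> k s' \<le> b" using \<zeta>(2)[of s k] \<zeta>(2)[of s' k] i(1) s by auto
    show "\<bar>\<zeta> k s' - \<zeta> k s\<bar> \<le> \<Lambda> * (s' - s)" using i by linarith
    show "norm (uk k (\<zeta> k s') - uk k (\<zeta> k s)) \<le> \<Lambda> * (s' - s)" using \<nu>(2)[OF z, of k] i by linarith
    have le: "B * (\<zeta> k s' - \<zeta> k s) + B * (\<nu> k (\<zeta> k s') - \<nu> k (\<zeta> k s)) \<le> B * \<Lambda> * (s' - s)"
      using mult_left_mono[OF i(3) B(1)] by (simp add: algebra_simps)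
    then show "norm (X k (\<zeta> k s') - X k (\<zeta> k s)) \<le> B * \<Lambda> * (s' - s)" using X_sew(1)[OF z, of k] by linarith
    \<comment> \<open>Each increment in the product is at most a multiple of \<open>s' - s\<close>,
      so the error becomes quadratic in the new parameter with a constant independent of
      \<open>k\<close>.\<close>
    have "B * (B * (\<zeta> k s' - \<zeta> k s) + B * (\<nu> k (\<zeta> k s') - \<nu> k (\<zeta> k s))) * (\<nu> k (\<zeta> k s') - \<nu> k (\<zeta> k s))
       \<le> B * (B * \<Lambda> * (s' - s)) * (\<Lambda> * (s' - s))"
      using le i B(1) \<Lambda>0 s by (intro mult_mono mult_left_mono mult_nonneg_nonneg add_nonneg_nonneg) auto
    also have "\<dots> = (B * \<Lambda>)\<^sup>2 * (s' - s)\<^sup>2" by (simp add: power2_eq_square)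
    finally show "norm (X k (\<zeta> k s') - X k (\<zeta> k s) - (H k (\<zeta> k s') - H k (\<zeta> k s))
       - control_term g (X k (\<zeta> k s)) (uk k (\<zeta> k s') - uk k (\<zeta> k s))) \<le> (B * \<Lambda>)\<^sup>2 * (s' - s)\<^sup>2"
      using X_sew(2)[OF z, of k] by linarith
  qed

  \<comment> \<open>Uniform limit of a subsequence of the reparametrized triples\<close>
  obtain CU where CU: "\<And>u. u \<in> U \<Longrightarrow> norm u \<le> CU" using compact_imp_bounded[OF compact_U] unfolding bounded_iff by blast
  define FF where "FF = (\<lambda>k s. (\<zeta> k s, uk k (\<zeta> k s), X k (\<zeta> k s)))"
  \<comment> \<open>The sum of the Lipschitz constants of time, input and trajectory.\<close>
  define \<Lambda>' where "\<Lambda>' = \<Lambda> + (\<Lambda> + B * \<Lambda>)"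
  have FF_bound: "norm (FF k s) \<le> (\<bar>a\<bar> + \<bar>b\<bar>) + (CU + C)" if "s \<in> {0..1}" for k s
  proof -
    note z = \<zeta>(2)[OF that, of k]
    have "norm (uk k (\<zeta> k s), X k (\<zeta> k s)) \<le> CU + C"
      using norm_Pair_le[of "uk k (\<zeta> k s)" "X k (\<zeta> k s)"] CU[OF ukU[OF z]] C[OF z, of k] by (meson add_mono order_trans)
    moreover have "\<bar>\<zeta> k s\<bar> \<le> \<bar>a\<bar> + \<bar>b\<bar>" using z by auto
    ultimately show ?thesis
      unfolding FF_def using norm_Pair_le[of "\<zeta> k s" "(uk k (\<zeta> k s), X k (\<zeta> k s))"] by simp
  qed
  have FF_lip: "norm (FF k s' - FF k s) \<le> \<Lambda>' * (s' - s)" if s: "0 \<le> s" "s \<le> s'" "s' \<le> 1" for k s s'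
  proof -
    have "norm (FF k s' - FF k s) \<le> norm (\<zeta> k s' - \<zeta> k s) + (norm (uk k (\<zeta> k s') - uk k (\<zeta> k s)) + norm (X k (\<zeta> k s') - X k (\<zeta> k s)))"
      unfolding FF_def diff_Pair by (intro order_trans[OF norm_Pair_le] add_left_mono norm_Pair_le)
    also have "\<dots> \<le> \<Lambda> * (s' - s) + (\<Lambda> * (s' - s) + B * \<Lambda> * (s' - s))"
      using \<zeta>_incr(1-3)[OF s, of k] by (intro add_mono) auto
    finally show ?thesis by (simp add: \<Lambda>'_def algebra_simps)
  qed
  have \<Lambda>'0: "0 \<le> \<Lambda>'" using \<Lambda>0 B(1) by (simp add: \<Lambda>'_def)
  have FF_lip': "norm (FF k s - FF k s') \<le> \<Lambda>' * \<bar>s - s'\<bar>" if "s \<in> {0..1}" "s' \<in> {0..1}" for k s s'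
    using FF_lip[of s s' k] FF_lip[of s' s k] that by (cases "s \<le> s'") (auto simp: norm_minus_commute)
  obtain G and r :: "nat \<Rightarrow> nat" where G: "continuous_on {0..1} G" and r: "strict_mono r"
    and unif: "\<And>e. 0 < e \<Longrightarrow> \<exists>N. \<forall>n s. n \<ge> N \<and> s \<in> {0..1} \<longrightarrow> norm (FF (r n) s - G s) < e"
  proof (rule Arzela_Ascoli[of "{0..1::real}" FF, OF compact_Icc])
    show "norm (FF k s) \<le> (\<bar>a\<bar> + \<bar>b\<bar>) + (CU + C)" if "s \<in> {0..1}" for k s by (rule FF_bound[OF that])
  next
    fix s e :: real assume s: "s \<in> {0..1}" "0 < e"
    show "\<exists>d>0. \<forall>n y. y \<in> {0..1} \<and> norm (s - y) < d \<longrightarrow> norm (FF n s - FF n y) < e"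
    proof (intro exI[of _ "e / (\<Lambda>' + 1)"] conjI allI impI)
      show "0 < e / (\<Lambda>' + 1)" using s \<Lambda>'0 by simp
      fix n y assume y: "y \<in> {0..1} \<and> norm (s - y) < e / (\<Lambda>' + 1)"
      have "norm (FF n s - FF n y) \<le> \<Lambda>' * \<bar>s - y\<bar>" using FF_lip' s y by blast
      also have "\<dots> \<le> (\<Lambda>' + 1) * \<bar>s - y\<bar>" by (simp add: algebra_simps)
      also have "\<dots> < e" using y \<Lambda>'0 by (simp add: field_simps)
      finally show "norm (FF n s - FF n y) < e" .
    qed
  next
    fix G and r :: "nat \<Rightarrow> nat" assume "continuous_on {0..1} G" "strict_mono r"
      "\<And>e. 0 < e \<Longrightarrow> \<exists>N. \<forall>n s. n \<ge> N \<and> s \<in> {0..1} \<longrightarrow> norm (FF (r n) s - G s) < e"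
    show thesis by (rule that) fact+
  qed
  \<comment> \<open>The arguments may move with \<open>n\<close>; this is needed at the arc lengths
    \<open>l k t\<close>, which change with \<open>k\<close>.\<close>
  have FF_conv: "(\<lambda>n. FF (r (q n)) (s n)) \<longlonglongrightarrow> G l"
    if q: "filterlim q at_top sequentially" and s: "\<And>n. s n \<in> {0..1}" "s \<longlonglongrightarrow> l" "l \<in> {0..1}" for q s l
  proof -
    have "(\<lambda>n. FF (r (q n)) (s n) - G (s n)) \<longlonglongrightarrow> 0"
    proof (rule LIMSEQ_I)
      fix e :: real assume "0 < e"
      then obtain N where N: "\<And>n s. n \<ge> N \<Longrightarrow> s \<in> {0..1} \<Longrightarrow> norm (FF (r n) s - G s) < e" using unif by blast
      obtain M where "\<And>n. n \<ge> M \<Longrightarrow> q n \<ge> N"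
        using q unfolding filterlim_at_top eventually_sequentially by blast
      then show "\<exists>no. \<forall>n\<ge>no. norm (FF (r (q n)) (s n) - G (s n) - 0) < e" using N s(1) by (intro exI[of _ M]) auto
    qed
    moreover have "(\<lambda>n. G (s n)) \<longlonglongrightarrow> G l"
      by (rule continuous_on_tendsto_compose[OF G s(2,3)]) (use s(1) in auto)
    ultimately have "(\<lambda>n. (FF (r (q n)) (s n) - G (s n)) + G (s n)) \<longlonglongrightarrow> 0 + G l" by (rule tendsto_add)
    then show ?thesis by simp
  qed
  define \<phi>0 where "\<phi>0 = (\<lambda>s. fst (G s))"
  define \<phi> where "\<phi> = (\<lambda>s. fst (snd (G s)))"
  define y where "y = (\<lambda>s. snd (snd (G s)))"
  have pw: "(\<lambda>n. FF (r n) s) \<longlonglongrightarrow> G s" if "s \<in> {0..1}" for s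
    using FF_conv[of "\<lambda>n. n" "\<lambda>_. s" s] that by (simp add: filterlim_ident)
  have pw3: "(\<lambda>n. \<zeta> (r n) s) \<longlonglongrightarrow> \<phi>0 s" "(\<lambda>n. uk (r n) (\<zeta> (r n) s)) \<longlonglongrightarrow> \<phi> s" "(\<lambda>n. X (r n) (\<zeta> (r n) s)) \<longlonglongrightarrow> y s"
    if "s \<in> {0..1}" for s
    using tendsto_fst[OF pw[OF that]] tendsto_fst[OF tendsto_snd[OF pw[OF that]]] tendsto_snd[OF tendsto_snd[OF pw[OF that]]]
    by (simp_all add: FF_def \<phi>0_def \<phi>_def y_def)
  have \<phi>0_in: "\<phi>0 s \<in> {a..b}" if "s \<in> {0..1}" for s
    by (rule closed_sequentially[OF closed_atLeastAtMost _ pw3(1)[OF that]]) (use \<zeta>(2) that in auto)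
  have \<phi>_in: "\<phi> s \<in> U" if "s \<in> {0..1}" for s
    by (rule closed_sequentially[OF compact_imp_closed[OF compact_U] _ pw3(2)[OF that]]) (use \<zeta>(2) ukU that in auto)
  have y_in: "y s \<in> cball 0 C" if "s \<in> {0..1}" for s
    by (rule closed_sequentially[OF closed_cball _ pw3(3)[OF that]]) (use \<zeta>(2) XC that in auto)
  have G_lip: "norm (G s' - G s) \<le> \<Lambda>' * (s' - s)" if s: "0 \<le> s" "s \<le> s'" "s' \<le> 1" for s s'
    by (rule LIMSEQ_le_const2[OF tendsto_norm[OF tendsto_diff[OF pw pw]]]) (use FF_lip[OF s] s in auto)
  have \<phi>0_mono: "\<phi>0 s \<le> \<phi>0 s'" if s: "0 \<le> s" "s \<le> s'" "s' \<le> 1" for s s'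
    by (rule LIMSEQ_le[OF pw3(1) pw3(1)]) (use \<zeta>(4)[OF s] s in auto)
  have comp_lip: "\<bar>\<phi>0 s' - \<phi>0 s\<bar> \<le> \<Lambda>' * (s' - s)" "norm (\<phi> s' - \<phi> s) \<le> \<Lambda>' * (s' - s)" "norm (y s' - y s) \<le> \<Lambda>' * (s' - s)"
    if s: "0 \<le> s" "s \<le> s'" "s' \<le> 1" for s s'
  proof -
    have p: "norm (fst z) \<le> norm z" "norm (fst (snd z)) \<le> norm z" "norm (snd (snd z)) \<le> norm z" for z :: "real \<times> (real^'m) \<times> (real^'n)"
      using norm_fst_le[of "fst z" "snd z"] norm_snd_le[of "snd z" "fst z"]
        norm_fst_le[of "fst (snd z)" "snd (snd z)"] norm_snd_le[of "snd (snd z)" "fst (snd z)"] by auto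
    show "\<bar>\<phi>0 s' - \<phi>0 s\<bar> \<le> \<Lambda>' * (s' - s)" "norm (\<phi> s' - \<phi> s) \<le> \<Lambda>' * (s' - s)" "norm (y s' - y s) \<le> \<Lambda>' * (s' - s)"
      using p[of "G s' - G s"] G_lip[OF s] by (auto simp: \<phi>0_def \<phi>_def y_def)
  qed

  \<comment> \<open>A clock for the limit\<close>
  have "\<exists>s. s \<in> {0..1} \<and> \<phi>0 s = t \<and> \<phi> s = u t \<and> y s = x t" if t: "t \<in> {a..b}" for t
  proof -
    have "\<forall>n. l (r n) t \<in> {0..1}" using \<zeta>(3)[OF t] by blast
    then obtain s q where s: "s \<in> {0..1}" and q: "strict_mono q" "((\<lambda>n. l (r n) t) \<circ> q) \<longlonglongrightarrow> s"
      using compact_imp_seq_compact[OF compact_Icc, of 0 "1::real"] unfolding seq_compact_def by meson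
    \<comment> \<open>At its own arc length of \<open>t\<close> each triple equals
      \<open>(t, uk k t, X k t)\<close>, whose limit is \<open>(t, u t, x t)\<close>; uniform
      convergence identifies it with \<open>G s\<close>.\<close>
    have "(\<lambda>n. FF (r (q n)) (l (r (q n)) t)) \<longlonglongrightarrow> G s"
      by (rule FF_conv[OF filterlim_subseq[OF q(1)]]) (use \<zeta>(3)[OF t] q(2) s in \<open>auto simp: o_def\<close>)
    moreover have "FF k (l k t) = (t, uk k t, X k t)" for k using \<zeta>(3)[OF t, of k] by (simp add: FF_def)
    moreover have "(\<lambda>n. (t, uk (r (q n)) t, X (r (q n)) t)) \<longlonglongrightarrow> (t, u t, x t)"
      using LIMSEQ_subseq_LIMSEQ[OF conv(1)[OF t] strict_mono_o[OF r q(1)]]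
        LIMSEQ_subseq_LIMSEQ[OF conv(2)[OF t] strict_mono_o[OF r q(1)]]
      by (intro tendsto_Pair tendsto_const) (auto simp: o_def)
    ultimately have "G s = (t, u t, x t)" using LIMSEQ_unique by fastforce
    then show ?thesis using s by (intro exI[of _ s]) (simp add: \<phi>0_def \<phi>_def y_def)
  qed
  then obtain \<sigma> where \<sigma>: "\<And>t. t \<in> {a..b} \<Longrightarrow> \<sigma> t \<in> {0..1} \<and> \<phi>0 (\<sigma> t) = t \<and> \<phi> (\<sigma> t) = u t \<and> y (\<sigma> t) = x t"
    by metis
  have img: "\<phi>0 ` {0..1} = {a..b}"
  proof
    show "\<phi>0 ` {0..1} \<subseteq> {a..b}" using \<phi>0_in by blast
    show "{a..b} \<subseteq> \<phi>0 ` {0..1}" using \<sigma> by (metis image_eqI subsetI)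
  qed
  have mono: "mono_on {0..1} \<phi>0" by (rule mono_onI) (use \<phi>0_mono in auto)

  \<comment> \<open>The increment estimate and the differential equation for the limit\<close>
  have quad: "norm (y s' - y s - (H0 (\<phi>0 s') - H0 (\<phi>0 s)) - control_term g (y s) (\<phi> s' - \<phi> s)) \<le> (B * \<Lambda>)\<^sup>2 * (s' - s)\<^sup>2"
    if s: "0 \<le> s" "s \<le> s'" "s' \<le> 1" for s s'
  proof -
    \<comment> \<open>\<open>H (r n)\<close> is evaluated at moving times; the common Lipschitz
      constant \<open>B\<close> reduces this to the pointwise limit at
      \<open>\<phi>0 t\<close>.\<close>
    have Hc: "(\<lambda>n. H (r n) (\<zeta> (r n) t)) \<longlonglongrightarrow> H0 (\<phi>0 t)" if t: "t \<in> {0..1}" for t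
    proof -
      have bnd: "norm (H (r n) (\<zeta> (r n) t) - H (r n) (\<phi>0 t)) \<le> B * \<bar>\<zeta> (r n) t - \<phi>0 t\<bar>" for n
        using Hlip[of "\<zeta> (r n) t" "\<phi>0 t" "r n"] Hlip[of "\<phi>0 t" "\<zeta> (r n) t" "r n"] \<phi>0_in[OF t] \<zeta>(2)[OF t, of "r n"]
        by (cases "\<phi>0 t \<le> \<zeta> (r n) t") (auto simp: norm_minus_commute)
      have lim0: "(\<lambda>n. B * \<bar>\<zeta> (r n) t - \<phi>0 t\<bar>) \<longlonglongrightarrow> 0"
        using pw3(1)[OF t] by (intro tendsto_mult_right_zero tendsto_rabs_zero) (simp add: LIM_zero)
      have "(\<lambda>n. H (r n) (\<zeta> (r n) t) - H (r n) (\<phi>0 t)) \<longlonglongrightarrow> 0"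
        by (rule Lim_null_comparison[OF always_eventually lim0]) (use bnd in blast)
      moreover have "(\<lambda>n. H (r n) (\<phi>0 t)) \<longlonglongrightarrow> H0 (\<phi>0 t)"
        using LIMSEQ_subseq_LIMSEQ[OF Hlim[OF \<phi>0_in[OF t]] r] by (simp add: o_def)
      ultimately have "(\<lambda>n. (H (r n) (\<zeta> (r n) t) - H (r n) (\<phi>0 t)) + H (r n) (\<phi>0 t)) \<longlonglongrightarrow> 0 + H0 (\<phi>0 t)" by (rule tendsto_add)
      then show ?thesis by simp
    qed
    have ss: "s \<in> {0..1}" "s' \<in> {0..1}" using s by auto
    show ?thesis
    proof (rule LIMSEQ_le_const2)
      show "(\<lambda>n. norm (X (r n) (\<zeta> (r n) s') - X (r n) (\<zeta> (r n) s) - (H (r n) (\<zeta> (r n) s') - H (r n) (\<zeta> (r n) s))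
       - control_term g (X (r n) (\<zeta> (r n) s)) (uk (r n) (\<zeta> (r n) s') - uk (r n) (\<zeta> (r n) s))))
        \<longlonglongrightarrow> norm (y s' - y s - (H0 (\<phi>0 s') - H0 (\<phi>0 s)) - control_term g (y s) (\<phi> s' - \<phi> s))"
        by (intro tendsto_norm tendsto_diff tendsto_control_term pw3 Hc ss)
    qed (use \<zeta>_incr(4)[OF s] in auto)
  qed
  obtain w where w: "borel_representative a b V v w"
    using borel_representative_exists[OF ab V v] by blast
  \<comment> \<open>The time component of the space-time solution is \<open>\<phi>0\<close>
    itself.\<close>
  have st: "space_time_solution f g a xbar \<phi>0 \<phi> (w \<circ> \<phi>0) \<phi>0 y"
    unfolding space_time_solution_def
  proof (intro conjI)
    show "abs_continuous_on {0..1} \<phi>0"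
      by (rule abs_continuous_on_lipschitz[of _ _ \<Lambda>']) (use comp_lip in auto)
    show "abs_continuous_on {0..1} y"
      by (rule abs_continuous_on_lipschitz[of _ _ \<Lambda>']) (use comp_lip in auto)
    show "\<phi>0 0 = a" using LIMSEQ_unique[OF pw3(1)[of 0]] \<zeta>(1) by auto
    show "y 0 = xbar" using LIMSEQ_unique[OF pw3(3)[of 0]] \<zeta>(1) X_a by auto
    obtain h where h: "negligible {s \<in> {0..1}. \<not> (\<phi> has_vector_derivative h s) (at s within {0..1})}"
      using lipschitz_has_vector_derivative_ae[OF zero_le_one comp_lip(2)] by blast
    have wv: "AE t in lebesgue_on {a..b}. w t = v t" using w by (simp add: borel_representative_def)
    let ?D = "{s \<in> {0..1}. \<not> (\<exists>p. (\<phi>0 has_vector_derivative p) (at s within {0..1}) \<and>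
     ((\<lambda>s. integral {a..\<phi>0 s} F0) has_vector_derivative
        p *\<^sub>R f (\<phi>0 s) (y s) (\<phi> s) (w (\<phi>0 s))) (at s within {0..1}))}"
    have D: "negligible ?D"
      unfolding F0_def
      by (rule space_time_drift_derivative_ae[OF comp_lip(1) mono img \<sigma> F0int[unfolded F0_def] F0B[unfolded F0_def] wv])
    show "AE s in lebesgue_on {0..1}.
        (\<phi>0 has_vector_derivative vector_derivative \<phi>0 (at s within {0..1})) (at s within {0..1}) \<and>
        (y has_vector_derivative
           (vector_derivative \<phi>0 (at s within {0..1}) *\<^sub>R f (\<phi>0 s) (y s) (\<phi> s) ((w \<circ> \<phi>0) s) +
            (\<Sum>\<alpha>\<in>UNIV. (vector_derivative \<phi> (at s within {0..1}) $ \<alpha>) *\<^sub>R g \<alpha> (y s))))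
        (at s within {0..1})"
      unfolding control_term_def[symmetric]
    proof (subst AE_lebesgue_on_iff_negligible, simp, rule negligible_subset[OF negligible_Un[OF h D]], rule subsetI, rule ccontr)
      fix s
      assume bad: "s \<in> {s \<in> {0..1}. \<not> ((\<phi>0 has_vector_derivative vector_derivative \<phi>0 (at s within {0..1})) (at s within {0..1}) \<and>
        (y has_vector_derivative
           (vector_derivative \<phi>0 (at s within {0..1}) *\<^sub>R f (\<phi>0 s) (y s) (\<phi> s) ((w \<circ> \<phi>0) s) +
            control_term g (y s) (vector_derivative \<phi> (at s within {0..1}))))
        (at s within {0..1}))}"
        and "s \<notin> {s \<in> {0..1}. \<not> (\<phi> has_vector_derivative h s) (at s within {0..1})} \<union> ?D"
      then obtain p where s: "s \<in> {0..1}" and \<phi>': "(\<phi> has_vector_derivative h s) (at s within {0..1})"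
        and p: "(\<phi>0 has_vector_derivative p) (at s within {0..1})"
          "((\<lambda>s. integral {a..\<phi>0 s} F0) has_vector_derivative p *\<^sub>R f (\<phi>0 s) (y s) (\<phi> s) (w (\<phi>0 s))) (at s within {0..1})"
        by blast
      have vd: "vector_derivative \<phi>0 (at s within {0..1}) = p" "vector_derivative \<phi> (at s within {0..1}) = h s"
        using vector_derivative_within_cbox[of 0 1 s \<phi>0 p] vector_derivative_within_cbox[of 0 1 s \<phi> "h s"] p(1) \<phi>' s by auto
      \<comment> \<open>The converse direction of the estimate, with the drift integral composed
        with \<open>\<phi>0\<close> in the role of \<open>\<Phi>\<close>.\<close>
      have "(y has_vector_derivative p *\<^sub>R f (\<phi>0 s) (y s) (\<phi> s) (w (\<phi>0 s)) + control_term g (y s) (h s)) (at s within {0..1})"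
        by (rule sewing_derivative[OF comp_lip(3,2) bounded_linear_control_term B(1) B(4) quad[unfolded H0_def] s p(2) \<phi>'])
           (use y_in in auto)
      then show False using bad p(1) vd by simp
    qed
  qed

  \<comment> \<open>The limit is a graph completion\<close>
  have gc: "graph_completion a b U u \<phi>0 \<phi>"
    unfolding graph_completion_def space_time_controls_def
  proof (intro conjI CollectI, clarify, intro conjI)
    show "\<exists>L. L-lipschitz_on {0..1} (\<lambda>s. (\<phi>0 s, \<phi> s))"
    proof (rule exI[of _ "2 * \<Lambda>'"], rule lipschitz_onI)
      fix s s' :: real assume s: "s \<in> {0..1}" "s' \<in> {0..1}"
      have *: "dist (\<phi>0 s, \<phi> s) (\<phi>0 s', \<phi> s') \<le> 2 * \<Lambda>' * dist s s'" if "s \<in> {0..1}" "s' \<in> {0..1}" "s \<le> s'" for s s'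
      proof -
        have "norm (\<phi>0 s' - \<phi>0 s, \<phi> s' - \<phi> s) \<le> norm (\<phi>0 s' - \<phi>0 s) + norm (\<phi> s' - \<phi> s)" by (rule norm_Pair_le)
        also have "\<dots> \<le> 2 * \<Lambda>' * (s' - s)" using comp_lip(1,2)[of s s'] that by simp
        finally have "dist (\<phi>0 s', \<phi> s') (\<phi>0 s, \<phi> s) \<le> 2 * \<Lambda>' * (s' - s)" unfolding dist_norm by (simp del: norm_Pair)
        then show ?thesis using that by (simp add: dist_commute dist_real_def)
      qed
      show "dist (\<phi>0 s, \<phi> s) (\<phi>0 s', \<phi> s') \<le> 2 * \<Lambda>' * dist s s'"
        using *[OF s] *[OF s(2,1)] by (metis dist_commute linear)
    qed (use \<Lambda>'0 in simp)
    show "\<phi> ` {0..1} \<subseteq> U" using \<phi>_in by blast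
    show "\<forall>t\<in>{a..b}. \<exists>s\<in>{0..1}. (t, u t) = (\<phi>0 s, \<phi> s)"
    proof
      fix t assume "t \<in> {a..b}"
      from \<sigma>[OF this] show "\<exists>s\<in>{0..1}. (t, u t) = (\<phi>0 s, \<phi> s)" by (intro bexI[of _ "\<sigma> t"]) auto
    qed
  qed (use mono img in auto)
  have clock: "is_clock a b u \<phi>0 \<phi> \<sigma>" using \<sigma> by (simp add: is_clock_def)
  have "x a = xbar" using LIMSEQ_unique[OF conv(2)[of a]] X_a ab by auto
  then show ?thesis unfolding gc_solution_def using gc clock w st \<sigma> by metis
qed

end

section \<open>From graph completions to limit solutions\<close>

text \<open>
  The approximations are McShane extensions of restrictions of \<open>\<sigma>\<close> to finite sets.
\<close>
lemma lipschitz_approximation_of_increasing: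
  fixes \<sigma> :: "real \<Rightarrow> real"
  assumes ab: "a < b" and mono: "\<And>s t. a \<le> s \<Longrightarrow> s \<le> t \<Longrightarrow> t \<le> b \<Longrightarrow> \<sigma> s \<le> \<sigma> t"
  shows "\<exists>\<sigma>k :: nat \<Rightarrow> real \<Rightarrow> real.
     (\<forall>k. \<exists>L. \<forall>s t. s \<le> t \<longrightarrow> \<sigma>k k s \<le> \<sigma>k k t \<and> \<sigma>k k t - \<sigma>k k s \<le> L * (t - s)) \<and>
     (\<forall>k. \<sigma>k k a = \<sigma> a) \<and>
     (\<forall>t\<in>{a..b}. (\<lambda>k. \<sigma>k k t) \<longlonglongrightarrow> \<sigma> t) \<and>
     (\<forall>k. \<forall>t\<in>{a..b}. \<exists>p\<in>{a..b}. \<exists>q\<in>{a..b}. p \<le> t \<and> t \<le> q \<and> q - p \<le> (b - a) / Suc k \<and> \<sigma> p \<le> \<sigma>k k t \<and> \<sigma>k k t \<le> \<sigma> q)"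
proof -
  \<comment> \<open>\<open>a\<close> is added so that \<open>J\<close> is nonempty and can be
    enumerated by \<open>from_nat_into\<close>.\<close>
  define J where "J = insert a {t \<in> {a..b}. \<not> continuous (at t within {a..b}) \<sigma>}"
  have "mono_on {a..b} \<sigma>" by (rule mono_onI) (use mono in auto)
  then have J: "countable J" "J \<noteq> {}" "J \<subseteq> {a..b}"
    using mono_on_ctble_discont[of "{a..b}" \<sigma>] ab by (auto simp: J_def)
  \<comment> \<open>A grid of mesh \<open>(b - a) / Suc k\<close> together with the first
    \<open>k + 1\<close> points of \<open>J\<close>: the grid serves points of continuity, the
    enumeration catches each discontinuity from some \<open>k\<close> on.\<close>
  define P where "P = (\<lambda>k. (\<lambda>i. a + real i * (b - a) / Suc k) ` {..Suc k} \<union> from_nat_into J ` {..k})"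
  have grid: "a + real i * (b - a) / Suc k \<in> {a..b}" if "i \<le> Suc k" for i k
  proof -
    have "real i * (b - a) \<le> real (Suc k) * (b - a)" using that ab by (intro mult_right_mono) auto
    then have "real i * (b - a) / Suc k \<le> b - a" by (simp add: field_simps)
    moreover have "0 \<le> real i * (b - a) / Suc k" using ab by simp
    ultimately show ?thesis by auto
  qed
  have P: "finite (P k)" "P k \<subseteq> {a..b}" "a \<in> P k" "b \<in> P k" for k
  proof -
    show "finite (P k)" by (simp add: P_def)
    show "P k \<subseteq> {a..b}" using grid J(3) from_nat_into[OF J(2)] by (auto simp: P_def)
    have "a = a + real 0 * (b - a) / Suc k" "b = a + real (Suc k) * (b - a) / Suc k" by (auto simp: field_simps)
    then show "a \<in> P k" "b \<in> P k" unfolding P_def by blast+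
  qed
  \<comment> \<open>A crude Lipschitz constant for \<open>\<sigma>\<close> on \<open>P k\<close>:
    the sum of all difference quotients, where pairs of equal points contribute 0.\<close>
  define L where "L = (\<lambda>k. \<Sum>z\<in>P k \<times> P k. \<bar>(\<sigma> (fst z) - \<sigma> (snd z)) / (fst z - snd z)\<bar>)"
  have L0: "0 \<le> L k" for k unfolding L_def by (intro sum_nonneg) auto
  have L: "\<sigma> q - \<sigma> p \<le> L k * (q - p)" if "p \<in> P k" "q \<in> P k" "p < q" for k p q
  proof -
    have "\<bar>(\<sigma> (fst (q,p)) - \<sigma> (snd (q,p))) / (fst (q,p) - snd (q,p))\<bar> \<le> L k"
      unfolding L_def using that P(1) by (intro member_le_sum) auto
    then have "(\<sigma> q - \<sigma> p) / (q - p) \<le> L k"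
      using abs_ge_self[of "(\<sigma> q - \<sigma> p) / (q - p)"] by (simp only: fst_conv snd_conv)
    then show ?thesis using that(3) by (simp add: field_simps)
  qed
  \<comment> \<open>The one-sided penalty \<open>max 0 (p - t)\<close>, in place of a distance,
    keeps the extension increasing.\<close>
  define h where "h = (\<lambda>k t p. \<sigma> p - L k * max 0 (p - t))"
  define \<sigma>k where "\<sigma>k = (\<lambda>k t. Max (h k t ` P k))"
  have ge: "h k t p \<le> \<sigma>k k t" if "p \<in> P k" for k t p
    unfolding \<sigma>k_def using that P(1) by (intro Max_ge) auto
  have le: "\<sigma>k k t \<le> c" if "\<And>p. p \<in> P k \<Longrightarrow> h k t p \<le> c" for k t c
    unfolding \<sigma>k_def using that P(1,3) by (subst Max_le_iff) auto
  have incr: "\<sigma>k k s \<le> \<sigma>k k t" "\<sigma>k k t - \<sigma>k k s \<le> L k * (t - s)" if "s \<le> t" for k s t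
  proof -
    show "\<sigma>k k s \<le> \<sigma>k k t"
    proof (rule le)
      fix p assume p: "p \<in> P k"
      have "L k * max 0 (p - t) \<le> L k * max 0 (p - s)" using that L0 by (intro mult_left_mono) auto
      then have "h k s p \<le> h k t p" by (simp add: h_def)
      then show "h k s p \<le> \<sigma>k k t" using ge[OF p, of t] by linarith
    qed
    have "\<sigma>k k t \<le> \<sigma>k k s + L k * (t - s)"
    proof (rule le)
      fix p assume p: "p \<in> P k"
      have "L k * max 0 (p - s) \<le> L k * (max 0 (p - t) + (t - s))" using that L0 by (intro mult_left_mono) auto
      then have "h k t p \<le> h k s p + L k * (t - s)" by (simp add: h_def algebra_simps)
      then show "h k t p \<le> \<sigma>k k s + L k * (t - s)" using ge[OF p, of s] by linarith
    qed
    then show "\<sigma>k k t - \<sigma>k k s \<le> L k * (t - s)" by simp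
  qed
  have interp: "\<sigma>k k p = \<sigma> p" if p: "p \<in> P k" for k p
  proof (rule antisym)
    show "\<sigma>k k p \<le> \<sigma> p"
    proof (rule le)
      fix q assume q: "q \<in> P k"
      show "h k p q \<le> \<sigma> p"
      proof (cases "p < q")
        case True then show ?thesis using L[OF p q] by (simp add: h_def)
      next
        case False then show ?thesis using mono[of q p] subsetD[OF P(2) p] subsetD[OF P(2) q] by (simp add: h_def)
      qed
    qed
    show "\<sigma> p \<le> \<sigma>k k p" using ge[OF p, of p] by (simp add: h_def)
  qed
  have near: "\<exists>p\<in>{a..b}. \<exists>q\<in>{a..b}. p \<le> t \<and> t \<le> q \<and> q - p \<le> (b - a) / Suc k \<and> \<sigma> p \<le> \<sigma>k k t \<and> \<sigma>k k t \<le> \<sigma> q"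
    if t: "t \<in> {a..b}" for k t
  proof -
    \<comment> \<open>The index of the grid cell that contains \<open>t\<close>. Only
      \<open>t = b\<close> has no cell to its right, which is the case
      \<open>\<not> i < Suc k\<close>.\<close>
    define i where "i = nat \<lfloor>(t - a) * Suc k / (b - a)\<rfloor>"
    have z: "0 \<le> (t - a) * Suc k / (b - a)" using t ab by simp
    have i1: "real i \<le> (t - a) * Suc k / (b - a)" using z unfolding i_def by simp
    have i2: "(t - a) * Suc k / (b - a) < real i + 1" using z unfolding i_def by linarith
    let ?g = "\<lambda>j::nat. a + real j * (b - a) / Suc k"
    have gt: "?g i \<le> t" using i1 ab by (simp add: field_simps)
    have tg: "t < ?g (Suc i)" using i2 ab by (simp add: field_simps)
    show ?thesis
    proof (cases "i < Suc k")
      case True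
      have gP: "?g j \<in> P k" if "j \<le> Suc k" for j
        unfolding P_def using that by (intro UnI1 imageI) simp
      have pq: "?g i \<in> P k" "?g (Suc i) \<in> P k"
        using True by (intro gP, simp)+
      have "\<sigma> (?g i) \<le> \<sigma>k k t" "\<sigma>k k t \<le> \<sigma> (?g (Suc i))"
        using incr(1)[OF gt, of k] incr(1)[OF less_imp_le[OF tg], of k] interp[OF pq(1)] interp[OF pq(2)] by auto
      moreover have "?g (Suc i) - ?g i \<le> (b - a) / Suc k"
      proof -
        have "real (Suc i) * (b - a) / Suc k = real i * (b - a) / Suc k + (b - a) / Suc k"
          by (simp only: of_nat_Suc distrib_right add_divide_distrib mult_1_left add.commute)
        then show ?thesis by simp
      qed
      ultimately show ?thesis using subsetD[OF P(2) pq(1)] subsetD[OF P(2) pq(2)] gt less_imp_le[OF tg] by blast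
    next
      case False
      have "b \<le> ?g i"
      proof -
        have "real (Suc k) * (b - a) \<le> real i * (b - a)" using False ab by (intro mult_right_mono) auto
        then have "b - a \<le> real i * (b - a) / Suc k" by (simp add: field_simps)
        then show ?thesis by simp
      qed
      then have "t = b" using gt t by auto
      then show ?thesis using interp[OF P(4)] ab by (intro bexI[of _ b]) auto
    qed
  qed
  \<comment> \<open>At a point of \<open>J\<close> the value is eventually exact; at a point of
    continuity it is squeezed between \<open>\<sigma> p\<close> and
    \<open>\<sigma> q\<close>.\<close>
  have lim: "(\<lambda>k. \<sigma>k k t) \<longlonglongrightarrow> \<sigma> t" if t: "t \<in> {a..b}" for t
  proof (cases "t \<in> J")
    case True
    then obtain j where j: "from_nat_into J j = t" using from_nat_into_surj[OF J(1)] by blast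
    have "\<sigma>k k t = \<sigma> t" if "k \<ge> j" for k
      using that j by (intro interp) (auto simp: P_def)
    then have "\<forall>\<^sub>F k in sequentially. \<sigma>k k t = \<sigma> t" unfolding eventually_sequentially by blast
    then show ?thesis by (rule tendsto_eventually)
  next
    case False
    then have cont: "continuous (at t within {a..b}) \<sigma>" using t by (simp add: J_def)
    show ?thesis
    proof (rule LIMSEQ_I)
      fix e :: real assume "0 < e"
      then obtain d where d: "d > 0" "\<And>s. s \<in> {a..b} \<Longrightarrow> \<bar>s - t\<bar> < d \<Longrightarrow> \<bar>\<sigma> s - \<sigma> t\<bar> < e"
        using cont unfolding continuous_within_eps_delta dist_real_def by blast
      have "(\<lambda>k. (b - a) * inverse (real (Suc k))) \<longlonglongrightarrow> (b - a) * 0"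
        by (intro tendsto_intros LIMSEQ_inverse_real_of_nat)
      then have "\<forall>\<^sub>F k in sequentially. (b - a) * inverse (real (Suc k)) < d"
        using d(1) by (intro order_tendstoD(2)[of _ "(b - a) * 0"]) auto
      then obtain k0 where k0: "\<And>k. k \<ge> k0 \<Longrightarrow> (b - a) / Suc k < d"
        unfolding eventually_sequentially by (auto simp: divide_inverse)
      show "\<exists>k0. \<forall>k\<ge>k0. norm (\<sigma>k k t - \<sigma> t) < e"
      proof (intro exI[of _ k0] allI impI)
        fix k assume "k \<ge> k0"
        from k0[OF this] obtain p q where pq: "p \<in> {a..b}" "q \<in> {a..b}" "p \<le> t" "t \<le> q" "q - p < d"
          "\<sigma> p \<le> \<sigma>k k t" "\<sigma>k k t \<le> \<sigma> q" using near[OF t, of k] by (meson le_less_trans)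
        have "\<bar>\<sigma> p - \<sigma> t\<bar> < e" "\<bar>\<sigma> q - \<sigma> t\<bar> < e" using pq by (auto intro!: d(2))
        then show "norm (\<sigma>k k t - \<sigma> t) < e" using pq(6,7) by auto
      qed
    qed
  qed
  show ?thesis
    using incr interp[OF P(3)] near lim by (intro exI[of _ \<sigma>k] conjI allI ballI impI exI) blast+
qed

section \<open>Variation of dominated maps, convergence in mean, bounds on derivatives\<close>

lemma sum_division_telescope:
  fixes \<nu> :: "real \<Rightarrow> real"
  assumes ab: "a \<le> b" and d: "d division_of {a..b}"
  shows "(\<Sum>k\<in>d. \<nu> (Sup k) - \<nu> (Inf k)) = \<nu> b - \<nu> a"
proof -
  note kk = division_of_real_interval[OF d]
  \<comment> \<open>Left end points serve as tags, so that telescoping over tagged divisions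
    applies.\<close>
  let ?p = "(\<lambda>k. (Inf k, k)) ` d"
  have "?p tagged_division_of {a..b}"
    unfolding tagged_division_of_def tagged_partial_division_of_def
  proof (intro conjI allI impI)
    show "finite ?p" using division_of_finite[OF d] by simp
    have "{K. \<exists>x. (x, K) \<in> ?p} = d" by auto
    then show "\<Union>{K. \<exists>x. (x, K) \<in> ?p} = {a..b}" using division_ofD(6)[OF d] by simp
  next
    fix x k assume "(x, k) \<in> ?p"
    then have k: "k \<in> d" "x = Inf k" by auto
    show "x \<in> k" using kk(1,2)[OF k(1)] k(2) by (metis atLeastAtMost_iff order_refl)
    show "k \<subseteq> {a..b}" "\<exists>a b. k = cbox a b" using division_ofD(2,4)[OF d k(1)] by auto
  next
    fix x1 k1 x2 k2 assume "(x1, k1) \<in> ?p \<and> (x2, k2) \<in> ?p \<and> (x1, k1) \<noteq> (x2, k2)"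
    then show "interior k1 \<inter> interior k2 = {}" using division_ofD(5)[OF d] by auto
  qed
  from additive_tagged_division_1[OF ab this, of \<nu>] show ?thesis
    by (subst (asm) sum.reindex) (auto simp: inj_on_def)
qed

lemma total_variation_le_dominated:
  assumes ab: "a \<le> b"
    and dom: "\<And>s t. a \<le> s \<Longrightarrow> s \<le> t \<Longrightarrow> t \<le> b \<Longrightarrow> norm (u t - u s) \<le> \<nu> t - \<nu> s"
  shows "total_variation a b u \<le> ennreal (\<nu> b - \<nu> a)"
  unfolding total_variation_def
proof (rule SUP_least)
  fix d assume "d \<in> {d. d division_of {a..b}}"
  then have d: "d division_of {a..b}" by simp
  have "(\<Sum>k\<in>d. norm (u (Sup k) - u (Inf k))) \<le> (\<Sum>k\<in>d. \<nu> (Sup k) - \<nu> (Inf k))"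
    using division_of_real_interval[OF d] by (intro sum_mono dom) auto
  then show "ennreal (\<Sum>k\<in>d. norm (u (Sup k) - u (Inf k))) \<le> ennreal (\<nu> b - \<nu> a)"
    unfolding sum_division_telescope[OF ab d] by (rule ennreal_leI)
qed

text \<open>The limit inherits measurability and the bound \<open>B\<close>, so dominated
  convergence applies to the differences; convergence at every point covers the summand at
  \<open>\<tau>\<close>.\<close>

lemma tendsto_at_and_L1I:
  fixes wk :: "nat \<Rightarrow> real \<Rightarrow> 'e::euclidean_space"
  assumes meas: "\<And>k. wk k \<in> borel_measurable (lebesgue_on {a..b})"
    and bound: "\<And>k t. t \<in> {a..b} \<Longrightarrow> norm (wk k t) \<le> B"
    and lim: "\<And>t. t \<in> {a..b} \<Longrightarrow> (\<lambda>k. wk k t) \<longlonglongrightarrow> w t" and \<tau>: "\<tau> \<in> {a..b}"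
  shows "tendsto_at_and_L1 {a..b} \<tau> wk w"
proof -
  have wm: "w \<in> borel_measurable (lebesgue_on {a..b})"
    by (rule borel_measurable_LIMSEQ_metric[where f=wk]) (use meas lim in auto)
  have wB: "norm (w t) \<le> B" if "t \<in> {a..b}" for t
    by (rule LIMSEQ_le_const2[OF tendsto_norm[OF lim[OF that]]]) (use bound[OF that] in auto)
  have int: "(\<lambda>t. wk k t - w t) absolutely_integrable_on {a..b}" for k
  proof (rule bounded_measurable_absolutely_integrable)
    show "(\<lambda>t. wk k t - w t) \<in> borel_measurable (lebesgue_on {a..b})" using meas wm by (intro borel_measurable_diff)
    show "norm (wk k t - w t) \<le> B + B" if "t \<in> {a..b}" for t
      using norm_triangle_ineq4[of "wk k t" "w t"] bound[OF that, of k] wB[OF that] by linarith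
  qed
  have L1: "L1_norm {a..b} (\<lambda>t. wk k t - w t) = integral {a..b} (\<lambda>t. norm (wk k t - w t))" for k
    unfolding L1_norm_def
    by (rule set_lebesgue_integral_eq_integral(2)) (rule absolutely_integrable_norm[OF int, unfolded o_def])
  have "(\<lambda>k. integral {a..b} (\<lambda>t. norm (wk k t - w t))) \<longlonglongrightarrow> integral {a..b} (\<lambda>t. 0)"
  proof (rule dominated_convergence(2)[where h="\<lambda>_. B + B"])
    show "(\<lambda>t. norm (wk k t - w t)) integrable_on {a..b}" for k
      using int[of k] by (simp add: absolutely_integrable_on_def)
    show "norm (norm (wk k t - w t)) \<le> B + B" if "t \<in> {a..b}" for k t
      using norm_triangle_ineq4[of "wk k t" "w t"] bound[OF that, of k] wB[OF that] by simp
    show "(\<lambda>k. norm (wk k t - w t)) \<longlonglongrightarrow> 0" if "t \<in> {a..b}" for t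
      using lim[OF that] by (intro tendsto_norm_zero) (simp add: LIM_zero)
  qed auto
  then have "(\<lambda>k. L1_norm {a..b} (\<lambda>t. wk k t - w t)) \<longlonglongrightarrow> 0" by (simp add: L1)
  moreover have "(\<lambda>k. norm (wk k \<tau> - w \<tau>)) \<longlonglongrightarrow> 0"
    using lim[OF \<tau>] by (intro tendsto_norm_zero) (simp add: LIM_zero)
  ultimately have "(\<lambda>k. norm (wk k \<tau> - w \<tau>) + L1_norm {a..b} (\<lambda>t. wk k t - w t)) \<longlonglongrightarrow> 0 + 0"
    by (rule tendsto_add[rotated])
  then show ?thesis using int by (simp add: tendsto_at_and_L1_def)
qed

text \<open>It serves to cut off the density of a Lipschitz input at its Lipschitz constant without
  changing it wherever it is the derivative.\<close>

lemma lipschitz_vector_derivative_bound: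
  fixes h :: "real \<Rightarrow> 'e::euclidean_space"
  assumes ab: "a < b" and t: "t \<in> {a..b}" and d: "(h has_vector_derivative h') (at t within {a..b})"
    and lip: "\<And>r s. a \<le> r \<Longrightarrow> r \<le> s \<Longrightarrow> s \<le> b \<Longrightarrow> norm (h s - h r) \<le> C * (s - r)"
  shows "norm h' \<le> C"
proof (rule field_le_epsilon)
  fix e :: real assume "0 < e"
  then obtain \<delta> where \<delta>: "\<delta> > 0" "\<And>s. s \<in> {a..b} \<Longrightarrow> \<bar>s - t\<bar> < \<delta> \<Longrightarrow> norm (h s - h t - (s - t) *\<^sub>R h') \<le> e * \<bar>s - t\<bar>"
    using d unfolding has_vector_derivative_within_alt by blast
  obtain s where s: "s \<in> {a..b}" "s \<noteq> t" "\<bar>s - t\<bar> < \<delta>"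
  proof (cases "t < b")
    case True
    show ?thesis by (rule that[of "min b (t + \<delta> / 2)"]) (use True \<delta>(1) t in \<open>auto simp: min_def\<close>)
  next
    case False
    show ?thesis by (rule that[of "max a (t - \<delta> / 2)"]) (use False \<delta>(1) t ab in \<open>auto simp: max_def\<close>)
  qed
  have "norm (h s - h t) \<le> C * \<bar>s - t\<bar>"
    using lip[of s t] lip[of t s] s t by (cases "s \<le> t") (auto simp: norm_minus_commute)
  moreover have "\<bar>s - t\<bar> * norm h' \<le> norm (h s - h t) + norm (h s - h t - (s - t) *\<^sub>R h')"
  proof -
    have "h s - h t - (h s - h t - (s - t) *\<^sub>R h') = (s - t) *\<^sub>R h'" by simp
    then show ?thesis using norm_triangle_ineq4[of "h s - h t" "h s - h t - (s - t) *\<^sub>R h'"] by (simp only: norm_scaleR)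
  qed
  ultimately have "\<bar>s - t\<bar> * norm h' \<le> C * \<bar>s - t\<bar> + e * \<bar>s - t\<bar>" using \<delta>(2)[OF s(1,3)] by linarith
  then have "\<bar>s - t\<bar> * norm h' \<le> \<bar>s - t\<bar> * (C + e)" by (simp add: algebra_simps)
  then show "norm h' \<le> C + e" using s(2) by simp
qed

context control_system
begin

text \<open>
  Projecting the state to a ball makes the right-hand side globally Lipschitz; a solution that
  stays in the ball solves the original equation.
\<close>
lemma truncated_solution_exists:
  assumes R: "0 \<le> R" and u_lip: "\<And>r s. a \<le> r \<Longrightarrow> r \<le> s \<Longrightarrow> s \<le> b \<Longrightarrow> norm (u s - u r) \<le> K * (s - r)"
    and uU: "\<And>t. t \<in> {a..b} \<Longrightarrow> u t \<in> U" and v: "v \<in> L1_maps {a..b} V"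
  obtains X N where "abs_continuous_on {a..b} X" "X a = x0" "negligible N"
    "\<And>t. t \<in> {a..b} - N \<Longrightarrow> \<exists>u'. (u has_vector_derivative u') (at t within {a..b}) \<and>
       (X has_vector_derivative f t (closest_point (cball 0 R) (X t)) (u t) (v t) +
          control_term g (closest_point (cball 0 R) (X t)) u') (at t within {a..b})"
proof -
  have ab: "a \<le> b" using a_less_b by simp
  let ?P = "closest_point (cball (0::real^'n) R)"
  have Pin: "?P z \<in> cball 0 R" for z using R by (intro closest_point_in_set) auto
  \<comment> \<open>The projection does not increase distances, so Lipschitz constants on the ball
    become global.\<close>
  have Plip: "norm (?P z - ?P z') \<le> norm (z - z')" for z z'
    using closest_point_lipschitz[of "cball 0 R" z z'] R by (simp add: dist_norm)
  obtain C where "local_bound R C" using local_bound_exists by blast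
  note C = local_boundD[OF this]
  have vV: "v t \<in> V" if "t \<in> {a..b}" for t using v that by (auto simp: L1_maps_def)
  obtain h where h: "h absolutely_integrable_on {a..b}"
    "negligible {t \<in> {a..b}. \<not> (u has_vector_derivative h t) (at t within {a..b})}"
    using lipschitz_has_vector_derivative_ae[OF ab u_lip] by blast
  have hm: "h \<in> borel_measurable (lebesgue_on {a..b})"
    using absolutely_integrable_measurable[of "{a..b}" h] h(1) by simp
  \<comment> \<open>The density \<open>h\<close> may be large on a null set. Cutting it off at
    \<open>K\<close> makes the right-hand side bounded and Lipschitz at every \<open>t\<close>, and
    changes nothing where \<open>h t\<close> is the derivative of \<open>u\<close>.\<close>
  define w where "w = (\<lambda>t. if norm (h t) \<le> K then h t else 0)"
  have wm: "w \<in> borel_measurable (lebesgue_on {a..b})"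
    unfolding w_def using hm by measurable
  have wK: "norm (w t) \<le> \<bar>K\<bar>" for t by (auto simp: w_def)
  have um: "u \<in> borel_measurable (lebesgue_on {a..b})"
    by (rule continuous_imp_measurable_on_sets_lebesgue[OF abs_continuous_on_imp_continuous_on[OF abs_continuous_on_lipschitz[of _ _ K]]])
       (use u_lip in auto)
  define G where "G = (\<lambda>t z. f t (?P z) (u t) (v t) + control_term g (?P z) (w t))"
  have Gb: "norm (G t z) \<le> C + C * \<bar>K\<bar>" if "t \<in> {a..b}" for t z
    unfolding G_def
  proof (rule norm_triangle_mono)
    show "norm (f t (?P z) (u t) (v t)) \<le> C" by (rule C(2)[OF that Pin uU[OF that] vV[OF that]])
    have "norm (control_term g (?P z) (w t)) \<le> C * norm (w t)" by (rule C(4)[OF Pin])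
    also have "\<dots> \<le> C * \<bar>K\<bar>" using wK C(1) by (intro mult_left_mono) auto
    finally show "norm (control_term g (?P z) (w t)) \<le> C * \<bar>K\<bar>" .
  qed
  obtain X where X: "continuous_on {a..b} X" "(\<lambda>r. G r (X r)) absolutely_integrable_on {a..b}"
    "\<And>t. t \<in> {a..b} \<Longrightarrow> X t = x0 + integral {a..t} (\<lambda>r. G r (X r))"
  proof (rule integral_equation_solution_exists[OF ab, of G "C + C * \<bar>K\<bar>" "C + C * \<bar>K\<bar>" x0])
    show "(\<lambda>t. G t z) \<in> borel_measurable (lebesgue_on {a..b})" for z
    proof -
      have "(\<lambda>t. control_term g (?P z) (w t)) \<in> borel_measurable (lebesgue_on {a..b})"
        by (rule measurable_compose[OF wm borel_measurable_continuous_onI])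
           (intro linear_continuous_on bounded_linear_control_term)
      then show ?thesis unfolding G_def
        by (intro borel_measurable_add drift_measurable um L1_maps_imp_measurable[OF v] vV) auto
    qed
    show "norm (G t z) \<le> C + C * \<bar>K\<bar>" if "t \<in> {a..b}" for t z by (rule Gb[OF that])
    show "norm (G t z - G t z') \<le> (C + C * \<bar>K\<bar>) * norm (z - z')" if "t \<in> {a..b}" for t z z'
    proof -
      have "norm (G t z - G t z') = norm ((f t (?P z) (u t) (v t) - f t (?P z') (u t) (v t)) +
          (control_term g (?P z) (w t) - control_term g (?P z') (w t)))"
        by (simp add: G_def algebra_simps)
      also have "\<dots> \<le> C * norm (?P z - ?P z') + C * norm (?P z - ?P z') * norm (w t)"
        using C(3)[OF that Pin Pin uU[OF that] vV[OF that]] C(5)[OF Pin Pin] by (intro norm_triangle_mono)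
      also have "\<dots> \<le> C * norm (z - z') + C * norm (z - z') * \<bar>K\<bar>"
        using Plip[of z z'] wK[of t] C(1) by (intro add_mono mult_mono mult_left_mono mult_nonneg_nonneg) auto
      also have "\<dots> = (C + C * \<bar>K\<bar>) * norm (z - z')" by (simp add: algebra_simps)
      finally show ?thesis .
    qed
  next
    fix X assume "continuous_on {a..b} X" "(\<lambda>r. G r (X r)) absolutely_integrable_on {a..b}"
      "\<And>t. t \<in> {a..b} \<Longrightarrow> X t = x0 + integral {a..t} (\<lambda>r. G r (X r))"
    show thesis by (rule that) fact+
  qed
  have Gi: "(\<lambda>r. G r (X r)) integrable_on {a..b}" using X(2) set_lebesgue_integral_eq_integral(1) by blast
  let ?N = "{t \<in> {a..b}. \<not> (u has_vector_derivative h t) (at t within {a..b})} \<union>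
    {t \<in> {a..b}. \<not> ((\<lambda>t. integral {a..t} (\<lambda>r. G r (X r))) has_vector_derivative G t (X t)) (at t within {a..b})}"
  show ?thesis
  proof (rule that)
    show "abs_continuous_on {a..b} X"
    proof (rule abs_continuous_on_lipschitz[of _ _ "C + C * \<bar>K\<bar>"])
      fix s t assume st: "s \<in> {a..b}" "t \<in> {a..b}" "s \<le> t"
      have "X t - X s = integral {a..t} (\<lambda>r. G r (X r)) - integral {a..s} (\<lambda>r. G r (X r))" using X(3) st by simp
      then show "norm (X t - X s) \<le> (C + C * \<bar>K\<bar>) * (t - s)"
        using integral_lipschitz[OF X(2) Gb, of s t] st by simp
    qed
    show "X a = x0" using X(3)[of a] ab by simp
    show "negligible ?N" by (rule negligible_Un[OF h(2) indefinite_integral_has_vector_derivative_ae[OF Gi]])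
    fix t assume t: "t \<in> {a..b} - ?N"
    then have tab: "t \<in> {a..b}" and du: "(u has_vector_derivative h t) (at t within {a..b})"
      and dI: "((\<lambda>t. integral {a..t} (\<lambda>r. G r (X r))) has_vector_derivative G t (X t)) (at t within {a..b})" by blast+
    have "norm (h t) \<le> K" by (rule lipschitz_vector_derivative_bound[OF a_less_b tab du u_lip])
    then have "w t = h t" by (simp add: w_def)
    have "(X has_vector_derivative G t (X t)) (at t within {a..b})"
    proof (rule has_vector_derivative_transform[OF tab X(3)])
      show "((\<lambda>t. x0 + integral {a..t} (\<lambda>r. G r (X r))) has_vector_derivative G t (X t)) (at t within {a..b})"
        using has_vector_derivative_add[OF has_vector_derivative_const dI, of x0] by simp
    qed
    then show "\<exists>u'. (u has_vector_derivative u') (at t within {a..b}) \<and>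
       (X has_vector_derivative f t (?P (X t)) (u t) (v t) + control_term g (?P (X t)) u') (at t within {a..b})"
      using du \<open>w t = h t\<close> by (auto simp: G_def)
  qed
qed

lemma gc_solution_imp_BV_simple_limit_solution:
  assumes gc: "gc_solution f g a b U V xbar u v x" and v: "v \<in> L1_maps {a..b} V"
  shows "BV_simple_limit_solution f g a b U xbar u v x"
proof -
  have ab: "a \<le> b" using a_less_b by simp
  have vV: "v t \<in> V" if "t \<in> {a..b}" for t using v that by (auto simp: L1_maps_def)
  have vm: "v \<in> borel_measurable (lebesgue_on {a..b})" by (rule L1_maps_imp_measurable[OF v])
  obtain \<phi>0 \<phi> \<sigma> w y0 y where xa: "x a = xbar" and comp: "graph_completion a b U u \<phi>0 \<phi>"
    and clock: "is_clock a b u \<phi>0 \<phi> \<sigma>" and w: "borel_representative a b V v w"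
    and st: "space_time_solution f g a xbar \<phi>0 \<phi> (w \<circ> \<phi>0) y0 y" and xy: "\<And>t. t \<in> {a..b} \<Longrightarrow> x t = y (\<sigma> t)"
    using gc unfolding gc_solution_def by blast
  obtain L where L: "L-lipschitz_on {0..1} (\<lambda>s. (\<phi>0 s, \<phi> s))" and \<phi>U: "\<And>s. s \<in> {0..1} \<Longrightarrow> \<phi> s \<in> U"
    and mono: "mono_on {0..1} \<phi>0" and img: "\<phi>0 ` {0..1} = {a..b}"
    using comp unfolding graph_completion_def space_time_controls_def by blast
  have L0: "0 \<le> L" by (rule lipschitz_on_nonneg[OF L])
  have lip: "\<bar>\<phi>0 t - \<phi>0 s\<bar> \<le> L * (t - s)" "norm (\<phi> t - \<phi> s) \<le> L * (t - s)"
    if "0 \<le> s" "s \<le> t" "t \<le> 1" for s t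
  proof -
    have "norm ((\<phi>0 t - \<phi>0 s, \<phi> t - \<phi> s)) \<le> L * (t - s)"
      using lipschitz_onD[OF L, of t s] that by (simp add: dist_norm)
    then show "\<bar>\<phi>0 t - \<phi>0 s\<bar> \<le> L * (t - s)" "norm (\<phi> t - \<phi> s) \<le> L * (t - s)"
      using norm_fst_le[of "\<phi>0 t - \<phi>0 s" "\<phi> t - \<phi> s"] norm_snd_le[of "\<phi> t - \<phi> s" "\<phi>0 t - \<phi>0 s"] by auto
  qed
  have \<sigma>: "\<sigma> t \<in> {0..1}" "\<phi>0 (\<sigma> t) = t" "\<phi> (\<sigma> t) = u t" if "t \<in> {a..b}" for t
    using clock that by (auto simp: is_clock_def)
  have uU: "u t \<in> U" if "t \<in> {a..b}" for t using \<phi>U[OF \<sigma>(1)[OF that]] \<sigma>(3)[OF that] by simp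
  have y0_ac: "abs_continuous_on {0..1} y0" and y_ac: "abs_continuous_on {0..1} y" and y00: "y0 0 = a"
    using st by (auto simp: space_time_solution_def)
  let ?ode = "\<lambda>s. (y0 has_vector_derivative vector_derivative \<phi>0 (at s within {0..1})) (at s within {0..1}) \<and>
        (y has_vector_derivative
           (vector_derivative \<phi>0 (at s within {0..1}) *\<^sub>R f (y0 s) (y s) (\<phi> s) (w (\<phi>0 s)) +
            control_term g (y s) (vector_derivative \<phi> (at s within {0..1})))) (at s within {0..1})"
  have "AE s in lebesgue_on {0..1}. ?ode s"
    using st unfolding space_time_solution_def control_term_def o_def by blast
  then have ode: "negligible {s \<in> {0..1}. \<not> ?ode s}" by (subst (asm) AE_lebesgue_on_iff_negligible) auto
  have vd: "vector_derivative h (at s within {0..1}) = h'"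
    if "(h has_vector_derivative h') (at s within {0..1})" "s \<in> {0..1}" for h :: "real \<Rightarrow> 'z::euclidean_space" and h' and s :: real
    using vector_derivative_within_cbox[of 0 1 s h h'] that by simp
  have "\<phi>0 0 = a"
  proof -
    obtain s where "s \<in> {0..1}" "\<phi>0 s = a" using img ab by (metis atLeastAtMost_iff imageE order_refl)
    then have "\<phi>0 0 \<le> a" using mono_onD[OF mono, of 0 s] by auto
    moreover have "\<phi>0 0 \<in> {a..b}" using img by auto
    ultimately show ?thesis by auto
  qed
  obtain h0 where h0: "negligible {s \<in> {0..1}. \<not> (\<phi>0 has_vector_derivative h0 s) (at s within {0..1})}"
    using lipschitz_has_vector_derivative_ae[OF zero_le_one lip(1)[folded real_norm_def]] by blast
  obtain h1 where h1: "negligible {s \<in> {0..1}. \<not> (\<phi> has_vector_derivative h1 s) (at s within {0..1})}"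
    using lipschitz_has_vector_derivative_ae[OF zero_le_one lip(2)] by blast
  have \<phi>0_ac: "abs_continuous_on {0..1} \<phi>0" and \<phi>_ac: "abs_continuous_on {0..1} \<phi>"
    by (rule abs_continuous_on_lipschitz[of _ _ L], use lip in auto)+
  \<comment> \<open>Both functions have the same derivative almost everywhere and the same initial
    value; \<open>increment_le_dominated\<close> with \<open>B = 0\<close> identifies them.\<close>
  have y0_eq: "y0 s = \<phi>0 s" if s: "s \<in> {0..1}" for s
  proof -
    let ?N = "{s \<in> {0..1}. \<not> ?ode s} \<union> {s \<in> {0..1}. \<not> (\<phi>0 has_vector_derivative h0 s) (at s within {0..1})}"
    have "norm ((y0 s - \<phi>0 s) - (y0 0 - \<phi>0 0)) \<le> 0 * (s - 0)"
    proof (rule increment_le_dominated[where u="\<lambda>r::real. r" and N="?N" and \<nu>="\<lambda>r. r"])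
      show "abs_continuous_on {0..s} (\<lambda>r. y0 r - \<phi>0 r)"
        by (rule abs_continuous_on_subset[OF abs_continuous_on_diff[OF y0_ac \<phi>0_ac]]) (use s in auto)
      show "negligible ?N" by (rule negligible_Un[OF ode h0])
      fix r assume r: "r \<in> {0..s} - ?N"
      then have r01: "r \<in> {0..1}" using s by auto
      have d: "(\<phi>0 has_vector_derivative h0 r) (at r within {0..1})"
        "(y0 has_vector_derivative vector_derivative \<phi>0 (at r within {0..1})) (at r within {0..1})"
        using r r01 by blast+
      have "((\<lambda>r. y0 r - \<phi>0 r) has_vector_derivative 0) (at r within {0..1})"
        using has_vector_derivative_diff[OF d(2,1)] vd[OF d(1) r01] by simp
      then have "((\<lambda>r. y0 r - \<phi>0 r) has_vector_derivative 0) (at r within {0..s})"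
        by (rule has_vector_derivative_within_subset) (use s in auto)
      then show "\<exists>z' w'. ((\<lambda>r. y0 r - \<phi>0 r) has_vector_derivative z') (at r within {0..s}) \<and>
        ((\<lambda>r. r) has_vector_derivative w') (at r within {0..s}) \<and> norm z' \<le> 0 * norm w'"
        using has_vector_derivative_id[of "at r within {0..s}"] by (metis mult_zero_left norm_zero order_refl)
    qed (use s in auto)
    then show ?thesis using y00 \<open>\<phi>0 0 = a\<close> by simp
  qed
  \<comment> \<open>Every clock is increasing: as \<open>\<phi>0\<close> is increasing, a reversed
    pair of parameters would reverse the times.\<close>
  have \<sigma>_mono: "\<sigma> s \<le> \<sigma> t" if "a \<le> s" "s \<le> t" "t \<le> b" for s t
  proof (rule ccontr)
    assume "\<not> \<sigma> s \<le> \<sigma> t"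
    then have lt: "\<sigma> t < \<sigma> s" by simp
    have s: "s \<in> {a..b}" and t: "t \<in> {a..b}" using that by auto
    have "t \<le> s" using mono_onD[OF mono \<sigma>(1)[OF t] \<sigma>(1)[OF s]] lt \<sigma>(2)[OF s] \<sigma>(2)[OF t] by simp
    then show False using lt that by simp
  qed
  have y_cont: "continuous_on {0..1} y" and \<phi>_cont: "continuous_on {0..1} \<phi>"
    by (intro abs_continuous_on_imp_continuous_on y_ac \<phi>_ac)+
  obtain Cy where Cy: "0 < Cy" "\<forall>z\<in>y ` {0..1}. norm z \<le> Cy"
    using compact_imp_bounded[OF compact_continuous_image[OF y_cont compact_Icc]] unfolding bounded_pos by blast
  \<comment> \<open>The margin 1 keeps truncated trajectories inside the ball once they are within 1
    of the reference curves.\<close>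
  define R where "R = Cy + 1"
  have R: "0 \<le> R" using Cy by (simp add: R_def)
  have yR: "y s \<in> cball 0 R" if "s \<in> {0..1}" for s
  proof -
    have "norm (y s) \<le> Cy" using Cy(2) that by blast
    then show ?thesis by (simp add: R_def)
  qed
  obtain C where "local_bound R C" using local_bound_exists by blast
  note C = local_boundD[OF this]

  \<comment> \<open>Regularized clocks and reference curves\<close>
  obtain \<sigma>k :: "nat \<Rightarrow> real \<Rightarrow> real" where \<sigma>k_lip: "\<And>k. \<exists>L. \<forall>s t. s \<le> t \<longrightarrow> \<sigma>k k s \<le> \<sigma>k k t \<and> \<sigma>k k t - \<sigma>k k s \<le> L * (t - s)"
    and \<sigma>k_a: "\<And>k. \<sigma>k k a = \<sigma> a"
    and \<sigma>k_lim: "\<And>t. t \<in> {a..b} \<Longrightarrow> (\<lambda>k. \<sigma>k k t) \<longlonglongrightarrow> \<sigma> t"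
    and \<sigma>k_near: "\<And>k t. t \<in> {a..b} \<Longrightarrow> \<exists>p\<in>{a..b}. \<exists>q\<in>{a..b}. p \<le> t \<and> t \<le> q \<and> q - p \<le> (b - a) / Suc k \<and> \<sigma> p \<le> \<sigma>k k t \<and> \<sigma>k k t \<le> \<sigma> q"
  proof -
    have "\<exists>\<sigma>k :: nat \<Rightarrow> real \<Rightarrow> real.
     (\<forall>k. \<exists>L. \<forall>s t. s \<le> t \<longrightarrow> \<sigma>k k s \<le> \<sigma>k k t \<and> \<sigma>k k t - \<sigma>k k s \<le> L * (t - s)) \<and>
     (\<forall>k. \<sigma>k k a = \<sigma> a) \<and>
     (\<forall>t\<in>{a..b}. (\<lambda>k. \<sigma>k k t) \<longlonglongrightarrow> \<sigma> t) \<and>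
     (\<forall>k. \<forall>t\<in>{a..b}. \<exists>p\<in>{a..b}. \<exists>q\<in>{a..b}. p \<le> t \<and> t \<le> q \<and> q - p \<le> (b - a) / Suc k \<and> \<sigma> p \<le> \<sigma>k k t \<and> \<sigma>k k t \<le> \<sigma> q)"
      by (rule lipschitz_approximation_of_increasing[OF a_less_b]) (rule \<sigma>_mono)
    then show ?thesis using that by blast
  qed
  have \<sigma>k_mono: "\<sigma>k k s \<le> \<sigma>k k t" if "s \<le> t" for k s t using \<sigma>k_lip[of k] that by blast
  obtain Ls where Ls: "\<And>k s t. s \<le> t \<Longrightarrow> \<sigma>k k t - \<sigma>k k s \<le> Ls k * (t - s)" using \<sigma>k_lip by metis
  have \<sigma>k_in: "\<sigma>k k t \<in> {0..1}" if t: "t \<in> {a..b}" for k t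
  proof -
    obtain p q where "p \<in> {a..b}" "q \<in> {a..b}" "\<sigma> p \<le> \<sigma>k k t" "\<sigma>k k t \<le> \<sigma> q" using \<sigma>k_near[OF t, of k] by blast
    then show ?thesis using \<sigma>(1)[of p] \<sigma>(1)[of q] by auto
  qed
  have \<sigma>k_cont: "continuous_on {a..b} (\<sigma>k k)" for k
  proof (rule abs_continuous_on_imp_continuous_on, rule abs_continuous_on_lipschitz[of _ _ "Ls k"])
    fix s t :: real assume "s \<le> t"
    then show "norm (\<sigma>k k t - \<sigma>k k s) \<le> Ls k * (t - s)" using \<sigma>k_mono[of s t k] Ls[of s t k] by simp
  qed
  \<comment> \<open>The space-time trajectory read at \<open>\<sigma>k\<close>. In general it is not
    a trajectory of the input \<open>uk k\<close>, since its time
    \<open>\<phi>0 (\<sigma>k k t)\<close> differs from \<open>t\<close>.\<close>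
  define \<eta> where "\<eta> = (\<lambda>k t. y (\<sigma>k k t))"
  define uk where "uk = (\<lambda>k t. \<phi> (\<sigma>k k t))"
  have \<eta>R: "\<eta> k t \<in> cball 0 R" if "t \<in> {a..b}" for k t unfolding \<eta>_def by (rule yR[OF \<sigma>k_in[OF that]])
  have ukU: "uk k t \<in> U" if "t \<in> {a..b}" for k t unfolding uk_def by (rule \<phi>U[OF \<sigma>k_in[OF that]])
  have \<eta>_cont: "continuous_on {a..b} (\<eta> k)" for k
    unfolding \<eta>_def by (rule continuous_on_compose2[OF y_cont \<sigma>k_cont]) (use \<sigma>k_in in auto)
  have uk_cont: "continuous_on {a..b} (uk k)" for k
    unfolding uk_def by (rule continuous_on_compose2[OF \<phi>_cont \<sigma>k_cont]) (use \<sigma>k_in in auto)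
  have \<eta>_lim: "(\<lambda>k. \<eta> k t) \<longlonglongrightarrow> x t" if t: "t \<in> {a..b}" for t
    unfolding \<eta>_def xy[OF t] by (rule continuous_on_tendsto_compose[OF y_cont \<sigma>k_lim[OF t] \<sigma>(1)[OF t]]) (use \<sigma>k_in[OF t] in auto)
  have uk_lim: "(\<lambda>k. uk k t) \<longlonglongrightarrow> u t" if t: "t \<in> {a..b}" for t
    unfolding uk_def \<sigma>(3)[OF t, symmetric]
    by (rule continuous_on_tendsto_compose[OF \<phi>_cont \<sigma>k_lim[OF t] \<sigma>(1)[OF t]]) (use \<sigma>k_in[OF t] in auto)
  have \<eta>m: "\<eta> k \<in> borel_measurable (lebesgue_on {a..b})" and ukm: "uk k \<in> borel_measurable (lebesgue_on {a..b})" for k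
    by (rule continuous_imp_measurable_on_sets_lebesgue[OF \<eta>_cont] continuous_imp_measurable_on_sets_lebesgue[OF uk_cont]; simp)+
  have xm: "x \<in> borel_measurable (lebesgue_on {a..b})"
    by (rule borel_measurable_LIMSEQ_metric[where f=\<eta>]) (use \<eta>m \<eta>_lim in auto)
  have um: "u \<in> borel_measurable (lebesgue_on {a..b})"
    by (rule borel_measurable_LIMSEQ_metric[where f=uk]) (use ukm uk_lim in auto)
  have xR: "x t \<in> cball 0 R" if "t \<in> {a..b}" for t using yR[OF \<sigma>(1)[OF that]] xy[OF that] by simp
  \<comment> \<open>\<open>\<sigma> p\<close> and \<open>\<sigma> q\<close> bracket
    \<open>\<sigma>k k t\<close> and have times \<open>p\<close> and \<open>q\<close>, so the time
    lag is at most the mesh.\<close>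
  have near: "\<bar>\<phi>0 (\<sigma>k k t) - t\<bar> \<le> (b - a) / Suc k" if t: "t \<in> {a..b}" for k t
  proof -
    obtain p q where pq: "p \<in> {a..b}" "q \<in> {a..b}" "p \<le> t" "t \<le> q" "q - p \<le> (b - a) / Suc k" "\<sigma> p \<le> \<sigma>k k t" "\<sigma>k k t \<le> \<sigma> q"
      using \<sigma>k_near[OF t, of k] by blast
    have "\<phi>0 (\<sigma> p) \<le> \<phi>0 (\<sigma>k k t)" "\<phi>0 (\<sigma>k k t) \<le> \<phi>0 (\<sigma> q)"
      using pq \<sigma>(1) \<sigma>k_in[OF t] by (auto intro!: mono_onD[OF mono])
    then show ?thesis using pq \<sigma>(2)[OF pq(1)] \<sigma>(2)[OF pq(2)] by linarith
  qed
  have \<phi>0_in: "\<phi>0 s \<in> {a..b}" if "s \<in> {0..1}" for s using img that by blast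
  \<comment> \<open>\<open>F0\<close> is the drift along \<open>x\<close> and \<open>u\<close>,
    \<open>F k\<close> the drift along the reference curve at the true time \<open>r\<close> instead
    of its own time.\<close>
  define F0 where "F0 = (\<lambda>r. f r (x r) (u r) (v r))"
  define F where "F = (\<lambda>k r. f r (\<eta> k r) (uk k r) (v r))"
  have F0m: "F0 \<in> borel_measurable (lebesgue_on {a..b})" unfolding F0_def by (intro drift_measurable xm um vm vV) auto
  have Fm: "F k \<in> borel_measurable (lebesgue_on {a..b})" for k unfolding F_def by (intro drift_measurable \<eta>m ukm vm vV) auto
  have F0B: "norm (F0 r) \<le> C" if "r \<in> {a..b}" for r unfolding F0_def using that xR uU vV by (intro C(2)) auto
  have FB: "norm (F k r) \<le> C" if "r \<in> {a..b}" for k r unfolding F_def using that \<eta>R ukU vV by (intro C(2)) auto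
  have F0int: "F0 absolutely_integrable_on {a..b}" by (rule bounded_measurable_absolutely_integrable[OF F0m F0B])
  have Fint: "F k absolutely_integrable_on {a..b}" for k by (rule bounded_measurable_absolutely_integrable[OF Fm FB])
  have Flim: "(\<lambda>k. F k r) \<longlonglongrightarrow> F0 r" if r: "r \<in> {a..b}" for r
  proof -
    have "(\<lambda>k. (\<lambda>(x, u, v). f r x u v) (\<eta> k r, uk k r, v r)) \<longlonglongrightarrow> (\<lambda>(x, u, v). f r x u v) (x r, u r, v r)"
    proof (rule continuous_on_tendsto_compose[OF f_continuous[OF r]])
      show "(\<lambda>k. (\<eta> k r, uk k r, v r)) \<longlonglongrightarrow> (x r, u r, v r)"
        by (intro tendsto_Pair tendsto_const \<eta>_lim uk_lim r)
    qed (use vV[OF r] in auto)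
    then show ?thesis by (simp add: F_def F0_def)
  qed
  define H0 where "H0 = (\<lambda>t. integral {a..t} F0)"
  define HF where "HF = (\<lambda>k t. integral {a..t} (F k))"
  have H0_lip: "norm (H0 t - H0 s) \<le> C * \<bar>t - s\<bar>" if "s \<in> {a..b}" "t \<in> {a..b}" for s t
    using integral_lipschitz[OF F0int F0B, of s t] integral_lipschitz[OF F0int F0B, of t s] that
    by (cases "s \<le> t") (auto simp: H0_def norm_minus_commute)
  have \<Phi>_lip: "norm (H0 (\<phi>0 t) - H0 (\<phi>0 s)) \<le> C * L * (t - s)" if "0 \<le> s" "s \<le> t" "t \<le> 1" for s t
  proof -
    have "norm (H0 (\<phi>0 t) - H0 (\<phi>0 s)) \<le> C * \<bar>\<phi>0 t - \<phi>0 s\<bar>" using that by (intro H0_lip \<phi>0_in) auto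
    also have "\<dots> \<le> C * (L * (t - s))" using lip(1)[OF that] C(1) by (rule mult_left_mono)
    finally show ?thesis by (simp add: mult.assoc)
  qed
  \<comment> \<open>In the parameter \<open>s\<close> the input is dominated by
    \<open>L * s\<close>, so the general estimate reads
    \<open>C * (C * L * (t - s) + C * L * (t - s)) * L * (t - s)\<close>.\<close>
  have y_quad: "norm (y t - y s - (H0 (\<phi>0 t) - H0 (\<phi>0 s)) - control_term g (y s) (\<phi> t - \<phi> s)) \<le> 2 * (C * L)\<^sup>2 * (t - s)\<^sup>2"
    if s: "0 \<le> s" "s \<le> t" "t \<le> 1" for s t
  proof -
    have wv: "AE t in lebesgue_on {a..b}. w t = v t" using w by (simp add: borel_representative_def)
    let ?D = "{s \<in> {0..1}. \<not> (\<exists>p. (\<phi>0 has_vector_derivative p) (at s within {0..1}) \<and>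
     ((\<lambda>s. integral {a..\<phi>0 s} F0) has_vector_derivative
        p *\<^sub>R f (\<phi>0 s) (y s) (\<phi> s) (w (\<phi>0 s))) (at s within {0..1}))}"
    have ck: "\<sigma> r \<in> {0..1} \<and> \<phi>0 (\<sigma> r) = r \<and> \<phi> (\<sigma> r) = u r \<and> y (\<sigma> r) = x r" if "r \<in> {a..b}" for r
      using \<sigma>[OF that] xy[OF that] by simp
    have D: "negligible ?D"
      unfolding F0_def
      by (rule space_time_drift_derivative_ae[OF lip(1) mono img ck F0int[unfolded F0_def] F0B[unfolded F0_def] wv])
    let ?N = "{s \<in> {0..1}. \<not> ?ode s} \<union> ({s \<in> {0..1}. \<not> (\<phi> has_vector_derivative h1 s) (at s within {0..1})} \<union> ?D)"
    have N: "negligible ?N" by (rule negligible_Un[OF ode negligible_Un[OF h1 D]])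
    have der: "\<exists>\<phi>' u'. ((\<lambda>s. H0 (\<phi>0 s)) has_vector_derivative \<phi>') (at r within {0..1}) \<and>
        (\<phi> has_vector_derivative u') (at r within {0..1}) \<and>
        (y has_vector_derivative \<phi>' + control_term g (y r) u') (at r within {0..1})" if r: "r \<in> {0..1} - ?N" for r
    proof -
      have r01: "r \<in> {0..1}" and o: "?ode r" and d1: "(\<phi> has_vector_derivative h1 r) (at r within {0..1})" using r by blast+
      obtain p where p: "(\<phi>0 has_vector_derivative p) (at r within {0..1})"
        "((\<lambda>s. H0 (\<phi>0 s)) has_vector_derivative p *\<^sub>R f (\<phi>0 r) (y r) (\<phi> r) (w (\<phi>0 r))) (at r within {0..1})"
        using r unfolding H0_def by blast
      have "(y has_vector_derivative p *\<^sub>R f (\<phi>0 r) (y r) (\<phi> r) (w (\<phi>0 r)) + control_term g (y r) (h1 r)) (at r within {0..1})"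
        using o vd[OF p(1) r01] vd[OF d1 r01] y0_eq[OF r01] by simp
      then show ?thesis using p(2) d1 by blast
    qed
    have ac: "abs_continuous_on {0..1} (\<lambda>s. H0 (\<phi>0 s))"
      by (rule abs_continuous_on_lipschitz[of _ _ "C * L"]) (use \<Phi>_lip in auto)
    have "norm (y t - y s - (H0 (\<phi>0 t) - H0 (\<phi>0 s)) - control_term g (y s) (\<phi> t - \<phi> s))
      \<le> C * (C * L * (t - s) + C * (L * t - L * s)) * (L * t - L * s)"
    proof (rule sewing_estimate_quadratic[where p=0 and q=1 and X=y and \<Phi>="\<lambda>s. H0 (\<phi>0 s)" and u=\<phi> and N="?N" and \<Gamma>="control_term g" and B=C and \<nu>="\<lambda>s. L * s"])
      show "norm (\<phi> t - \<phi> s) \<le> L * t - L * s" if "0 \<le> s" "s \<le> t" "t \<le> 1" for s t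
        using lip(2)[OF that] by (simp add: right_diff_distrib)
    qed (fact y_ac ac \<phi>_ac N bounded_linear_control_term der \<Phi>_lip C(1) s | use C(4,5) yR in blast)+
    also have "\<dots> = 2 * (C * L)\<^sup>2 * (t - s)\<^sup>2" by (simp add: power2_eq_square algebra_simps)
    finally show ?thesis .
  qed

  \<comment> \<open>Truncated trajectories of the regularized inputs\<close>
  let ?P = "closest_point (cball (0::real^'n) R)"
  have P_in: "?P z \<in> cball 0 R" for z using R by (intro closest_point_in_set) auto
  have P_lip: "norm (?P z - ?P z') \<le> norm (z - z')" for z z'
    using closest_point_lipschitz[of "cball 0 R" z z'] R by (simp add: dist_norm)
  have P_id: "?P z = z" if "z \<in> cball 0 R" for z by (rule closest_point_self[OF that])
  \<comment> \<open>The Lipschitz constant of \<open>uk k\<close> depends on \<open>k\<close>, but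
    its variation is dominated by \<open>L * \<sigma>k k\<close>, whose total increase is at most
    \<open>L\<close>.\<close>
  have uk_dom: "norm (uk k t - uk k s) \<le> L * \<sigma>k k t - L * \<sigma>k k s" if "a \<le> s" "s \<le> t" "t \<le> b" for k s t
    unfolding uk_def right_diff_distrib[symmetric]
    using \<sigma>k_in[of s k] \<sigma>k_in[of t k] \<sigma>k_mono[OF that(2), of k] that by (intro lip(2)) auto
  have uk_lip: "norm (uk k t - uk k s) \<le> L * Ls k * (t - s)" if "a \<le> s" "s \<le> t" "t \<le> b" for k s t
    using uk_dom[OF that, of k] mult_left_mono[OF Ls[OF that(2), of k] L0] by (simp add: algebra_simps)
  have uk_ac: "abs_continuous_on {a..b} (uk k)" for k
    by (rule abs_continuous_on_lipschitz[of _ _ "L * Ls k"]) (use uk_lip in auto)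
  have "\<exists>X N. abs_continuous_on {a..b} X \<and> X a = xbar \<and> negligible N \<and>
    (\<forall>t\<in>{a..b} - N. \<exists>u'. (uk k has_vector_derivative u') (at t within {a..b}) \<and>
       (X has_vector_derivative f t (?P (X t)) (uk k t) (v t) + control_term g (?P (X t)) u') (at t within {a..b}))" for k
  proof (rule truncated_solution_exists[OF R, of "uk k" "L * Ls k" v xbar])
    fix X N assume "abs_continuous_on {a..b} X" "X a = xbar" "negligible N"
      "\<And>t. t \<in> {a..b} - N \<Longrightarrow> \<exists>u'. (uk k has_vector_derivative u') (at t within {a..b}) \<and>
       (X has_vector_derivative f t (?P (X t)) (uk k t) (v t) + control_term g (?P (X t)) u') (at t within {a..b})"
    then show ?thesis by blast
  qed (use uk_lip ukU v in auto)
  then obtain X N where X_ac: "\<And>k. abs_continuous_on {a..b} (X k)" and X_a: "\<And>k. X k a = xbar"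
    and N: "\<And>k. negligible (N k)" and X_der: "\<And>k t. t \<in> {a..b} - N k \<Longrightarrow> \<exists>u'. (uk k has_vector_derivative u') (at t within {a..b}) \<and>
       (X k has_vector_derivative f t (?P (X k t)) (uk k t) (v t) + control_term g (?P (X k t)) u') (at t within {a..b})"
    by metis
  define FX where "FX = (\<lambda>k r. f r (?P (X k r)) (uk k r) (v r))"
  have P_cont: "continuous_on UNIV ?P"
    using R by (intro continuous_on_closest_point) auto
  have PXm: "(\<lambda>r. ?P (X k r)) \<in> borel_measurable (lebesgue_on {a..b})" for k
    by (rule continuous_imp_measurable_on_sets_lebesgue[OF continuous_on_compose2[OF P_cont abs_continuous_on_imp_continuous_on[OF X_ac]]]) auto
  have FXm: "FX k \<in> borel_measurable (lebesgue_on {a..b})" for k unfolding FX_def by (intro drift_measurable PXm ukm vm vV) auto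
  have FXB: "norm (FX k r) \<le> C" if "r \<in> {a..b}" for k r unfolding FX_def using that P_in ukU vV by (intro C(2)) auto
  have FXint: "FX k absolutely_integrable_on {a..b}" for k by (rule bounded_measurable_absolutely_integrable[OF FXm FXB])
  define HX where "HX = (\<lambda>k t. integral {a..t} (FX k))"
  have HX_lip: "norm (HX k t - HX k s) \<le> C * (t - s)" if "a \<le> s" "s \<le> t" "t \<le> b" for k s t
    unfolding HX_def by (rule integral_lipschitz[OF FXint FXB that])
  have HX_ac: "abs_continuous_on {a..b} (HX k)" for k
    by (rule abs_continuous_on_lipschitz[of _ _ C]) (use HX_lip in auto)
  have X_quad: "norm (X k t - X k s - (HX k t - HX k s) - control_term g (?P (X k s)) (uk k t - uk k s))
      \<le> C * (C * (t - s) + C * (L * \<sigma>k k t - L * \<sigma>k k s)) * (L * \<sigma>k k t - L * \<sigma>k k s)"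
    if st: "a \<le> s" "s \<le> t" "t \<le> b" for k s t
  proof -
    let ?N = "N k \<union> {t \<in> {a..b}. \<not> (HX k has_vector_derivative FX k t) (at t within {a..b})}"
    have FXi: "FX k integrable_on {a..b}" by (rule set_lebesgue_integral_eq_integral(1)[OF FXint])
    have N': "negligible ?N"
      unfolding HX_def by (rule negligible_Un[OF N indefinite_integral_has_vector_derivative_ae[OF FXi]])
    have der: "\<exists>\<phi>' u'. (HX k has_vector_derivative \<phi>') (at r within {a..b}) \<and>
        (uk k has_vector_derivative u') (at r within {a..b}) \<and>
        (X k has_vector_derivative \<phi>' + control_term g (?P (X k r)) u') (at r within {a..b})" if r: "r \<in> {a..b} - ?N" for r
    proof -
      have "(HX k has_vector_derivative FX k r) (at r within {a..b})" "r \<in> {a..b} - N k" using r by blast+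
      then show ?thesis using X_der[of r k] unfolding FX_def by blast
    qed
    have G_lip: "norm (control_term g (?P z) w' - control_term g (?P z') w') \<le> C * norm (z - z') * norm w'" for z z' w'
    proof -
      have "norm (control_term g (?P z) w' - control_term g (?P z') w') \<le> C * norm (?P z - ?P z') * norm w'"
        by (rule C(5)[OF P_in P_in])
      also have "\<dots> \<le> C * norm (z - z') * norm w'" using P_lip C(1) by (intro mult_right_mono mult_left_mono) auto
      finally show ?thesis .
    qed
    show ?thesis
      by (rule sewing_estimate_quadratic[where p=a and q=b and X="X k" and \<Phi>="HX k" and u="uk k" and N="?N" and \<Gamma>="\<lambda>z. control_term g (?P z)" and B=C and \<nu>="\<lambda>t. L * \<sigma>k k t"])
        (fact X_ac HX_ac uk_ac N' bounded_linear_control_term der HX_lip uk_dom C(1) st | rule G_lip | rule C(4)[OF P_in])+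
  qed

  \<comment> \<open>Comparison of truncated trajectories with reference curves\<close>
  define E where "E = (\<lambda>k t. H0 (\<phi>0 (\<sigma>k k t)) - HF k t)"
  \<comment> \<open>Two sources of error: the time lag, at most the mesh, and the mean distance
    between the drifts \<open>F k\<close> and \<open>F0\<close>.\<close>
  define e where "e = (\<lambda>k. C * ((b - a) / Suc k) + integral {a..b} (\<lambda>r. norm (F k r - F0 r)))"
  have FF0int: "(\<lambda>r. F k r - F0 r) absolutely_integrable_on {a..b}" for k
    by (rule set_integral_diff(1)[OF Fint F0int])
  then have nint: "(\<lambda>r. norm (F k r - F0 r)) integrable_on {a..b}" for k
    by (simp add: absolutely_integrable_on_def)
  have e0: "0 \<le> e k" for k
    unfolding e_def using C(1) ab nint by (intro add_nonneg_nonneg mult_nonneg_nonneg integral_nonneg) auto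
  have e_lim: "e \<longlonglongrightarrow> 0"
  proof -
    have "(\<lambda>k. integral {a..b} (\<lambda>r. norm (F k r - F0 r))) \<longlonglongrightarrow> integral {a..b} (\<lambda>r. 0)"
    proof (rule dominated_convergence(2)[where h="\<lambda>_. C + C"])
      show "norm (norm (F k r - F0 r)) \<le> C + C" if "r \<in> {a..b}" for k r
        using norm_triangle_ineq4[of "F k r" "F0 r"] FB[OF that, of k] F0B[OF that] by simp
      show "(\<lambda>k. norm (F k r - F0 r)) \<longlonglongrightarrow> 0" if "r \<in> {a..b}" for r
        using Flim[OF that] by (intro tendsto_norm_zero) (simp add: LIM_zero)
    qed (use nint in auto)
    then have 1: "(\<lambda>k. integral {a..b} (\<lambda>r. norm (F k r - F0 r))) \<longlonglongrightarrow> 0" by simp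
    have 2: "(\<lambda>k. C * ((b - a) * inverse (real (Suc k)))) \<longlonglongrightarrow> C * ((b - a) * 0)"
      by (intro tendsto_intros LIMSEQ_inverse_real_of_nat)
    show ?thesis using tendsto_add[OF 2 1] by (simp add: e_def divide_inverse)
  qed
  have E_le: "norm (E k t) \<le> e k" if t: "t \<in> {a..b}" for k t
  proof -
    have i: "F k integrable_on {a..t}" "F0 integrable_on {a..t}" "(\<lambda>r. norm (F k r - F0 r)) integrable_on {a..t}"
      by (rule integrable_subinterval_real[of _ a b]; use set_lebesgue_integral_eq_integral(1)[OF Fint] set_lebesgue_integral_eq_integral(1)[OF F0int] nint t in auto)+
    have "E k t = (H0 (\<phi>0 (\<sigma>k k t)) - H0 t) - integral {a..t} (\<lambda>r. F k r - F0 r)"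
      unfolding E_def HF_def H0_def integral_diff[OF i(1,2)] by simp
    then have "norm (E k t) \<le> norm (H0 (\<phi>0 (\<sigma>k k t)) - H0 t) + norm (integral {a..t} (\<lambda>r. F k r - F0 r))"
      by (simp only: norm_triangle_ineq4)
    also have "norm (H0 (\<phi>0 (\<sigma>k k t)) - H0 t) \<le> C * \<bar>\<phi>0 (\<sigma>k k t) - t\<bar>"
      by (rule H0_lip[OF t \<phi>0_in[OF \<sigma>k_in[OF t]]])
    also have "\<dots> \<le> C * ((b - a) / Suc k)" by (rule mult_left_mono[OF near[OF t] C(1)])
    also have "norm (integral {a..t} (\<lambda>r. F k r - F0 r)) \<le> integral {a..t} (\<lambda>r. norm (F k r - F0 r))"
      using i by (intro integral_norm_bound_integral integrable_diff) auto
    also have "\<dots> \<le> integral {a..b} (\<lambda>r. norm (F k r - F0 r))"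
      using t by (intro integral_subset_le i nint) auto
    finally show ?thesis by (simp add: e_def)
  qed
  \<comment> \<open>Adding \<open>E\<close> exchanges the drift integral
    \<open>H0 (\<phi>0 (\<sigma>k k t))\<close> of the reference curve for \<open>HF k t\<close>,
    whose integrand can be compared pointwise with that of \<open>HX k\<close>. \<open>E\<close>
    itself then enters only through its bound \<open>e k\<close>.\<close>
  define D where "D = (\<lambda>k t. X k t - \<eta> k t + E k t)"
  \<comment> \<open>It grows with time and, up to the factor \<open>L\<close>, with the variation of
    the input.\<close>
  define \<mu> where "\<mu> = (\<lambda>k t. t + \<sigma>k k t)"
  have \<mu>_mono: "\<mu> k s \<le> \<mu> k t" if "s \<le> t" for k s t using \<sigma>k_mono[OF that, of k] that by (simp add: \<mu>_def)
  have \<mu>_cont: "continuous_on {a..b} (\<mu> k)" for k unfolding \<mu>_def by (intro continuous_intros \<sigma>k_cont)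
  \<comment> \<open>The remainders of the two increment estimates are quadratic in the increment of
    \<open>\<mu>\<close> and vanish under refinement. What remains is the drift difference
    \<open>?I\<close> and the field difference \<open>?J\<close>, both proportional to
    \<open>B + e k\<close>.\<close>
  have D_inc: "norm (D k t - D k s) \<le> C * (1 + L) * (B + e k) * (\<mu> k t - \<mu> k s)"
    if st: "a \<le> s" "s \<le> t" "t \<le> b" and B: "\<And>r. s \<le> r \<Longrightarrow> r \<le> t \<Longrightarrow> norm (D k r) \<le> B" for k s t B
  proof (rule quadratic_error_negligible[where C="C * (C * (1 + L)) * L + 2 * (C * L)\<^sup>2"])
    show "continuous_on {s..t} (\<mu> k)" using st by (intro continuous_on_subset[OF \<mu>_cont]) auto
    show "s \<le> t" by (rule st)
    show "0 \<le> C * (C * (1 + L)) * L + 2 * (C * L)\<^sup>2" using C(1) L0 by simp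
    show "\<mu> k s' \<le> \<mu> k t'" if "s' \<le> t'" for s' t' by (rule \<mu>_mono[OF that])
    fix s' t' assume st': "s \<le> s'" "s' \<le> t'" "t' \<le> t"
    have i': "a \<le> s'" "s' \<le> t'" "t' \<le> b" "s' \<in> {a..b}" "t' \<in> {a..b}" using st st' by auto
    have B0: "0 \<le> B" using B[of s] st norm_ge_zero[of "D k s"] by linarith
    \<comment> \<open>The projection fixes \<open>\<eta> k r\<close>, and \<open>D\<close> differs
      from \<open>X - \<eta>\<close> by \<open>E\<close> only.\<close>
    have XE: "norm (?P (X k r) - \<eta> k r) \<le> B + e k" if r: "s' \<le> r" "r \<le> t'" for r
    proof -
      have rab: "r \<in> {a..b}" using r i' by auto
      have "norm (?P (X k r) - \<eta> k r) = norm (?P (X k r) - ?P (\<eta> k r))" by (simp only: P_id[OF \<eta>R[OF rab]])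
      also have "\<dots> \<le> norm (X k r - \<eta> k r)" by (rule P_lip)
      also have "X k r - \<eta> k r = D k r - E k r" by (simp add: D_def)
      also have "norm \<dots> \<le> norm (D k r) + norm (E k r)" by (rule norm_triangle_ineq4)
      also have "\<dots> \<le> B + e k" using B[of r] E_le[OF rab, of k] r st' by (intro add_mono) auto
      finally show ?thesis .
    qed
    define dt where "dt = t' - s'"
    define ds where "ds = \<sigma>k k t' - \<sigma>k k s'"
    have dt: "0 \<le> dt" using st' by (simp add: dt_def)
    have ds: "0 \<le> ds" using \<sigma>k_mono[OF st'(2), of k] by (simp add: ds_def)
    have d\<mu>: "\<mu> k t' - \<mu> k s' = dt + ds" by (simp add: \<mu>_def dt_def ds_def)
    let ?du = "uk k t' - uk k s'"
    let ?O1 = "X k t' - X k s' - (HX k t' - HX k s') - control_term g (?P (X k s')) ?du"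
    let ?O2 = "\<eta> k t' - \<eta> k s' - (H0 (\<phi>0 (\<sigma>k k t')) - H0 (\<phi>0 (\<sigma>k k s'))) - control_term g (\<eta> k s') ?du"
    let ?I = "(HX k t' - HX k s') - (HF k t' - HF k s')"
    let ?J = "control_term g (?P (X k s')) ?du - control_term g (\<eta> k s') ?du"
    have "D k t' - D k s' = (?O1 - ?O2) + (?I + ?J)" by (simp add: D_def E_def)
    then have "norm (D k t' - D k s') \<le> (norm ?O1 + norm ?O2) + (norm ?I + norm ?J)"
      by (simp only:) (intro norm_triangle_mono order_trans[OF norm_triangle_ineq4] order_refl)
    moreover have "norm ?O1 \<le> C * (C * (1 + L)) * L * (dt + ds)\<^sup>2"
    proof -
      have "norm ?O1 \<le> C * (C * dt + C * (L * ds)) * (L * ds)"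
        using X_quad[OF i'(1-3), of k] by (simp only: dt_def ds_def right_diff_distrib)
      also have "\<dots> \<le> C * (C * (1 + L) * (dt + ds)) * (L * (dt + ds))"
      proof (intro mult_mono)
        have "C * dt + C * (L * ds) \<le> C * dt + C * (L * ds) + (C * ds + C * (L * dt))"
          using C(1) L0 dt ds by simp
        also have "\<dots> = C * (1 + L) * (dt + ds)" by (simp add: algebra_simps)
        finally show "C * dt + C * (L * ds) \<le> C * (1 + L) * (dt + ds)" .
      qed (use C(1) L0 dt ds in auto)
      also have "\<dots> = C * (C * (1 + L)) * L * (dt + ds)\<^sup>2" by (simp add: power2_eq_square)
      finally show ?thesis .
    qed
    moreover have "norm ?O2 \<le> 2 * (C * L)\<^sup>2 * (dt + ds)\<^sup>2"
    proof -
      have "norm ?O2 \<le> 2 * (C * L)\<^sup>2 * ds\<^sup>2"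
        unfolding \<eta>_def uk_def ds_def
        using \<sigma>k_in[OF i'(4), of k] \<sigma>k_in[OF i'(5), of k] \<sigma>k_mono[OF st'(2), of k] by (intro y_quad) auto
      also have "\<dots> \<le> 2 * (C * L)\<^sup>2 * (dt + ds)\<^sup>2" using dt ds by (intro mult_left_mono power_mono) auto
      finally show ?thesis .
    qed
    moreover have "norm ?I \<le> C * (B + e k) * dt"
    proof -
      have int: "FX k integrable_on {s'..t'}" "F k integrable_on {s'..t'}"
        by (rule integrable_subinterval_real[of _ a b]; use set_lebesgue_integral_eq_integral(1)[OF FXint] set_lebesgue_integral_eq_integral(1)[OF Fint] i' in auto)+
      have "?I = integral {s'..t'} (\<lambda>r. FX k r - F k r)"
        unfolding HX_def HF_def integral_increment[OF FXint i'(1-3)] integral_increment[OF Fint i'(1-3)] integral_diff[OF int] ..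
      moreover have "norm (integral {s'..t'} (\<lambda>r. FX k r - F k r)) \<le> C * (B + e k) * measure lborel {s'..t'}"
      proof (rule has_integral_bound_real)
        show "((\<lambda>r. FX k r - F k r) has_integral integral {s'..t'} (\<lambda>r. FX k r - F k r)) {s'..t'}"
          by (intro integrable_integral integrable_diff int)
        show "0 \<le> C * (B + e k)" using C(1) B0 e0[of k] by simp
        show "norm (FX k r - F k r) \<le> C * (B + e k)" if r: "r \<in> {s'..t'} - {}" for r
        proof -
          have rab: "r \<in> {a..b}" using r i' by auto
          have "norm (FX k r - F k r) \<le> C * norm (?P (X k r) - \<eta> k r)"
            unfolding FX_def F_def by (rule C(3)[OF rab P_in \<eta>R[OF rab] ukU[OF rab] vV[OF rab]])
          also have "\<dots> \<le> C * (B + e k)" using XE[of r] r C(1) by (intro mult_left_mono) auto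
          finally show ?thesis .
        qed
      qed auto
      ultimately show ?thesis using dt by (simp add: dt_def)
    qed
    moreover have "norm ?J \<le> C * (B + e k) * (L * ds)"
    proof -
      have "norm ?J \<le> C * norm (?P (X k s') - \<eta> k s') * norm ?du" by (rule C(5)[OF P_in \<eta>R[OF i'(4)]])
      also have "\<dots> \<le> C * (B + e k) * (L * ds)"
        using XE[of s'] uk_dom[OF i'(1-3), of k] C(1) B0 e0[of k] st'(2)
        by (intro mult_mono mult_left_mono) (auto simp: ds_def right_diff_distrib)
      finally show ?thesis .
    qed
    moreover have "C * (B + e k) * dt + C * (B + e k) * (L * ds) \<le> C * (1 + L) * (B + e k) * (dt + ds)"
    proof -
      have "0 \<le> C * (B + e k) * (ds + L * dt)" using C(1) B0 e0[of k] L0 dt ds by simp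
      then show ?thesis by (simp add: algebra_simps)
    qed
    ultimately have "norm (D k t' - D k s') \<le> C * (1 + L) * (B + e k) * (dt + ds) +
        (C * (C * (1 + L)) * L * (dt + ds)\<^sup>2 + 2 * (C * L)\<^sup>2 * (dt + ds)\<^sup>2)" by linarith
    then show "norm (D k t' - D k s') \<le> C * (1 + L) * (B + e k) * (\<mu> k t' - \<mu> k s') +
        (C * (C * (1 + L)) * L + 2 * (C * L)\<^sup>2) * (\<mu> k t' - \<mu> k s')\<^sup>2"
      unfolding d\<mu> by (simp only: distrib_right)
  qed
  \<comment> \<open>The increase of every \<open>\<mu> k\<close> is at most
    \<open>b - a + 1\<close>, so \<open>n\<close> does not depend on \<open>k\<close> and
    \<open>2 ^ n * e k\<close> tends to 0.\<close>
  obtain n :: nat where n: "2 * (C * (1 + L)) * (b - a + 1) \<le> real n" using real_arch_simple by blast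
  have X_close: "norm (X k t - \<eta> k t) \<le> 2 ^ n * e k" if t: "t \<in> {a..b}" for k t
  proof -
    have "norm (D k t) \<le> (2 ^ n - 1) * e k"
    proof (rule gronwall_increments[where a=a and b=b and \<mu>="\<mu> k" and L="C * (1 + L)" and D="D k"])
      have "continuous_on {a..b} (\<lambda>t. H0 (\<phi>0 (\<sigma>k k t)))"
      proof (rule continuous_on_compose2[of "{0..1}" "\<lambda>s. H0 (\<phi>0 s)"])
        show "continuous_on {0..1} (\<lambda>s. H0 (\<phi>0 s))"
          by (rule abs_continuous_on_imp_continuous_on, rule abs_continuous_on_lipschitz[of _ _ "C * L"]) (use \<Phi>_lip in auto)
      qed (use \<sigma>k_cont \<sigma>k_in in auto)
      moreover have "continuous_on {a..b} (HF k)"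
        unfolding HF_def by (rule indefinite_integral_continuous_1[OF set_lebesgue_integral_eq_integral(1)[OF Fint]])
      ultimately show "continuous_on {a..b} (D k)"
        unfolding D_def E_def by (intro continuous_intros \<eta>_cont abs_continuous_on_imp_continuous_on[OF X_ac])
      \<comment> \<open>This is where \<open>\<sigma>k k a = \<sigma> a\<close> matters: the
        reference curve starts exactly at \<open>xbar\<close> and at time \<open>a\<close>.\<close>
      show "D k a = 0"
        using X_a[of k] \<sigma>k_a[of k] xy[of a] xa \<sigma>(2)[of a] ab by (simp add: D_def \<eta>_def E_def H0_def HF_def)
      have "\<mu> k t - \<mu> k a \<le> b - a + 1"
        using \<sigma>k_in[OF t, of k] \<sigma>k_in[of a k] t ab by (auto simp: \<mu>_def)
      then have "2 * (C * (1 + L)) * (\<mu> k t - \<mu> k a) \<le> 2 * (C * (1 + L)) * (b - a + 1)"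
        using C(1) L0 by (intro mult_left_mono) auto
      then show "2 * (C * (1 + L)) * (\<mu> k t - \<mu> k a) \<le> real n" using n by linarith
    qed (use D_inc \<mu>_cont \<mu>_mono C(1) L0 e0 t in auto)
    moreover have "norm (X k t - \<eta> k t) \<le> norm (D k t) + norm (E k t)"
      using norm_triangle_ineq4[of "D k t" "E k t"] by (simp add: D_def)
    ultimately show ?thesis using E_le[OF t, of k] by (simp add: algebra_simps)
  qed
  have en_lim: "(\<lambda>k. 2 ^ n * e k) \<longlonglongrightarrow> 0" using tendsto_mult_left[OF e_lim, of "2 ^ n"] by simp
  then have "\<forall>\<^sub>F k in sequentially. 2 ^ n * e k < 1" by (rule order_tendstoD) simp
  then obtain k0 where k0: "\<And>k. k \<ge> k0 \<Longrightarrow> 2 ^ n * e k < 1" unfolding eventually_sequentially by blast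
  \<comment> \<open>From \<open>k0\<close> on the trajectories stay in the ball, where the
    projection is the identity; hence the shift of the sequence by \<open>k0\<close>.\<close>
  have XR: "X (k + k0) t \<in> cball 0 R" if t: "t \<in> {a..b}" for k t
  proof -
    have "norm (X (k + k0) t) \<le> norm (\<eta> (k + k0) t) + norm (X (k + k0) t - \<eta> (k + k0) t)"
      using norm_triangle_ineq[of "\<eta> (k + k0) t" "X (k + k0) t - \<eta> (k + k0) t"] by simp
    also have "norm (\<eta> (k + k0) t) \<le> Cy" using Cy(2) \<sigma>k_in[OF t] by (auto simp: \<eta>_def)
    also have "norm (X (k + k0) t - \<eta> (k + k0) t) \<le> 1" using X_close[OF t, of "k + k0"] k0[of "k + k0"] by linarith
    finally show ?thesis by (simp add: R_def)
  qed
  have X_lim: "(\<lambda>k. X k t) \<longlonglongrightarrow> x t" if t: "t \<in> {a..b}" for t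
  proof -
    have "(\<lambda>k. X k t - \<eta> k t) \<longlonglongrightarrow> 0"
      by (rule Lim_null_comparison[OF always_eventually en_lim]) (use X_close[OF t] in blast)
    from tendsto_add[OF this \<eta>_lim[OF t]] show ?thesis by simp
  qed
  have sol: "caratheodory_solution f g a b xbar (uk (k + k0)) v (X (k + k0))" for k
    unfolding caratheodory_solution_def control_term_def[symmetric]
  proof (intro conjI X_ac X_a)
    let ?k = "k + k0"
    show "AE t in lebesgue_on {a..b}. (X ?k has_vector_derivative
       f t (X ?k t) (uk ?k t) (v t) + control_term g (X ?k t) (vector_derivative (uk ?k) (at t within {a..b}))) (at t within {a..b})"
    proof (subst AE_lebesgue_on_iff_negligible, simp, rule negligible_subset[OF N[of ?k]], rule subsetI, rule ccontr)
      fix t assume bad: "t \<in> {t \<in> {a..b}. \<not> (X ?k has_vector_derivative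
       f t (X ?k t) (uk ?k t) (v t) + control_term g (X ?k t) (vector_derivative (uk ?k) (at t within {a..b}))) (at t within {a..b})}"
        and "t \<notin> N ?k"
      then have t: "t \<in> {a..b}" "t \<in> {a..b} - N ?k" by blast+
      from X_der[OF t(2)] obtain u' where u': "(uk ?k has_vector_derivative u') (at t within {a..b})"
        "(X ?k has_vector_derivative f t (?P (X ?k t)) (uk ?k t) (v t) + control_term g (?P (X ?k t)) u') (at t within {a..b})" by blast
      have "vector_derivative (uk ?k) (at t within {a..b}) = u'"
        using vector_derivative_within_cbox[of a b t "uk ?k" u'] a_less_b t u'(1) by simp
      then show False using bad u'(2) P_id[OF XR[OF t(1), of k]] by simp
    qed
  qed

  \<comment> \<open>Bounded variation of the inputs and convergence of the trajectories\<close>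
  obtain CU where CU: "\<And>z. z \<in> U \<Longrightarrow> norm z \<le> CU" using compact_imp_bounded[OF compact_U] unfolding bounded_iff by blast
  show ?thesis
    unfolding BV_simple_limit_solution_def
  proof (intro exI[of _ "\<lambda>k. uk (k + k0)"] conjI allI ballI)
    show "uk (k + k0) \<in> AC_maps {a..b} U" for k using uk_ac ukU by (auto simp: AC_maps_def)
    show "\<exists>K. \<forall>k. total_variation a b (uk (k + k0)) \<le> ennreal K"
    proof (intro exI[of _ L] allI)
      fix k
      have "total_variation a b (uk (k + k0)) \<le> ennreal (L * \<sigma>k (k + k0) b - L * \<sigma>k (k + k0) a)"
        by (rule total_variation_le_dominated[OF ab, of _ "\<lambda>t. L * \<sigma>k (k + k0) t"]) (rule uk_dom)
      also have "\<dots> \<le> ennreal L"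
      proof (rule ennreal_leI)
        have "L * (\<sigma>k (k + k0) b - \<sigma>k (k + k0) a) \<le> L * 1"
          using \<sigma>k_in[of a "k + k0"] \<sigma>k_in[of b "k + k0"] ab L0 by (intro mult_left_mono) auto
        then show "L * \<sigma>k (k + k0) b - L * \<sigma>k (k + k0) a \<le> L" by (simp add: right_diff_distrib)
      qed
      finally show "total_variation a b (uk (k + k0)) \<le> ennreal L" .
    qed
    fix \<tau> assume \<tau>: "\<tau> \<in> {a..b}"
    show "approximates_at f g a b xbar u v x \<tau> (\<lambda>k. uk (k + k0))"
      unfolding approximates_at_def
    proof (intro exI[of _ "\<lambda>k. X (k + k0)"] conjI allI)
      show "caratheodory_solution f g a b xbar (uk (k + k0)) v (X (k + k0))" for k by (rule sol)
      show "\<exists>C. \<forall>k. \<forall>t\<in>{a..b}. norm (X (k + k0) t) \<le> C" using XR by (intro exI[of _ R]) auto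
      show "tendsto_at_and_L1 {a..b} \<tau> (\<lambda>k t. (X (k + k0) t, uk (k + k0) t)) (\<lambda>t. (x t, u t))"
      proof (rule tendsto_at_and_L1I[where B="R + CU", OF _ _ _ \<tau>])
        show "(\<lambda>t. (X (k + k0) t, uk (k + k0) t)) \<in> borel_measurable (lebesgue_on {a..b})" for k
          by (intro borel_measurable_Pair ukm continuous_imp_measurable_on_sets_lebesgue abs_continuous_on_imp_continuous_on X_ac) auto
        show "norm (X (k + k0) t, uk (k + k0) t) \<le> R + CU" if "t \<in> {a..b}" for k t
          using norm_Pair_le[of "X (k + k0) t" "uk (k + k0) t"] XR[OF that, of k] CU[OF ukU[OF that, of "k + k0"]] by simp
        show "(\<lambda>k. (X (k + k0) t, uk (k + k0) t)) \<longlonglongrightarrow> (x t, u t)" if "t \<in> {a..b}" for t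
          using LIMSEQ_ignore_initial_segment[OF X_lim[OF that]] LIMSEQ_ignore_initial_segment[OF uk_lim[OF that]]
          by (intro tendsto_Pair) auto
      qed
    qed
  qed
qed

end

section \<open>The one-point interval\<close>

lemma gc_solution_degenerate_interval:
  assumes V: "closed V" and v: "v \<in> L1_maps {a..a} V" and u: "u a \<in> U"
  shows "gc_solution f g a a U V xbar u v x \<longleftrightarrow> x a = xbar"
proof
  assume x: "x a = xbar"
  obtain w where w: "borel_representative a a V v w" using borel_representative_exists[OF order_refl V v] by blast
  have z: "vector_derivative (\<lambda>_. c) (at s within {0..1}) = 0" if "s \<in> {0..1}" for c :: "'z::euclidean_space" and s :: real
    using vector_derivative_within_cbox[of 0 1 s "\<lambda>_. c" 0] that by simp
  \<comment> \<open>The completion rests at \<open>(a, u a)\<close> for all parameters, so all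
    derivatives vanish and the solution is constant.\<close>
  have "space_time_solution f g a xbar (\<lambda>_. a) (\<lambda>_. u a) (w \<circ> (\<lambda>_. a)) (\<lambda>_. a) (\<lambda>_. xbar)"
    unfolding space_time_solution_def
  proof (intro conjI)
    show "abs_continuous_on {0..1} (\<lambda>_. a)" "abs_continuous_on {0..1} (\<lambda>_. xbar)"
      by (rule abs_continuous_on_lipschitz[of _ _ 0], simp)+
  qed (auto simp: z intro!: AE_I2)
  moreover have "graph_completion a a U u (\<lambda>_. a) (\<lambda>_. u a)"
    using u unfolding graph_completion_def space_time_controls_def
    by (auto simp: image_constant_conv intro!: exI[of _ 0] lipschitz_onI mono_onI bexI[of _ "0::real"])
  moreover have "is_clock a a u (\<lambda>_. a) (\<lambda>_. u a) (\<lambda>_. 0)" by (simp add: is_clock_def)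
  ultimately show "gc_solution f g a a U V xbar u v x"
    using w x unfolding gc_solution_def by fastforce
qed (simp add: gc_solution_def)

text \<open>A point is negligible, so the differential equation is vacuous and \<open>u\<close>
  itself, repeated, is an admissible approximating sequence; only the initial value remains as a
  condition.\<close>

lemma BV_simple_limit_solution_degenerate_interval:
  assumes u: "u a \<in> U"
  shows "BV_simple_limit_solution f g a a U xbar u v x \<longleftrightarrow> x a = xbar"
proof
  assume "BV_simple_limit_solution f g a a U xbar u v x"
  then obtain uk where "approximates_at f g a a xbar u v x a uk"
    unfolding BV_simple_limit_solution_def by auto
  then obtain xk where xk: "\<And>k. caratheodory_solution f g a a xbar (uk k) v (xk k)"
    and lim: "tendsto_at_and_L1 {a..a} a (\<lambda>k t. (xk k t, uk k t)) (\<lambda>t. (x t, u t))"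
    unfolding approximates_at_def by blast
  have "xk k a = xbar" for k using xk[of k] by (simp add: caratheodory_solution_def)
  then show "x a = xbar"
    using tendsto_fst[OF tendsto_at_and_L1_imp_tendsto[OF lim]] by (simp add: LIMSEQ_const_iff)
next
  assume x: "x a = xbar"
  have ac: "abs_continuous_on {a..a} h" for h :: "real \<Rightarrow> 'z::euclidean_space"
    by (rule abs_continuous_on_lipschitz[of _ _ 0]) auto
  show "BV_simple_limit_solution f g a a U xbar u v x"
    unfolding BV_simple_limit_solution_def
  proof (intro exI[of _ "\<lambda>_. u"] conjI allI ballI)
    show "u \<in> AC_maps {a..a} U" using u ac by (auto simp: AC_maps_def)
    show "\<exists>K. \<forall>k::nat. total_variation a a u \<le> ennreal K"
    proof (intro exI[of _ 0] allI)
      have "norm (u t - u s) \<le> 0 - 0" if "a \<le> s" "s \<le> t" "t \<le> a" for s t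
      proof -
        have "s = a" "t = a" using that by auto
        then show ?thesis by simp
      qed
      from total_variation_le_dominated[OF order_refl this] show "total_variation a a u \<le> ennreal 0" by simp
    qed
    fix \<tau> assume \<tau>: "\<tau> \<in> {a..a}"
    show "approximates_at f g a a xbar u v x \<tau> (\<lambda>_. u)"
      unfolding approximates_at_def
    proof (intro exI[of _ "\<lambda>_. x"] conjI allI)
      have "negligible {t \<in> {a..a}. P t}" for P
        by (rule negligible_subset[of "{a}"]) auto
      then show "caratheodory_solution f g a a xbar u v x"
        unfolding caratheodory_solution_def using ac x by (simp add: AE_lebesgue_on_iff_negligible del: atLeastAtMost_singleton)
      show "\<exists>C. \<forall>k::nat. \<forall>t\<in>{a..a}. norm (x t) \<le> C" by auto
      show "tendsto_at_and_L1 {a..a} \<tau> (\<lambda>k t. (x t, u t)) (\<lambda>t. (x t, u t))"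
      proof (rule tendsto_at_and_L1I[where B="norm (x a, u a)", OF _ _ _ \<tau>])
        show "(\<lambda>t. (x t, u t)) \<in> borel_measurable (lebesgue_on {a..a})"
          by (rule continuous_imp_measurable_on_sets_lebesgue[OF abs_continuous_on_imp_continuous_on[OF ac]]) auto
      qed auto
    qed
  qed
qed

theorem theorem4p2:
  fixes f :: "real \<Rightarrow> real^'n \<Rightarrow> real^'m \<Rightarrow> real^'l \<Rightarrow> real^'n"
    and g :: "'m \<Rightarrow> real^'n \<Rightarrow> real^'n"
    and a b :: real
    and U :: "(real^'m) set" and V :: "(real^'l) set"
    and xbar :: "real^'n"
    and u :: "real \<Rightarrow> real^'m" and v :: "real \<Rightarrow> real^'l"
    and x :: "real \<Rightarrow> real^'n"
  assumes "a \<le> b"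
    and "compact U" and "AC_approximable U"
    and "compact V"
    and "\<forall>x u. \<forall>v\<in>V. (\<lambda>t. f t x u v) \<in> borel_measurable (lebesgue_on {a..b})"
    and "\<forall>t\<in>{a..b}. continuous_on (UNIV \<times> UNIV \<times> V) (\<lambda>(x, u, v). f t x u v)"
    and "\<forall>z. \<exists>r>0. \<exists>L. \<forall>t\<in>{a..b}. \<forall>v\<in>V. L-lipschitz_on (cball z r) (\<lambda>(x, u). f t x u v)"
    and "\<forall>\<alpha>. C1_map (g \<alpha>)"
    and "\<exists>M>0. \<forall>x u. \<forall>t\<in>{a..b}. \<forall>v\<in>V.
           norm (f t x u v, \<chi> \<alpha>. g \<alpha> x) \<le> M * (1 + norm (x, u))"
    and "u \<in> BV_maps a b U"
    and "v \<in> L1_maps {a..b} V"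
  shows "gc_solution f g a b U V xbar u v x \<longleftrightarrow> BV_simple_limit_solution f g a b U xbar u v x"
proof (cases "a = b")
  case True
  then have "u a \<in> U" using assms(10) by (auto simp: BV_maps_def)
  then show ?thesis
    using True gc_solution_degenerate_interval[of V v a u U f g xbar x] compact_imp_closed[OF assms(4)] assms(11)
      BV_simple_limit_solution_degenerate_interval[of u a U f g xbar v x] by simp
next
  case False
  interpret control_system f g a b U V
    by unfold_locales (use assms False in auto)
  show ?thesis
    using gc_solution_imp_BV_simple_limit_solution[OF _ assms(11)]
      BV_simple_limit_solution_imp_gc_solution[OF _ compact_imp_closed[OF assms(4)] assms(11)] by blast
qed

end
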